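(* Let $\Gamma$ be a reduced Quadratic Baumslag–Solitar (QBS) graph, and let $G=\pi_1(\Gamma)$. Assume $G\not\cong\mathbb{Z}$. Then $G$ is one-ended.
   Context: A graph of groups $\Gamma$ is a connected graph (oriented edges; loops and multiple edges allowed) with a group $G_v$ for each vertex, a group $G_e$ for each edge, and injective homomorphisms $\partial_e^\pm:G_e\to G_{v^\pm}$, where $v^\pm$ are the endpoints of $e$ (two separate maps even if $e$ is a loop); $\pi_1(\Gamma)$ is its fundamental group. An elementary collapse is the collapse of an edge $e$ with distinct endpoints such that $\partial_e^+$ or $\partial_e^-$ is an isomorphism; $\Gamma$ is reduced if it admits no elementary collapse. A QBS graph is a graph of groups whose edge groups are infinite cyclic and each of whose vertex groups is either infinite cyclic or a quadratically hanging (QH) surface group. Here $G_v$ is a QH surface group if (1) $G_v\cong\pi_1(S)$ for a surface $S$, i.e. it has one of the presentations $\langle a_1,\dots,a_g,b_1,\dots,b_g,p_1,\dots,p_m\mid \prod_k p_k\prod_j[a_j,b_j]=1\rangle$ or $\langle a_1,\dots,a_g,p_1,\dots,p_m\mid\prod_k p_k\prod_j a_j^2=1\rangle$, where the $p_k$ are the boundary classes; and (2) the edges $e_1,\dots,e_m$ from $v$ are in correspondence with the components of $\partial S$, the boundary map of $e_i$ at $v$ sending $G_{e_i}$ into $\langle p_i\rangle$. A space $X$ is one-ended if there is a sequence of compact sets $K_n$ such that $X=\bigcup_n K_n$ and $X-K_n$ is connected for all $n$. A group is one-ended if one (equivalently, all) of its Cayley graphs is one-ended; equivalently, for $G$ finitely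 generated, if it acts freely and cocompactly on a one-ended space.
   Formalization: The graph Γ is assumed finite (finitely many vertices and edges); an infinite reduced QBS graph has a fundamental group that is not finitely generated, for which one-endedness via Cayley graphs is not well defined. *)

theory Defs
  imports "HOL-Analysis.Analysis" "HOL-Algebra.Elementary_Groups"
begin

section \<open>Groups given by presentations\<close>

text \<open>
  The letter \<open>(x, True)\<close> stands for the generator \<open>x\<close> and \<open>(x, False)\<close> for its inverse.
  Two words over \<open>X\<close> represent the same element of \<open>\<langle>X | R\<rangle>\<close> iff they are joined by finitely
  many insertions and deletions of cancelling pairs and of relators.
\<close>

type_synonym 'x word = "('x \<times> bool) list"

abbreviation gen :: "'x \<Rightarrow> 'x \<times> bool" where "gen x \<equiv> (x, True)"
abbreviation gen_inv :: "'x \<Rightarrow> 'x \<times> bool" where "gen_inv x \<equiv> (x, False)"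

definition words :: "'x set \<Rightarrow> 'x word set" where
  "words X = lists (X \<times> UNIV)"

inductive word_eq :: "'x set \<Rightarrow> 'x word set \<Rightarrow> 'x word \<Rightarrow> 'x word \<Rightarrow> bool"
  for X :: "'x set" and R :: "'x word set" where
  refl: "w \<in> words X \<Longrightarrow> word_eq X R w w"
| sym: "word_eq X R u w \<Longrightarrow> word_eq X R w u"
| trans: "word_eq X R u v \<Longrightarrow> word_eq X R v w \<Longrightarrow> word_eq X R u w"
| cancel: "u \<in> words X \<Longrightarrow> w \<in> words X \<Longrightarrow> x \<in> X \<Longrightarrow>
    word_eq X R (u @ [(x, s), (x, \<not> s)] @ w) (u @ w)"
| relator: "u \<in> words X \<Longrightarrow> w \<in> words X \<Longrightarrow> r \<in> R \<Longrightarrow> r \<in> words X \<Longrightarrow>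
    word_eq X R (u @ r @ w) (u @ w)"

definition word_class :: "'x set \<Rightarrow> 'x word set \<Rightarrow> 'x word \<Rightarrow> 'x word set" where
  "word_class X R w = {w'. word_eq X R w w'}"

definition presented_group :: "'x set \<Rightarrow> 'x word set \<Rightarrow> 'x word set monoid" where
  "presented_group X R =
    \<lparr>carrier = word_class X R ` words X,
     monoid.mult = (\<lambda>A B. \<Union>u\<in>A. \<Union>v\<in>B. word_class X R (u @ v)),
     one = word_class X R []\<rparr>"

lemma words_append [simp]: "u @ v \<in> words X \<longleftrightarrow> u \<in> words X \<and> v \<in> words X"
  by (simp add: words_def)

lemma words_Nil [simp]: "[] \<in> words X"
  by (simp add: words_def)

lemma word_eq_words: "word_eq X R u v \<Longrightarrow> u \<in> words X \<and> v \<in> words X"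
  by (induction rule: word_eq.induct) (auto simp: words_def)

lemma word_eq_ctxt:
  assumes "word_eq X R u v" "a \<in> words X" "b \<in> words X"
  shows "word_eq X R (a @ u @ b) (a @ v @ b)"
  using assms
proof (induction rule: word_eq.induct)
  case (refl w) then show ?case by (intro word_eq.refl) simp
next
  case (sym u w) then show ?case by (blast intro: word_eq.sym)
next
  case (trans u v w) then show ?case by (blast intro: word_eq.trans)
next
  case (cancel u w x s)
  then show ?case using word_eq.cancel[of "a @ u" X "w @ b" x R s] by simp
next
  case (relator u w r)
  then show ?case using word_eq.relator[of "a @ u" X "w @ b" r R] by simp
qed

lemma word_eq_append:
  assumes "word_eq X R u u'" "word_eq X R v v'"
  shows "word_eq X R (u @ v) (u' @ v')"
proof -
  have "word_eq X R (u @ v) (u' @ v)"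
    using word_eq_ctxt[OF assms(1), of "[]" v] word_eq_words[OF assms(2)] by simp
  moreover have "word_eq X R (u' @ v) (u' @ v')"
    using word_eq_ctxt[OF assms(2), of u' "[]"] word_eq_words[OF assms(1)] by simp
  ultimately show ?thesis by (rule word_eq.trans)
qed

lemma word_class_eq_iff:
  assumes "u \<in> words X"
  shows "word_class X R u = word_class X R v \<longleftrightarrow> word_eq X R u v"
proof
  assume "word_class X R u = word_class X R v"
  then have "u \<in> word_class X R v"
    using word_eq.refl[OF assms] by (auto simp: word_class_def)
  then show "word_eq X R u v" by (simp add: word_class_def word_eq.sym)
next
  assume uv: "word_eq X R u v"
  have "word_eq X R u w \<longleftrightarrow> word_eq X R v w" for w
    using word_eq.trans[OF uv, of w] word_eq.trans[OF word_eq.sym[OF uv], of w] by iprover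
  then show "word_class X R u = word_class X R v" by (simp add: word_class_def)
qed

lemma presented_group_mult:
  assumes "u \<in> words X" "v \<in> words X"
  shows "word_class X R u \<otimes>\<^bsub>presented_group X R\<^esub> word_class X R v = word_class X R (u @ v)"
proof -
  have "word_class X R (u' @ v') = word_class X R (u @ v)"
    if "u' \<in> word_class X R u" "v' \<in> word_class X R v" for u' v'
  proof -
    have "word_eq X R (u @ v) (u' @ v')"
      using that by (intro word_eq_append) (simp_all add: word_class_def)
    then show ?thesis using assms word_class_eq_iff[of "u @ v" X R "u' @ v'"] by simp
  qed
  moreover have "u \<in> word_class X R u" "v \<in> word_class X R v"
    using assms by (simp_all add: word_class_def word_eq.refl)
  ultimately have "(\<Union>u'\<in>word_class X R u. \<Union>v'\<in>word_class X R v. word_class X R (u' @ v'))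
      = word_class X R (u @ v)"
    by blast
  then show ?thesis by (simp add: presented_group_def)
qed

definition word_inv :: "'x word \<Rightarrow> 'x word" where
  "word_inv w = rev (map (\<lambda>(x, s). (x, \<not> s)) w)"

lemma word_inv_words: "w \<in> words X \<Longrightarrow> word_inv w \<in> words X"
  by (auto simp: word_inv_def words_def)

lemma word_inv_left: "w \<in> words X \<Longrightarrow> word_eq X R (word_inv w @ w) []"
proof (induction w)
  case Nil show ?case by (simp add: word_inv_def word_eq.refl)
next
  case (Cons l w)
  obtain x s where l: "l = (x, s)" by (cases l)
  have w: "w \<in> words X" "x \<in> X" using Cons.prems l by (auto simp: words_def)
  have "word_eq X R (word_inv w @ [(x, \<not> s), (x, \<not> \<not> s)] @ w) (word_inv w @ w)"
    using w word_inv_words by (intro word_eq.cancel) auto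
  then have "word_eq X R (word_inv (l # w) @ l # w) (word_inv w @ w)"
    by (simp add: l word_inv_def)
  then show ?case using Cons.IH[OF w(1)] by (rule word_eq.trans)
qed

lemma group_presented_group: "group (presented_group X R)"
proof (rule groupI)
  have car: "carrier (presented_group X R) = word_class X R ` words X"
    by (simp add: presented_group_def)
  show "x \<otimes>\<^bsub>presented_group X R\<^esub> y \<in> carrier (presented_group X R)"
    if xyz: "x \<in> carrier (presented_group X R)" "y \<in> carrier (presented_group X R)" for x y
  proof -
    obtain u v where "u \<in> words X" "v \<in> words X" "x = word_class X R u" "y = word_class X R v"
      using xyz unfolding car by blast
    then show ?thesis
      using presented_group_mult[of u X v R] by (simp add: presented_group_def)
  qed
  show "x \<otimes>\<^bsub>presented_group X R\<^esub> y \<otimes>\<^bsub>presented_group X R\<^esub> z =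
      x \<otimes>\<^bsub>presented_group X R\<^esub> (y \<otimes>\<^bsub>presented_group X R\<^esub> z)"
    if xyz: "x \<in> carrier (presented_group X R)" "y \<in> carrier (presented_group X R)"
      "z \<in> carrier (presented_group X R)" for x y z
  proof -
    obtain u v w where "u \<in> words X" "v \<in> words X" "w \<in> words X"
      "x = word_class X R u" "y = word_class X R v" "z = word_class X R w"
      using xyz unfolding car by blast
    then show ?thesis by (simp add: presented_group_mult)
  qed
  have one: "\<one>\<^bsub>presented_group X R\<^esub> = word_class X R []"
    by (simp add: presented_group_def)
  show "\<one>\<^bsub>presented_group X R\<^esub> \<in> carrier (presented_group X R)"
    by (simp add: presented_group_def)
  fix x assume "x \<in> carrier (presented_group X R)"
  then obtain u where u: "u \<in> words X" "x = word_class X R u"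
    by (auto simp: presented_group_def)
  show "\<one>\<^bsub>presented_group X R\<^esub> \<otimes>\<^bsub>presented_group X R\<^esub> x = x"
    using u by (simp add: one presented_group_mult)
  have "word_class X R (word_inv u) \<otimes>\<^bsub>presented_group X R\<^esub> x = \<one>\<^bsub>presented_group X R\<^esub>"
    using u by (simp add: one presented_group_mult word_inv_words word_class_eq_iff word_inv_left)
  then show "\<exists>y\<in>carrier (presented_group X R).
      y \<otimes>\<^bsub>presented_group X R\<^esub> x = \<one>\<^bsub>presented_group X R\<^esub>"
    using word_inv_words[OF u(1)] by (force simp: presented_group_def)
qed


section \<open>Surface groups\<close>

datatype surface_gen = GenA nat | GenB nat | GenP nat

definition surface_gens :: "bool \<Rightarrow> nat \<Rightarrow> nat \<Rightarrow> surface_gen set" where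
  "surface_gens orientable g m =
    GenA ` {..<g} \<union> (if orientable then GenB ` {..<g} else {}) \<union> GenP ` {..<m}"

definition surface_relator :: "bool \<Rightarrow> nat \<Rightarrow> nat \<Rightarrow> surface_gen word" where
  "surface_relator orientable g m =
    map (\<lambda>k. gen (GenP k)) [0..<m] @
    concat (map (\<lambda>j. if orientable then [gen (GenA j), gen (GenB j), gen_inv (GenA j), gen_inv (GenB j)]
                     else [gen (GenA j), gen (GenA j)]) [0..<g])"

definition surface_group :: "bool \<Rightarrow> nat \<Rightarrow> nat \<Rightarrow> surface_gen word set monoid" where
  "surface_group orientable g m =
    presented_group (surface_gens orientable g m) {surface_relator orientable g m}"

definition boundary_class :: "bool \<Rightarrow> nat \<Rightarrow> nat \<Rightarrow> nat \<Rightarrow> surface_gen word set" where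
  "boundary_class orientable g m k =
    word_class (surface_gens orientable g m) {surface_relator orientable g m} [gen (GenP k)]"


section \<open>Graphs of groups\<close>

text \<open>
  Every edge \<open>e\<close> carries an orientation; \<open>endpt \<Gamma> e True\<close> and \<open>endpt \<Gamma> e False\<close> are its endpoints
  $v^+$ and $v^-$, and \<open>bdry \<Gamma> e True\<close>, \<open>bdry \<Gamma> e False\<close> are the maps $\partial_e^+$, $\partial_e^-$.
\<close>

record ('v, 'e, 'a, 'c) gog =
  verts :: "'v set"
  edges :: "'e set"
  endpt :: "'e \<Rightarrow> bool \<Rightarrow> 'v"
  vgroup :: "'v \<Rightarrow> 'a monoid"
  egroup :: "'e \<Rightarrow> 'c monoid"
  bdry :: "'e \<Rightarrow> bool \<Rightarrow> 'c \<Rightarrow> 'a"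

definition joins_verts :: "('v, 'e, 'a, 'c) gog \<Rightarrow> 'e set \<Rightarrow> bool" where
  "joins_verts \<Gamma> T \<longleftrightarrow>
    (\<forall>v\<in>verts \<Gamma>. \<forall>w\<in>verts \<Gamma>. (v, w) \<in> {(endpt \<Gamma> e s, endpt \<Gamma> e (\<not> s)) | e s. e \<in> T}\<^sup>*)"

definition graph_of_groups :: "('v, 'e, 'a, 'c) gog \<Rightarrow> bool" where
  "graph_of_groups \<Gamma> \<longleftrightarrow>
    verts \<Gamma> \<noteq> {} \<and>
    (\<forall>e\<in>edges \<Gamma>. \<forall>s. endpt \<Gamma> e s \<in> verts \<Gamma>) \<and>
    joins_verts \<Gamma> (edges \<Gamma>) \<and>
    (\<forall>v\<in>verts \<Gamma>. group (vgroup \<Gamma> v)) \<and>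
    (\<forall>e\<in>edges \<Gamma>. group (egroup \<Gamma> e)) \<and>
    (\<forall>e\<in>edges \<Gamma>. \<forall>s. bdry \<Gamma> e s \<in> hom (egroup \<Gamma> e) (vgroup \<Gamma> (endpt \<Gamma> e s)) \<and>
       inj_on (bdry \<Gamma> e s) (carrier (egroup \<Gamma> e)))"

text \<open>A spanning tree, given by its edges: it reaches every vertex, and each of its edges is a bridge.\<close>

definition spanning_tree :: "('v, 'e, 'a, 'c) gog \<Rightarrow> 'e set \<Rightarrow> bool" where
  "spanning_tree \<Gamma> T \<longleftrightarrow>
    T \<subseteq> edges \<Gamma> \<and> joins_verts \<Gamma> T \<and> (\<forall>e\<in>T. \<not> joins_verts \<Gamma> (T - {e}))"

datatype ('v, 'e, 'a) pi1_gen = VGen 'v 'a | EGen 'e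

definition pi1_gens :: "('v, 'e, 'a, 'c) gog \<Rightarrow> ('v, 'e, 'a) pi1_gen set" where
  "pi1_gens \<Gamma> = {VGen v x | v x. v \<in> verts \<Gamma> \<and> x \<in> carrier (vgroup \<Gamma> v)} \<union> EGen ` edges \<Gamma>"

text \<open>
  The relators are the multiplication tables of the vertex groups,
  $t_e\,\partial_e^+(c)\,t_e^{-1} = \partial_e^-(c)$ for every edge \<open>e\<close>, and $t_e = 1$ for \<open>e\<close> in the
  spanning tree \<open>T\<close>.
\<close>

definition pi1_relators ::
  "('v, 'e, 'a, 'c) gog \<Rightarrow> 'e set \<Rightarrow> ('v, 'e, 'a) pi1_gen word set" where
  "pi1_relators \<Gamma> T =
    {[gen (VGen v x), gen (VGen v y), gen_inv (VGen v (x \<otimes>\<^bsub>vgroup \<Gamma> v\<^esub> y))] | v x y.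
       v \<in> verts \<Gamma> \<and> x \<in> carrier (vgroup \<Gamma> v) \<and> y \<in> carrier (vgroup \<Gamma> v)} \<union>
    {[gen (EGen e), gen (VGen (endpt \<Gamma> e True) (bdry \<Gamma> e True c)),
      gen_inv (EGen e), gen_inv (VGen (endpt \<Gamma> e False) (bdry \<Gamma> e False c))] | e c.
       e \<in> edges \<Gamma> \<and> c \<in> carrier (egroup \<Gamma> e)} \<union>
    {[gen (EGen e)] | e. e \<in> T}"

definition pi1 ::
  "('v, 'e, 'a, 'c) gog \<Rightarrow> 'e set \<Rightarrow> ('v, 'e, 'a) pi1_gen word set monoid" where
  "pi1 \<Gamma> T = presented_group (pi1_gens \<Gamma>) (pi1_relators \<Gamma> T)"

definition collapsible_edge :: "('v, 'e, 'a, 'c) gog \<Rightarrow> 'e \<Rightarrow> bool" where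
  "collapsible_edge \<Gamma> e \<longleftrightarrow>
    e \<in> edges \<Gamma> \<and> endpt \<Gamma> e True \<noteq> endpt \<Gamma> e False \<and>
    (\<exists>s. bdry \<Gamma> e s \<in> iso (egroup \<Gamma> e) (vgroup \<Gamma> (endpt \<Gamma> e s)))"

definition reduced_gog :: "('v, 'e, 'a, 'c) gog \<Rightarrow> bool" where
  "reduced_gog \<Gamma> \<longleftrightarrow> \<not> (\<exists>e. collapsible_edge \<Gamma> e)"


section \<open>Quadratic Baumslag-Solitar graphs\<close>

definition infinite_cyclic :: "('a, 'b) monoid_scheme \<Rightarrow> bool" where
  "infinite_cyclic G \<longleftrightarrow> G \<cong> integer_group"

text \<open>The edges leaving \<open>v\<close> are oriented edges, so a loop at \<open>v\<close> leaves \<open>v\<close> twice.\<close>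

definition edges_from :: "('v, 'e, 'a, 'c) gog \<Rightarrow> 'v \<Rightarrow> ('e \<times> bool) set" where
  "edges_from \<Gamma> v = {(e, s). e \<in> edges \<Gamma> \<and> endpt \<Gamma> e s = v}"

definition QH_vertex :: "('v, 'e, 'a, 'c) gog \<Rightarrow> 'v \<Rightarrow> bool" where
  "QH_vertex \<Gamma> v \<longleftrightarrow>
    (\<exists>orientable g m \<phi> \<epsilon>.
       \<phi> \<in> iso (surface_group orientable g m) (vgroup \<Gamma> v) \<and>
       bij_betw \<epsilon> {..<m} (edges_from \<Gamma> v) \<and>
       (\<forall>k<m. \<forall>e s. \<epsilon> k = (e, s) \<longrightarrow>
          bdry \<Gamma> e s ` carrier (egroup \<Gamma> e)
            \<subseteq> generate (vgroup \<Gamma> v) {\<phi> (boundary_class orientable g m k)}))"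

definition QBS_graph :: "('v, 'e, 'a, 'c) gog \<Rightarrow> bool" where
  "QBS_graph \<Gamma> \<longleftrightarrow>
    graph_of_groups \<Gamma> \<and>
    (\<forall>e\<in>edges \<Gamma>. infinite_cyclic (egroup \<Gamma> e)) \<and>
    (\<forall>v\<in>verts \<Gamma>. infinite_cyclic (vgroup \<Gamma> v) \<or> QH_vertex \<Gamma> v)"


section \<open>One-ended spaces and groups\<close>

text \<open>
  The sequence of compact sets is increasing. Without this the definition would be far too weak for graphs:
  a two-ended ladder is a countable union of short segments none of which separates it.
  The empty set is connected, so compact spaces (and finite groups) are one-ended.
\<close>

definition one_ended_space :: "'p topology \<Rightarrow> bool" where
  "one_ended_space X \<longleftrightarrow>
    (\<exists>K :: nat \<Rightarrow> 'p set.
       incseq K \<and> (\<forall>n. compactin X (K n)) \<and> topspace X = (\<Union>n. K n) \<and>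
       (\<forall>n. connectedin X (topspace X - K n)))"

text \<open>
  Geometric realisation of a graph, as a one-dimensional CW complex: \<open>Inner e t\<close> with \<open>0 < t < 1\<close> are
  the interior points of the edge \<open>e\<close>, and \<open>edge_point\<close> is its characteristic map on \<open>[0, 1]\<close>.
\<close>

datatype ('v, 'e) graph_point = Vertex 'v | Inner 'e real

definition edge_point :: "('e \<Rightarrow> 'v) \<Rightarrow> ('e \<Rightarrow> 'v) \<Rightarrow> 'e \<Rightarrow> real \<Rightarrow> ('v, 'e) graph_point" where
  "edge_point src tgt e t =
    (if t = 0 then Vertex (src e) else if t = 1 then Vertex (tgt e) else Inner e t)"

definition graph_points :: "'v set \<Rightarrow> 'e set \<Rightarrow> ('v, 'e) graph_point set" where
  "graph_points V E = Vertex ` V \<union> {Inner e t | e t. e \<in> E \<and> 0 < t \<and> t < 1}"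

definition graph_space ::
  "'v set \<Rightarrow> 'e set \<Rightarrow> ('e \<Rightarrow> 'v) \<Rightarrow> ('e \<Rightarrow> 'v) \<Rightarrow> ('v, 'e) graph_point topology" where
  "graph_space V E src tgt =
    topology (\<lambda>U. U \<subseteq> graph_points V E \<and>
      (\<forall>e\<in>E. openin (top_of_set {0..1}) {t \<in> {0..1}. edge_point src tgt e t \<in> U}))"

lemma openin_graph_space:
  "openin (graph_space V E src tgt) U \<longleftrightarrow> U \<subseteq> graph_points V E \<and>
    (\<forall>e\<in>E. openin (top_of_set {0..1}) {t \<in> {0..1}. edge_point src tgt e t \<in> U})"
proof -
  have "istopology (\<lambda>U. U \<subseteq> graph_points V E \<and>
      (\<forall>e\<in>E. openin (top_of_set {0..1}) {t \<in> {0..1}. edge_point src tgt e t \<in> U}))"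
    unfolding istopology_def
  proof (intro conjI allI impI ballI; (elim conjE)?)
    fix S T e
    assume "\<forall>e\<in>E. openin (top_of_set {0..1}) {t \<in> {0..1}. edge_point src tgt e t \<in> S}"
      "\<forall>e\<in>E. openin (top_of_set {0..1}) {t \<in> {0..1}. edge_point src tgt e t \<in> T}" "e \<in> E"
    then have "openin (top_of_set {0..1})
      ({t \<in> {0..1}. edge_point src tgt e t \<in> S} \<inter> {t \<in> {0..1}. edge_point src tgt e t \<in> T})"
      by (intro openin_Int) auto
    then show "openin (top_of_set {0..1}) {t \<in> {0..1}. edge_point src tgt e t \<in> S \<inter> T}"
      by (rule back_subst) auto
  next
    fix \<U> e
    assume *: "\<forall>U\<in>\<U>. U \<subseteq> graph_points V E \<and>
      (\<forall>e\<in>E. openin (top_of_set {0..1}) {t \<in> {0..1}. edge_point src tgt e t \<in> U})" "e \<in> E"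
    have "openin (top_of_set {0..1}) (\<Union>U\<in>\<U>. {t \<in> {0..1}. edge_point src tgt e t \<in> U})"
      using * by (intro openin_Union) auto
    then show "openin (top_of_set {0..1}) {t \<in> {0..1}. edge_point src tgt e t \<in> \<Union>\<U>}"
      by (rule back_subst) auto
  qed auto
  then show ?thesis by (simp add: graph_space_def)
qed

lemma topspace_graph_space:
  assumes "src ` E \<subseteq> V" "tgt ` E \<subseteq> V"
  shows "topspace (graph_space V E src tgt) = graph_points V E"
proof -
  have "edge_point src tgt e t \<in> graph_points V E" if "e \<in> E" "t \<in> {0..1}" for e t
    using that assms by (auto simp: edge_point_def graph_points_def)
  then have "{t \<in> {0..1}. edge_point src tgt e t \<in> graph_points V E} = {0..1}" if "e \<in> E" for e
    using that by auto
  then have "openin (graph_space V E src tgt) (graph_points V E)"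
    by (simp add: openin_graph_space)
  then show ?thesis
    by (meson openin_graph_space openin_subset openin_topspace subset_antisym)
qed

definition cayley_graph ::
  "('a, 'b) monoid_scheme \<Rightarrow> 'a set \<Rightarrow> ('a, 'a \<times> 'a) graph_point topology" where
  "cayley_graph G S = graph_space (carrier G) (carrier G \<times> S) fst (\<lambda>(x, s). x \<otimes>\<^bsub>G\<^esub> s)"

definition one_ended_group :: "('a, 'b) monoid_scheme \<Rightarrow> bool" where
  "one_ended_group G \<longleftrightarrow>
    (\<exists>S. finite S \<and> S \<subseteq> carrier G \<and> generate G S = carrier G \<and>
       one_ended_space (cayley_graph G S))"

end

theory Submission
  imports Defs "HOL-Library.Z2"
begin

text \<open>
  A finitely generated group is one-ended as soon as every function \<open>A\<close> from it to the field with two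
  elements that changes only finitely often under each right translation is constant off a finite set:
  apply this to the components of the complement of a finite set in the Cayley graph.

  Given such an \<open>A\<close> on the fundamental group, look at the two ends of every conjugate of an edge group, a
  line on which \<open>A\<close> is eventually constant in both directions. The lines on which the two limits differ
  form a finite set of edges of the Bass-Serre tree. At a \<open>\<int>\<close>-vertex all the edges have the same limits, and
  by reducedness there are at least two; at a QH vertex the number of edges with different limits is even,
  because the coboundary of \<open>A\<close> crosses every face of the universal cover of the surface in an even number
  of edges. So the finite subforest has no leaf and is empty. But then \<open>A\<close> is almost constant on every coset
  of a vertex group: clearly if the group is \<open>\<int>\<close>, and for a surface group by Poincare duality, the coboundary
  being a relative cycle of the dual cell structure, hence the boundary of a finite set of dual cells.
  As edge groups are infinite, the constants agree across the tree.
\<close>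

text \<open>Coefficients modulo 2 remove all signs, so orientable and non-orientable surfaces, with
  or without boundary, are handled by one computation. The universal cover is replaced by the Cayley
  complex of the one-relator presentation. The geometric input about it is that the link of a vertex
  is a circle, recorded by \<open>corner_sums\<close>; its simple connectedness is the definition of
  equality of words in a presented group, so an induction over \<open>word_eq\<close> takes the
  place of contracting loops. Likewise the Bass-Serre tree is never built as an object. A vertex is
  a coset \<open>g G_v\<close>, an edge is a coset of an edge group, and the leaf argument works
  with a height of vertices and the fact that at each vertex at most one edge leads down. Both come
  from an action of the fundamental group on normal forms. The obstacle there is that the
  presentation kills the stable letters of a spanning tree, whereas passing an edge changes the
  normal form; so the normal forms at different vertices must be identified along the tree
  beforehand.\<close>

declare add_bit_eq_xor [simp del] mult_bit_eq_and [simp del]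

section \<open>Generators\<close>

lemma (in group) invariant_generate:
  assumes S: "S \<subseteq> carrier G" and inv: "\<And>g s. g \<in> carrier G \<Longrightarrow> s \<in> S \<Longrightarrow> f (g \<otimes> s) = f g"
    and h: "h \<in> generate G S" and g: "g \<in> carrier G"
  shows "f (g \<otimes> h) = f g"
  using h g
proof (induction arbitrary: g)
  case (inv s)
  then have "s \<in> carrier G" using S by auto
  then have "g \<otimes> inv s \<otimes> s = g" using inv by (simp add: m_assoc)
  then show ?case using assms(2)[of "g \<otimes> inv s" s] inv \<open>s \<in> carrier G\<close> by simp
next
  case (eng h1 h2)
  then have "h1 \<in> carrier G" "h2 \<in> carrier G" using generate_in_carrier[OF S] by auto
  then show ?case using eng by (simp flip: m_assoc)
qed (use inv in simp_all)

lemma (in group) generate_eq_carrierI: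
  assumes "S \<subseteq> carrier G" "U \<subseteq> generate G S" "generate G U = carrier G"
  shows "generate G S = carrier G"
proof
  show "generate G S \<subseteq> carrier G" by (rule generate_incl[OF assms(1)])
  show "carrier G \<subseteq> generate G S"
    using generate_subgroup_incl[OF assms(2) generate_is_subgroup[OF assms(1)]] assms(3) by simp
qed

lemma words_Cons_iff: "l # w \<in> words X \<longleftrightarrow> fst l \<in> X \<and> w \<in> words X"
  by (cases l) (simp add: words_def)

lemma word_class_inverse:
  assumes "x \<in> X"
  shows "word_class X R [(x, \<not> \<sigma>)] = inv\<^bsub>presented_group X R\<^esub> (word_class X R [(x, \<sigma>)])"
proof -
  interpret group "presented_group X R" by (rule group_presented_group)
  have w: "[(x, \<tau>)] \<in> words X" for \<tau> using assms by (simp add: words_def)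
  have "word_eq X R ([] @ [(x, \<not> \<sigma>), (x, \<not> \<not> \<sigma>)] @ []) ([] @ [])"
    by (rule word_eq.cancel) (use assms in auto)
  then have "word_class X R [(x, \<not> \<sigma>), (x, \<sigma>)] = word_class X R []"
    using w by (subst word_class_eq_iff) (auto simp: words_def)
  then have "word_class X R [(x, \<not> \<sigma>)] \<otimes>\<^bsub>presented_group X R\<^esub> word_class X R [(x, \<sigma>)] = \<one>\<^bsub>presented_group X R\<^esub>"
    using presented_group_mult[OF w w, of R "\<not> \<sigma>" \<sigma>] by (simp add: presented_group_def)
  then show ?thesis
    using w by (intro inv_equality[symmetric]) (auto simp: presented_group_def)
qed

lemma generate_presented_group:
  "generate (presented_group X R) ((\<lambda>x. word_class X R [gen x]) ` X) = carrier (presented_group X R)"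
proof -
  let ?G = "presented_group X R" and ?S = "(\<lambda>x. word_class X R [gen x]) ` X"
  interpret group ?G by (rule group_presented_group)
  have l: "[(x, \<sigma>)] \<in> words X" if "x \<in> X" for x \<sigma> using that by (simp add: words_def)
  then have S: "?S \<subseteq> carrier ?G" by (auto simp: presented_group_def)
  have "word_class X R w \<in> generate ?G ?S" if "w \<in> words X" for w
    using that
  proof (induction w)
    case Nil
    then show ?case using generate.one[of ?G ?S] by (simp add: presented_group_def)
  next
    case (Cons l w)
    obtain x \<sigma> where xl: "l = (x, \<sigma>)" by (cases l)
    have x: "x \<in> X" "w \<in> words X" using Cons.prems xl by (auto simp: words_def)
    have "word_class X R [l] \<in> generate ?G ?S"
    proof (cases \<sigma>)
      case True
      then show ?thesis using x xl by (auto intro: generate.incl)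
    next
      case False
      then show ?thesis using generate.inv[of "word_class X R [gen x]" ?S ?G] word_class_inverse[OF x(1), of R True] x xl
        by auto
    qed
    then have "word_class X R [l] \<otimes>\<^bsub>?G\<^esub> word_class X R w \<in> generate ?G ?S"
      using Cons.IH[OF x(2)] by (rule generate.eng)
    moreover have "word_class X R [l] \<otimes>\<^bsub>?G\<^esub> word_class X R w = word_class X R (l # w)"
      using presented_group_mult[of "[l]" X w R] l x xl by simp
    ultimately show ?case by simp
  qed
  then have "carrier ?G \<subseteq> generate ?G ?S" by (auto simp: presented_group_def)
  moreover have "generate ?G ?S \<subseteq> carrier ?G" using generate_incl[OF S] .
  ultimately show ?thesis by blast
qed

section \<open>Almost invariant functions and ends\<close>

lemma bit_add_eq_0_iff: "a + b = 0 \<longleftrightarrow> a = b" for a b :: bit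
  by (cases a; cases b) auto

lemma bit_add_eq_1_iff: "a + b = 1 \<longleftrightarrow> a \<noteq> b" for a b :: bit
  by (cases a; cases b) auto

lemma bit_add_self [simp]: "a + a = (0 :: bit)" "a + (a + b) = (b :: bit)"
  by (cases a; cases b; simp)+

text \<open>The indicator of an almost invariant set in the sense of the theory of ends. It takes
  values in \<open>bit\<close> so that its coboundary along \<open>g\<close> is the sum
  \<open>A (x g) + A x\<close> and the parity of a finite set of changes is a sum of ones.\<close>

definition almost_invariant :: "('a, 'b) monoid_scheme \<Rightarrow> ('a \<Rightarrow> bit) \<Rightarrow> bool" where
  "almost_invariant G A \<longleftrightarrow> (\<forall>g\<in>carrier G. finite {x \<in> carrier G. A (x \<otimes>\<^bsub>G\<^esub> g) \<noteq> A x})"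

lemma (in group) finite_translate:
  assumes "finite F" "g \<in> carrier G"
  shows "finite {x \<in> carrier G. x \<otimes> g \<in> F}"
proof (rule finite_imageD)
  show "finite ((\<lambda>x. x \<otimes> g) ` {x \<in> carrier G. x \<otimes> g \<in> F})"
    by (rule finite_subset[OF _ assms(1)]) auto
  show "inj_on (\<lambda>x. x \<otimes> g) {x \<in> carrier G. x \<otimes> g \<in> F}"
    using assms(2) by (auto simp: inj_on_def)
qed

text \<open>A change under \<open>h1 h2\<close> is a change under \<open>h1\<close> or a translate
  of a change under \<open>h2\<close>, so finiteness need only be checked on generators.\<close>

lemma (in group) almost_invariant_generate:
  assumes gen: "generate G S = carrier G"
    and S: "\<And>s. s \<in> S \<Longrightarrow> s \<in> carrier G \<and> finite {x \<in> carrier G. A (x \<otimes> s) \<noteq> A x}"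
  shows "almost_invariant G A"
  unfolding almost_invariant_def
proof
  have SG: "S \<subseteq> carrier G" using S by auto
  fix g assume "g \<in> carrier G"
  then have "g \<in> generate G S" using gen by simp
  then show "finite {x \<in> carrier G. A (x \<otimes> g) \<noteq> A x}"
  proof induction
    case one then show ?case
      by (rule finite_subset[rotated, of "{}"]) auto
  next
    case (incl h) then show ?case using S by blast
  next
    case (inv h)
    then have h: "h \<in> carrier G" "finite {x \<in> carrier G. A (x \<otimes> h) \<noteq> A x}" using S by auto
    show ?case
    proof (rule finite_subset[OF _ finite_translate[OF h(2), of "inv h"]])
      show "{x \<in> carrier G. A (x \<otimes> inv h) \<noteq> A x} \<subseteq>
        {x \<in> carrier G. x \<otimes> inv h \<in> {x \<in> carrier G. A (x \<otimes> h) \<noteq> A x}}"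
        using h(1) by (auto simp: m_assoc)
    qed (use h in simp)
  next
    case (eng h1 h2)
    have c: "h1 \<in> carrier G" "h2 \<in> carrier G"
      using generate_in_carrier[OF SG] eng by auto
    show ?case
    proof (rule finite_subset[OF _ finite_UnI[OF finite_translate[OF eng(4) c(1)] eng(3)]])
      show "{x \<in> carrier G. A (x \<otimes> (h1 \<otimes> h2)) \<noteq> A x} \<subseteq>
        {x \<in> carrier G. x \<otimes> h1 \<in> {x \<in> carrier G. A (x \<otimes> h2) \<noteq> A x}} \<union>
        {x \<in> carrier G. A (x \<otimes> h1) \<noteq> A x}"
        using c by (auto simp: m_assoc)
    qed
  qed
qed

definition adjacency :: "('a, 'b) monoid_scheme \<Rightarrow> 'a set \<Rightarrow> 'a set \<Rightarrow> ('a \<times> 'a) set" where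
  "adjacency G S U = {(x, y). x \<in> U \<and> y \<in> U \<and> (\<exists>s\<in>S. y = x \<otimes>\<^bsub>G\<^esub> s \<or> x = y \<otimes>\<^bsub>G\<^esub> s)}"

lemma sym_adjacency: "sym (adjacency G S U)"
  by (auto simp: sym_def adjacency_def)

lemma rtrancl_adjacency_class:
  assumes "(x, y) \<in> (adjacency G S U)\<^sup>*" "C = {y. (x, y) \<in> (adjacency G S U)\<^sup>*}"
  shows "(x, y) \<in> (adjacency G S C)\<^sup>*"
  using assms(1)
proof (induction rule: rtrancl_induct)
  case base show ?case by simp
next
  case (step y z)
  then have "(y, z) \<in> adjacency G S C"
    using assms(2) by (auto simp: adjacency_def intro: rtrancl_into_rtrancl)
  with step.IH show ?case by simp
qed

lemma rtrancl_adjacency_in: "(x, y) \<in> (adjacency G S U)\<^sup>* \<Longrightarrow> x \<in> U \<Longrightarrow> y \<in> U"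
  by (induction rule: rtrancl_induct) (auto simp: adjacency_def)

text \<open>The indicator of a component of the complement of \<open>F\<close> can change only
  within one step of \<open>F\<close>, so it is almost invariant and the component is finite or
  cofinite. The complement of a cofinite component serves as \<open>K\<close>. If all components are
  finite, there are finitely many of them because each comes near \<open>F\<close>, and the group
  itself is finite.\<close>

lemma (in group) finite_superset_connected_complement:
  assumes S: "finite S" "S \<subseteq> carrier G" "generate G S = carrier G"
    and ai: "\<And>A. almost_invariant G A \<Longrightarrow> \<exists>b. finite {x \<in> carrier G. A x \<noteq> b}"
    and F0: "finite F0" "F0 \<subseteq> carrier G"
  shows "\<exists>K. finite K \<and> F0 \<subseteq> K \<and> K \<subseteq> carrier G \<and>
    (\<forall>x\<in>carrier G - K. \<forall>y\<in>carrier G - K. (x, y) \<in> (adjacency G S (carrier G - K))\<^sup>*)"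
proof -
  \<comment> \<open>The identity is added so that no component can be closed under all generators:
    it would contain \<open>x \<otimes> inv x\<close>.\<close>
  define F where "F = insert \<one> F0"
  have F: "finite F" "F \<subseteq> carrier G" "\<one> \<in> F" "F0 \<subseteq> F" using F0 by (auto simp: F_def)
  define U where "U = carrier G - F"
  define cls where "cls x = {y. (x, y) \<in> (adjacency G S U)\<^sup>*}" for x
  have clsU: "cls x \<subseteq> U" if "x \<in> U" for x
    using that rtrancl_adjacency_in by (fastforce simp: cls_def)
  have cls_step: "z \<in> cls x" if "y \<in> cls x" "(y, z) \<in> adjacency G S U" for x y z
    using that by (auto simp: cls_def)
  have fc: "finite (cls x) \<or> finite (carrier G - cls x)" if x: "x \<in> U" for x
  proof -
    define A :: "'a \<Rightarrow> bit" where "A y = of_bool (y \<in> cls x)" for y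
    have "almost_invariant G A"
    proof (rule almost_invariant_generate[OF S(3)], rule conjI)
      fix s assume s: "s \<in> S"
      then show sG: "s \<in> carrier G" using S by auto
      show "finite {y \<in> carrier G. A (y \<otimes> s) \<noteq> A y}"
      proof (rule finite_subset[OF _ finite_UnI[OF F(1) finite_translate[OF F(1) sG]]], rule subsetI, rule ccontr)
        fix y assume y: "y \<in> {y \<in> carrier G. A (y \<otimes> s) \<noteq> A y}"
          "y \<notin> F \<union> {x \<in> carrier G. x \<otimes> s \<in> F}"
        then have "(y, y \<otimes> s) \<in> adjacency G S U" "(y \<otimes> s, y) \<in> adjacency G S U"
          using s sG by (auto simp: adjacency_def U_def)
        then have "y \<in> cls x \<longleftrightarrow> y \<otimes> s \<in> cls x" using cls_step by blast
        with y(1) show False by (auto simp: A_def)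
      qed
    qed
    from ai[OF this] obtain b where b: "finite {y \<in> carrier G. A y \<noteq> b}" by blast
    have sub: "cls x \<subseteq> carrier G" using clsU[OF x] by (auto simp: U_def)
    show ?thesis
    proof (cases "b = 0")
      case True
      then have "{y \<in> carrier G. A y \<noteq> b} = cls x" using sub by (auto simp: A_def)
      then show ?thesis using b by simp
    next
      case False
      then have "{y \<in> carrier G. A y \<noteq> b} = carrier G - cls x" by (auto simp: A_def)
      then show ?thesis using b by simp
    qed
  qed
  show ?thesis
  proof (cases "\<exists>x\<in>U. finite (carrier G - cls x)")
    case True
    then obtain x where x: "x \<in> U" "finite (carrier G - cls x)" by blast
    have sub: "cls x \<subseteq> U" using clsU[OF x(1)] .
    have eq: "carrier G - (carrier G - cls x) = cls x" using sub by (auto simp: U_def)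
    have conn: "(y, z) \<in> (adjacency G S (cls x))\<^sup>*" if "y \<in> cls x" "z \<in> cls x" for y z
    proof -
      have "(x, y) \<in> (adjacency G S (cls x))\<^sup>*" "(x, z) \<in> (adjacency G S (cls x))\<^sup>*"
        using that unfolding cls_def by (simp_all add: rtrancl_adjacency_class[OF _ HOL.refl])
      moreover have "sym ((adjacency G S (cls x))\<^sup>*)" by (rule sym_rtrancl[OF sym_adjacency])
      ultimately show ?thesis by (meson symE rtrancl_trans)
    qed
    show ?thesis
      by (rule exI[of _ "carrier G - cls x"]) (use x sub conn eq F in \<open>auto simp: U_def\<close>)
  next
    case False
    \<comment> \<open>The points one step away from \<open>F\<close> in either direction. A
      component avoiding \<open>N\<close> would be closed under generators and their inverses and so
      reach the identity, which lies in \<open>F\<close>.\<close>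
    define N where "N = (\<Union>s\<in>S. {y \<in> carrier G. y \<otimes> s \<in> F}) \<union> (\<Union>s\<in>S. (\<lambda>f. f \<otimes> s) ` F)"
    have N: "finite N" unfolding N_def
      using S F finite_translate by (intro finite_UnI finite_UN_I) auto
    have meet: "cls x \<inter> N \<noteq> {}" if x: "x \<in> U" for x
    proof
      assume no: "cls x \<inter> N = {}"
      have *: "y \<otimes> g \<in> cls x" if "g \<in> generate G S" "y \<in> cls x" for g y
        using that
      proof (induction arbitrary: y)
        case one then show ?case using clsU[OF x] by (auto simp: U_def)
      next
        case (incl s)
        have y: "y \<in> U" "y \<notin> N" using clsU[OF x] incl no by auto
        then have "y \<otimes> s \<in> U" using incl S by (auto simp: N_def U_def)
        then show ?case using y incl by (intro cls_step[OF incl(2)]) (auto simp: adjacency_def)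
      next
        case (inv s)
        have y: "y \<in> U" "y \<notin> N" "y \<in> carrier G" "s \<in> carrier G"
          using clsU[OF x] inv no S by (auto simp: U_def)
        have yy: "y = (y \<otimes> inv s) \<otimes> s" using y by (simp add: m_assoc)
        then have "y \<otimes> inv s \<in> U" using y inv S unfolding N_def U_def by auto
        then show ?case using y inv yy by (intro cls_step[OF inv(2)]) (auto simp: adjacency_def)
      next
        case (eng h1 h2)
        have "h1 \<in> carrier G" "h2 \<in> carrier G" "y \<in> carrier G"
          using generate_in_carrier[OF S(2)] eng clsU[OF x] by (auto simp: U_def)
        then show ?case using eng by (simp flip: m_assoc)
      qed
      have xc: "x \<in> carrier G" "x \<in> cls x" using x by (auto simp: U_def cls_def)
      have "x \<otimes> inv x \<in> cls x" using *[of "inv x" x] S(3) xc by simp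
      then show False using clsU[OF x] F xc by (auto simp: U_def)
    qed
    have "U \<subseteq> (\<Union>y\<in>N \<inter> U. cls y)"
    proof
      fix x assume x: "x \<in> U"
      from meet[OF x] obtain y where y: "y \<in> cls x" "y \<in> N" by auto
      have "x \<in> cls y" using y(1) symD[OF sym_rtrancl[OF sym_adjacency]] by (auto simp: cls_def)
      then show "x \<in> (\<Union>y\<in>N \<inter> U. cls y)" using y clsU[OF x] by auto
    qed
    moreover have "finite (\<Union>y\<in>N \<inter> U. cls y)" using N fc False by (intro finite_UN_I) auto
    ultimately have "finite U" by (rule finite_subset)
    then have "finite (carrier G)" using F by (simp add: U_def)
    then show ?thesis using F0 by (intro exI[of _ "carrier G"]) auto
  qed
qed

subsection \<open>Compact subgraphs with connected complement\<close>

lemma continuous_map_edge_point: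
  assumes "src ` E \<subseteq> V" "tgt ` E \<subseteq> V" "e \<in> E"
  shows "continuous_map (top_of_set {0..1}) (graph_space V E src tgt) (edge_point src tgt e)"
proof -
  have "edge_point src tgt e t \<in> graph_points V E" if "t \<in> {0..1}" for t
    using assms that by (auto simp: edge_point_def graph_points_def)
  then show ?thesis
    using assms by (auto simp: continuous_map_def topspace_graph_space openin_graph_space)
qed

lemma compactin_graph_points:
  assumes E: "src ` E \<subseteq> V" "tgt ` E \<subseteq> V" and K: "finite K" "K \<subseteq> V"
    and E': "finite E'" "E' \<subseteq> E" "src ` E' \<subseteq> K" "tgt ` E' \<subseteq> K"
  shows "compactin (graph_space V E src tgt) (graph_points K E')"
proof -
  have "graph_points K E' = Vertex ` K \<union> (\<Union>e\<in>E'. edge_point src tgt e ` {0..1})"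
    using E' by (force simp: graph_points_def edge_point_def image_iff split: if_splits)
  moreover have "compactin (graph_space V E src tgt) (Vertex ` K)"
    using K by (intro finite_imp_compactin)
      (auto simp: topspace_graph_space[OF E] graph_points_def)
  moreover have "compactin (graph_space V E src tgt) (edge_point src tgt e ` {0..1})" if "e \<in> E'" for e
    using that E' E by (intro image_compactin[OF _ continuous_map_edge_point])
      (auto simp: compactin_subtopology)
  ultimately show ?thesis using E'(1) by (auto intro!: compactin_Un compactin_Union)
qed

lemma connectedin_graph_complement:
  assumes E: "src ` E \<subseteq> V" "tgt ` E \<subseteq> V" and K: "K \<subseteq> V"
    and conn: "\<And>x y. x \<in> V - K \<Longrightarrow> y \<in> V - K \<Longrightarrow> 
      (x, y) \<in> {(x, y). x \<in> V - K \<and> y \<in> V - K \<and> (\<exists>e\<in>E. src e = x \<and> tgt e = y \<or> src e = y \<and> tgt e = x)}\<^sup>*"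
  shows "connectedin (graph_space V E src tgt)
    (graph_points V E - graph_points K {e \<in> E. src e \<in> K \<and> tgt e \<in> K})"
proof -
  define X where "X = graph_space V E src tgt"
  define M where "M = graph_points V E - graph_points K {e \<in> E. src e \<in> K \<and> tgt e \<in> K}"
  \<comment> \<open>What is left of the unit interval when the end points lying in \<open>K\<close>
    are removed. The interior of an edge is removed as well exactly if both ends are in
    \<open>K\<close>, so every surviving point can be joined inside its edge to a vertex outside
    \<open>K\<close>.\<close>
  define I where "I e = {t. 0 \<le> t \<and> t \<le> 1 \<and> (src e \<in> K \<longrightarrow> 0 < t) \<and> (tgt e \<in> K \<longrightarrow> t < (1::real))}" for e
  define P where "P e = edge_point src tgt e ` I e" for e
  have top: "topspace X = graph_points V E" unfolding X_def by (rule topspace_graph_space[OF E])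
  have Vin: "Vertex x \<in> M \<longleftrightarrow> x \<in> V - K" for x
    using K by (auto simp: M_def graph_points_def)
  have tM: "topspace (subtopology X M) = M" using top by (auto simp: M_def)
  have P: "connectedin X (P e)" "P e \<subseteq> M" if e: "e \<in> E" "src e \<notin> K \<or> tgt e \<notin> K" for e
  proof -
    have "is_interval (I e)" by (auto simp: is_interval_1 I_def)
    then have "connected (I e)" using is_interval_connected by blast
    then have "connectedin (top_of_set {0..1}) (I e)"
      by (auto simp: connectedin_subtopology I_def)
    then show "connectedin X (P e)" unfolding X_def P_def
      by (rule connectedin_continuous_map_image[OF continuous_map_edge_point[OF E e(1)]])
    show "P e \<subseteq> M" using e E
      by (auto simp: P_def I_def M_def graph_points_def edge_point_def)
  qed
  have PV: "Vertex x \<in> P e" if "src e = x \<or> tgt e = x" "x \<notin> K" for e x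
  proof (cases "src e = x")
    case True
    then have "0 \<in> I e" "edge_point src tgt e 0 = Vertex x" using that by (auto simp: I_def edge_point_def)
    then show ?thesis unfolding P_def by (metis image_eqI)
  next
    case False
    then have "1 \<in> I e" "edge_point src tgt e 1 = Vertex x" using that by (auto simp: I_def edge_point_def)
    then show ?thesis unfolding P_def by (metis image_eqI)
  qed
  have cc: "connected_component_of (subtopology X M) p q"
    if "e \<in> E" "src e \<notin> K \<or> tgt e \<notin> K" "p \<in> P e" "q \<in> P e" for e p q
    unfolding connected_component_of_def
    using P[OF that(1,2)] that(3,4) by (intro exI[of _ "P e"]) (simp add: connectedin_subtopology)
  have vv: "connected_component_of (subtopology X M) (Vertex x) (Vertex y)"
    if xy: "x \<in> V - K" "y \<in> V - K" for x y
    using conn[OF xy]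
  proof (induction rule: rtrancl_induct)
    case base
    show ?case using xy Vin tM by (simp add: connected_component_of_refl)
  next
    case (step y z)
    then obtain e where e: "e \<in> E" "y \<in> V - K" "z \<in> V - K" "src e = y \<and> tgt e = z \<or> src e = z \<and> tgt e = y"
      by blast
    then have "connected_component_of (subtopology X M) (Vertex y) (Vertex z)"
      by (intro cc[of e]) (auto intro!: PV)
    with step.IH show ?case by (rule connected_component_of_trans)
  qed
  have near: "\<exists>x\<in>V - K. connected_component_of (subtopology X M) p (Vertex x)" if p: "p \<in> M" for p
  proof (cases p)
    case (Vertex x)
    then show ?thesis using p Vin tM by (intro bexI[of _ x]) (simp_all add: connected_component_of_refl)
  next
    case (Inner e t)
    then have e: "e \<in> E" "0 < t" "t < 1" "src e \<notin> K \<or> tgt e \<notin> K"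
      using p by (auto simp: M_def graph_points_def)
    then have tI: "t \<in> I e" by (auto simp: I_def)
    have "edge_point src tgt e t = p" using Inner e by (auto simp: edge_point_def)
    then have "p \<in> P e" using tI unfolding P_def by blast
    moreover obtain x where "src e = x \<or> tgt e = x" "x \<in> V - K" using e E by blast
    ultimately show ?thesis using e cc[OF e(1,4)] PV by blast
  qed
  have "connected_space (subtopology X M)"
    unfolding connected_space_iff_connected_component
  proof (intro allI impI ballI)
    fix p q assume "p \<in> topspace (subtopology X M)" "q \<in> topspace (subtopology X M)"
    then have pq: "p \<in> M" "q \<in> M" by auto
    from near[OF pq(1)] near[OF pq(2)] obtain x y where
      "x \<in> V - K" "connected_component_of (subtopology X M) p (Vertex x)"
      "y \<in> V - K" "connected_component_of (subtopology X M) q (Vertex y)" by blast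
    then show "connected_component_of (subtopology X M) p q"
      using vv by (meson connected_component_of_sym connected_component_of_trans)
  qed
  then show ?thesis using top by (auto simp: connectedin_def X_def M_def)
qed

theorem (in group) one_ended_groupI:
  assumes S: "finite S" "S \<subseteq> carrier G" "generate G S = carrier G"
    and ai: "\<And>A. almost_invariant G A \<Longrightarrow> \<exists>b. finite {x \<in> carrier G. A x \<noteq> b}"
  shows "one_ended_group G"
proof -
  let ?tgt = "\<lambda>(x, s). x \<otimes> s"
  let ?E = "carrier G \<times> S"
  have E: "fst ` ?E \<subseteq> carrier G" "?tgt ` ?E \<subseteq> carrier G" using S by auto
  define good where "good K \<longleftrightarrow> finite K \<and> K \<subseteq> carrier G \<and>
    (\<forall>x\<in>carrier G - K. \<forall>y\<in>carrier G - K. (x, y) \<in> (adjacency G S (carrier G - K))\<^sup>*)" for K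
  \<comment> \<open>Steps along inverse generators are included, because an arbitrary element is
    reached from the identity by generators and inverses; this is what makes the sets
    \<open>K n\<close> exhaust the group.\<close>
  define nbhd where "nbhd K = insert \<one> (K \<union> (\<Union>s\<in>S. (\<lambda>x. x \<otimes> s) ` K) \<union> (\<Union>s\<in>S. (\<lambda>x. x \<otimes> inv s) ` K))" for K
  have nb: "finite (nbhd K)" "nbhd K \<subseteq> carrier G" if "good K" for K
    using that S by (auto simp: nbhd_def good_def)
  have "\<exists>K. \<forall>n. good (K n) \<and> nbhd (K n) \<subseteq> K (Suc n)"
  proof (rule dependent_nat_choice)
    show "\<exists>K. good K"
      using finite_superset_connected_complement[OF S ai, of "{}"] by (auto simp: good_def)
    show "\<exists>K'. good K' \<and> nbhd K \<subseteq> K'" if "good K" for K n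
      using finite_superset_connected_complement[OF S ai nb[OF that]] by (auto simp: good_def)
  qed
  then obtain K where K: "\<And>n. good (K n)" "\<And>n. nbhd (K n) \<subseteq> K (Suc n)" by blast
  have mono: "K n \<subseteq> K (Suc n)" for n using K(2)[of n] by (auto simp: nbhd_def)
  then have inc: "incseq K" by (simp add: incseq_SucI)
  define L where "L n = graph_points (K n) {e \<in> ?E. fst e \<in> K n \<and> ?tgt e \<in> K n}" for n
  have mem: "g \<in> generate G S \<Longrightarrow> \<forall>n. \<forall>x\<in>K n. \<exists>n'. x \<otimes> g \<in> K n'" for g
  proof (induction rule: generate.induct)
    case one
    then show ?case using K(1) by (metis good_def r_one subsetD)
  next
    case (incl s)
    have "x \<otimes> s \<in> K (Suc n)" if "x \<in> K n" for n x
      using K(2)[of n] that incl unfolding nbhd_def by blast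
    then show ?case by blast
  next
    case (inv s)
    have "x \<otimes> inv s \<in> K (Suc n)" if "x \<in> K n" for n x
      using K(2)[of n] that inv unfolding nbhd_def by blast
    then show ?case by blast
  next
    case (eng h1 h2)
    show ?case
    proof (intro allI ballI)
      fix n x assume "x \<in> K n"
      moreover from this have "x \<in> carrier G" using K(1) by (auto simp: good_def)
      moreover have "h1 \<in> carrier G" "h2 \<in> carrier G" using generate_in_carrier[OF S(2)] eng by auto
      ultimately show "\<exists>n'. x \<otimes> (h1 \<otimes> h2) \<in> K n'" using eng by (metis m_assoc)
    qed
  qed
  have all: "\<exists>n. x \<in> K n" if "x \<in> carrier G" for x
    using mem[of x] that S(3) K(2)[of 0] by (force simp: nbhd_def)
  have "one_ended_space (cayley_graph G S)"
    unfolding one_ended_space_def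
  proof (intro exI[of _ L] conjI allI)
    show "incseq L"
      using inc by (fastforce simp: incseq_def L_def graph_points_def)
    show "compactin (cayley_graph G S) (L n)" for n
    proof -
      have Kn: "finite (K n)" "K n \<subseteq> carrier G" using K(1) by (auto simp: good_def)
      have "finite {e \<in> ?E. fst e \<in> K n \<and> ?tgt e \<in> K n}"
        by (rule finite_subset[of _ "K n \<times> S"]) (use Kn S in auto)
      then show ?thesis
        unfolding cayley_graph_def L_def
        by (rule compactin_graph_points[OF E Kn]) auto
    qed
    have top: "topspace (cayley_graph G S) = graph_points (carrier G) ?E"
      unfolding cayley_graph_def by (rule topspace_graph_space[OF E])
    show "topspace (cayley_graph G S) = (\<Union>n. L n)"
    proof
      show "(\<Union>n. L n) \<subseteq> topspace (cayley_graph G S)"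
      proof -
        have "K n \<subseteq> carrier G" for n using K(1) by (auto simp: good_def)
        then show ?thesis by (fastforce simp: top L_def graph_points_def)
      qed
      show "topspace (cayley_graph G S) \<subseteq> (\<Union>n. L n)"
      proof
        fix p assume p: "p \<in> topspace (cayley_graph G S)"
        show "p \<in> (\<Union>n. L n)"
        proof (cases p)
          case (Vertex x)
          then have "x \<in> carrier G" using p by (auto simp: top graph_points_def)
          from all[OF this] obtain n where "x \<in> K n" ..
          then have "p \<in> L n" using Vertex by (simp add: L_def graph_points_def)
          then show ?thesis by blast
        next
          case (Inner e t)
          then obtain x s where e: "e = (x, s)" "x \<in> carrier G" "s \<in> S" "0 < t" "t < 1"
            using p by (auto simp: top graph_points_def)
          from all[OF e(2)] obtain n where n: "x \<in> K n" ..
          \<comment> \<open>One index later: \<open>L n\<close> contains an edge only if both its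
            ends lie in \<open>K n\<close>.\<close>
          then have "x \<otimes> s \<in> K (Suc n)" "x \<in> K (Suc n)" using K(2)[of n] e(3) by (auto simp: nbhd_def)
          then have "p \<in> L (Suc n)" using Inner e by (auto simp: L_def graph_points_def)
          then show ?thesis by blast
        qed
      qed
    qed
    show "connectedin (cayley_graph G S) (topspace (cayley_graph G S) - L n)" for n
      unfolding top L_def unfolding cayley_graph_def
    proof (rule connectedin_graph_complement[OF E])
      show "K n \<subseteq> carrier G" using K(1) by (auto simp: good_def)
      fix x y assume "x \<in> carrier G - K n" "y \<in> carrier G - K n"
      then have "(x, y) \<in> (adjacency G S (carrier G - K n))\<^sup>*" using K(1) by (auto simp: good_def)
      then show "(x, y) \<in> {(x, y). x \<in> carrier G - K n \<and> y \<in> carrier G - K n \<and>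
         (\<exists>e\<in>?E. fst e = x \<and> ?tgt e = y \<or> fst e = y \<and> ?tgt e = x)}\<^sup>*"
        by (rule rtrancl_mono[THEN subsetD, rotated]) (auto simp: adjacency_def)
    qed
  qed
  then show ?thesis using S by (auto simp: one_ended_group_def)
qed

section \<open>Lines\<close>

text \<open>\<open>crosses G A g z\<close> says that the two ends of the coset \<open>g\<langle>z\<rangle>\<close> lie on different sides of \<open>A\<close>.\<close>

definition crosses :: "('a, 'b) monoid_scheme \<Rightarrow> ('a \<Rightarrow> bit) \<Rightarrow> 'a \<Rightarrow> 'a \<Rightarrow> bool" where
  "crosses G A g z \<longleftrightarrow>
    (\<exists>K. \<forall>k::int. k \<ge> K \<longrightarrow> A (g \<otimes>\<^bsub>G\<^esub> z [^]\<^bsub>G\<^esub> k) \<noteq> A (g \<otimes>\<^bsub>G\<^esub> z [^]\<^bsub>G\<^esub> (- k)))"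

definition infinite_order :: "('a, 'b) monoid_scheme \<Rightarrow> 'a \<Rightarrow> bool" where
  "infinite_order G z \<longleftrightarrow> z \<in> carrier G \<and> inj (\<lambda>k::int. z [^]\<^bsub>G\<^esub> k)"

lemma int_eventually_constant:
  fixes f :: "int \<Rightarrow> 'b"
  assumes "finite {k. f (k + 1) \<noteq> f k}"
  shows "\<exists>K>0. \<forall>k\<ge>K. f k = f K \<and> f (- k) = f (- K)"
proof -
  obtain K0 where K0: "abs ` {k. f (k + 1) \<noteq> f k} \<subseteq> {..<K0}"
    using assms unfolding finite_int_iff_bounded by blast
  define K where "K = max K0 1"
  have stp: "f (k + 1) = f k" if "\<bar>k\<bar> \<ge> K" for k
  proof (rule ccontr)
    assume "f (k + 1) \<noteq> f k"
    then have "\<bar>k\<bar> < K0" using K0 by blast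
    with that show False by (simp add: K_def)
  qed
  have "K > 0" by (simp add: K_def)
  moreover have "f k = f K" if "k \<ge> K" for k
    using that
  proof (induction k rule: int_ge_induct)
    case (step i) then show ?case using \<open>K > 0\<close> stp[of i] by simp
  qed simp
  moreover have "f (- k) = f (- K)" if "k \<ge> K" for k
    using that
  proof (induction k rule: int_ge_induct)
    case (step i) then show ?case using \<open>K > 0\<close> stp[of "- (i + 1)"] by simp
  qed simp
  ultimately show ?thesis by blast
qed

lemma sum_telescope_bit:
  fixes f :: "int \<Rightarrow> bit"
  shows "(\<Sum>k\<in>{a..<a + int n}. f (k + 1) + f k) = f (a + int n) + f a"
proof (induction n)
  case (Suc n)
  have "{a..<a + int (Suc n)} = insert (a + int n) {a..<a + int n}" by auto
  then show ?case using Suc by (simp add: ac_simps)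
qed simp

lemma sum_bit_sym_diff:
  fixes W :: "'a \<Rightarrow> bit"
  assumes "finite P" "finite Q"
  shows "sum W P + sum W Q = sum W ((P - Q) \<union> (Q - P))"
proof -
  have "sum W P = sum W (P - Q) + sum W (P \<inter> Q)"
    using assms by (metis sum.Int_Diff add.commute)
  moreover have "sum W Q = sum W (Q - P) + sum W (P \<inter> Q)"
    using assms by (metis sum.Int_Diff add.commute Int_commute)
  moreover have "sum W ((P - Q) \<union> (Q - P)) = sum W (P - Q) + sum W (Q - P)"
    using assms by (intro sum.union_disjoint) auto
  ultimately show ?thesis by (simp add: ac_simps)
qed

context group
begin

lemma line_inj: "infinite_order G z \<Longrightarrow> g \<in> carrier G \<Longrightarrow> inj (\<lambda>k::int. g \<otimes> z [^] k)"
proof (rule injI)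
  fix k l :: int
  assume "infinite_order G z" "g \<in> carrier G" "g \<otimes> z [^] k = g \<otimes> z [^] l"
  moreover from this have "z [^] k = z [^] l" by (simp add: infinite_order_def)
  ultimately show "k = l" unfolding infinite_order_def by (blast dest: injD)
qed

lemma line_step: "z \<in> carrier G \<Longrightarrow> g \<in> carrier G \<Longrightarrow> g \<otimes> z [^] k \<otimes> z = g \<otimes> z [^] (k + 1)" for k :: int
  by (simp add: m_assoc int_pow_mult)

lemma finite_line_preimage:
  assumes "infinite_order G z" "g \<in> carrier G" "finite F"
  shows "finite {k::int. g \<otimes> z [^] k \<in> F}"
  using finite_vimageI[OF assms(3) line_inj[OF assms(1,2)]] by (simp add: vimage_def)

lemma finite_line_changes:
  assumes A: "almost_invariant G A" and z: "infinite_order G z" "g \<in> carrier G"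
  shows "finite {k::int. A (g \<otimes> z [^] (k + 1)) \<noteq> A (g \<otimes> z [^] k)}"
proof -
  have zc: "z \<in> carrier G" using z by (simp add: infinite_order_def)
  have "finite {x \<in> carrier G. A (x \<otimes> z) \<noteq> A x}" using A zc by (simp add: almost_invariant_def)
  from finite_line_preimage[OF z this] show ?thesis
    using zc z(2) by (simp add: line_step)
qed

lemma line_limits:
  assumes "almost_invariant G A" "infinite_order G z" "g \<in> carrier G"
  obtains K :: int where "K > 0" "\<And>k. k \<ge> K \<Longrightarrow> A (g \<otimes> z [^] k) = A (g \<otimes> z [^] K)"
    "\<And>k. k \<ge> K \<Longrightarrow> A (g \<otimes> z [^] (- k)) = A (g \<otimes> z [^] (- K))"
proof -
  obtain K :: int where "K > 0"
    "\<forall>k\<ge>K. A (g \<otimes> z [^] k) = A (g \<otimes> z [^] K) \<and> A (g \<otimes> z [^] (- k)) = A (g \<otimes> z [^] (- K))"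
    using int_eventually_constant[OF finite_line_changes[OF assms]] by blast
  then show ?thesis by (intro that[of K]) blast+
qed

text \<open>Comparing opposite points far out amounts to comparing the two limits, as the values are
  eventually constant. All later evaluations of \<open>crosses\<close> pass through this
  form.\<close>

lemma crosses_iff:
  assumes "\<And>k::int. k \<ge> K \<Longrightarrow> A (g \<otimes> z [^] k) = a \<and> A (g \<otimes> z [^] (- k)) = b"
  shows "crosses G A g z \<longleftrightarrow> a \<noteq> b"
proof
  assume "crosses G A g z"
  then obtain L :: int where "\<forall>k\<ge>L. A (g \<otimes> z [^] k) \<noteq> A (g \<otimes> z [^] (- k))" unfolding crosses_def by blast
  then have "A (g \<otimes> z [^] (max K L)) \<noteq> A (g \<otimes> z [^] (- max K L))" by simp
  then show "a \<noteq> b" using assms[of "max K L"] by simp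
next
  assume "a \<noteq> b"
  then show "crosses G A g z" unfolding crosses_def using assms by (intro exI[of _ K]) auto
qed

text \<open>Shifting the base point by \<open>j\<close> moves each threshold by at most the absolute
  value of \<open>j\<close>. Hence crossing is a property of the coset and not of its chosen
  point.\<close>

lemma crosses_shift:
  assumes A: "almost_invariant G A" and z: "infinite_order G z" and g: "g \<in> carrier G"
  shows "crosses G A (g \<otimes> z [^] (j::int)) z \<longleftrightarrow> crosses G A g z"
proof -
  obtain K :: int where K: "K > 0" "\<And>k. k \<ge> K \<Longrightarrow> A (g \<otimes> z [^] k) = A (g \<otimes> z [^] K)"
    "\<And>k. k \<ge> K \<Longrightarrow> A (g \<otimes> z [^] (- k)) = A (g \<otimes> z [^] (- K))"
    using line_limits[OF A z g] by metis
  have zc: "z \<in> carrier G" using z by (simp add: infinite_order_def)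
  have "g \<otimes> z [^] j \<otimes> z [^] k = g \<otimes> z [^] (j + k)" for k
    using zc g by (simp add: m_assoc int_pow_mult)
  moreover have "- (- j + k) = j - k" for k by simp
  ultimately have "crosses G A (g \<otimes> z [^] j) z \<longleftrightarrow> A (g \<otimes> z [^] K) \<noteq> A (g \<otimes> z [^] (- K))"
    using K(2)[of "j + _"] K(3)[of "- j + _"]
    by (intro crosses_iff[of "K + \<bar>j\<bar>"]) auto
  also have "\<dots> \<longleftrightarrow> crosses G A g z"
    by (rule crosses_iff[symmetric, of K]) (use K(2,3) in blast)
  finally show ?thesis .
qed


lemma infinite_order_of_pow:
  assumes "infinite_order G (z [^] (n::int))" "z \<in> carrier G"
  shows "infinite_order G z" "n \<noteq> 0"
proof -
  have i: "inj (\<lambda>k::int. z [^] (n * k))" using assms by (simp add: infinite_order_def int_pow_pow)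
  show n: "n \<noteq> 0"
  proof
    assume "n = 0"
    then have "z [^] (n * 0) = z [^] (n * 1)" by simp
    then show False using i by (metis injD zero_neq_one)
  qed
  have "k = l" if "z [^] k = z [^] l" for k l :: int
  proof -
    have "z [^] (n * k) = z [^] (n * l)"
      using that assms(2) by (metis int_pow_pow mult.commute)
    then show "k = l" using i by (metis injD)
  qed
  then show "infinite_order G z" using assms(2) by (auto simp: infinite_order_def inj_def)
qed

text \<open>A subgroup of finite index sees the same two ends, possibly exchanged when
  \<open>n\<close> is negative. This is needed because an edge group may be a proper subgroup of the
  infinite cyclic group that contains it.\<close>

lemma crosses_pow:
  assumes A: "almost_invariant G A" and z: "infinite_order G z" and g: "g \<in> carrier G"
    and n: "n \<noteq> (0::int)"
  shows "crosses G A g (z [^] n) \<longleftrightarrow> crosses G A g z"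
proof -
  obtain K :: int where K: "K > 0" "\<And>k. k \<ge> K \<Longrightarrow> A (g \<otimes> z [^] k) = A (g \<otimes> z [^] K)"
    "\<And>k. k \<ge> K \<Longrightarrow> A (g \<otimes> z [^] (- k)) = A (g \<otimes> z [^] (- K))"
    using line_limits[OF A z g] by metis
  have zc: "z \<in> carrier G" using z by (simp add: infinite_order_def)
  have pp: "(z [^] n) [^] k = z [^] (n * k)" for k :: int using zc by (simp add: int_pow_pow)
  have base: "crosses G A g z \<longleftrightarrow> A (g \<otimes> z [^] K) \<noteq> A (g \<otimes> z [^] (- K))"
    by (rule crosses_iff[of K]) (use K(2,3) in blast)
  show ?thesis
  proof (cases "n > 0")
    case True
    have ge: "n * k \<ge> K" if "k \<ge> K" for k using True K(1) that
      by (smt (verit) mult_le_cancel_right1)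
    have "crosses G A g (z [^] n) \<longleftrightarrow> A (g \<otimes> z [^] K) \<noteq> A (g \<otimes> z [^] (- K))"
      by (rule crosses_iff[of K]) (simp add: pp K(2)[OF ge] K(3)[OF ge])
    then show ?thesis using base by simp
  next
    case False
    have ge: "- (n * k) \<ge> K" if "k \<ge> K" for k using False n K(1) that
      by (smt (verit) mult_le_cancel_right1 mult_minus_left)
    have "crosses G A g (z [^] n) \<longleftrightarrow> A (g \<otimes> z [^] (- K)) \<noteq> A (g \<otimes> z [^] K)"
      by (rule crosses_iff[of K]) (use K(2)[OF ge] K(3)[OF ge] in \<open>simp add: pp\<close>)
    then show ?thesis using base by auto
  qed
qed

lemma int_pow_intertwine:
  assumes zc: "z \<in> carrier G" and t: "t \<in> carrier G" "z' \<in> carrier G" "z \<otimes> t = t \<otimes> z'"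
  shows "z [^] (k::int) \<otimes> t = t \<otimes> z' [^] k"
proof -
  have inv_eq: "inv z \<otimes> t = t \<otimes> inv z'"
  proof -
    have "inv z \<otimes> t = inv z \<otimes> (t \<otimes> z') \<otimes> inv z'" using t zc by (simp add: m_assoc)
    also have "\<dots> = inv z \<otimes> (z \<otimes> t) \<otimes> inv z'" using t(3) by simp
    also have "\<dots> = t \<otimes> inv z'" using t(1,2) zc by (simp add: m_assoc[symmetric])
    finally show ?thesis .
  qed
  show ?thesis
  proof (induction k rule: int_induct[of _ 0])
    case base then show ?case using t zc by simp
  next
    case (step1 i)
    have "z [^] (i + 1) \<otimes> t = z [^] i \<otimes> (z \<otimes> t)" using t zc by (simp add: int_pow_mult m_assoc)
    also have "\<dots> = z [^] i \<otimes> t \<otimes> z'" using t zc by (simp add: m_assoc)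
    also have "\<dots> = t \<otimes> z' [^] (i + 1)" using step1(2) t zc by (simp add: int_pow_mult m_assoc)
    finally show ?case .
  next
    case (step2 i)
    have "z [^] (i - 1) \<otimes> t = z [^] i \<otimes> (inv z \<otimes> t)" using t zc by (simp add: int_pow_diff m_assoc)
    also have "\<dots> = z [^] i \<otimes> t \<otimes> inv z'" using t zc by (simp add: m_assoc inv_eq)
    also have "\<dots> = t \<otimes> z' [^] (i - 1)" using step2(2) t zc by (simp add: int_pow_diff m_assoc)
    finally show ?case .
  qed
qed

text \<open>Right multiplication by \<open>t\<close> carries the line of \<open>z\<close> to a
  parallel line of \<open>z'\<close>, and almost invariance makes \<open>A\<close> agree on the two
  outside a finite set. With a stable letter for \<open>t\<close>, an edge of the Bass-Serre tree
  crosses as seen from one end iff it does from the other.\<close>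

lemma crosses_translate:
  assumes A: "almost_invariant G A" and z: "infinite_order G z" and g: "g \<in> carrier G"
    and t: "t \<in> carrier G" "z' \<in> carrier G" "z \<otimes> t = t \<otimes> z'"
  shows "infinite_order G z'" "crosses G A (g \<otimes> t) z' \<longleftrightarrow> crosses G A g z"
proof -
  have zc: "z \<in> carrier G" using z by (simp add: infinite_order_def)
  note pow = int_pow_intertwine[OF zc t]
  show io: "infinite_order G z'"
    unfolding infinite_order_def
  proof (intro conjI injI t(2))
    fix k l :: int assume "z' [^] k = z' [^] l"
    then have "z [^] k \<otimes> t = z [^] l \<otimes> t" by (simp add: pow)
    then have "z [^] k = z [^] l" using t zc by simp
    then show "k = l" using z by (auto simp: infinite_order_def inj_def)
  qed
  have "finite {x \<in> carrier G. A (x \<otimes> t) \<noteq> A x}" using A t by (simp add: almost_invariant_def)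
  from finite_line_preimage[OF z g this]
  have "finite {k::int. A (g \<otimes> z [^] k \<otimes> t) \<noteq> A (g \<otimes> z [^] k)}" using g zc by simp
  then obtain N where N: "abs ` {k::int. A (g \<otimes> z [^] k \<otimes> t) \<noteq> A (g \<otimes> z [^] k)} \<subseteq> {..<N}"
    unfolding finite_int_iff_bounded by blast
  have eq: "A (g \<otimes> t \<otimes> z' [^] k) = A (g \<otimes> z [^] k)" if "\<bar>k\<bar> > N" for k
  proof -
    have "g \<otimes> t \<otimes> z' [^] k = g \<otimes> z [^] k \<otimes> t" using g t zc by (simp add: m_assoc pow)
    moreover have "A (g \<otimes> z [^] k \<otimes> t) = A (g \<otimes> z [^] k)"
    proof (rule ccontr)
      assume "A (g \<otimes> z [^] k \<otimes> t) \<noteq> A (g \<otimes> z [^] k)"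
      then have "\<bar>k\<bar> < N" using N by blast
      with that show False by simp
    qed
    ultimately show ?thesis by simp
  qed
  obtain K :: int where K: "K > 0" "\<And>k. k \<ge> K \<Longrightarrow> A (g \<otimes> z [^] k) = A (g \<otimes> z [^] K)"
    "\<And>k. k \<ge> K \<Longrightarrow> A (g \<otimes> z [^] (- k)) = A (g \<otimes> z [^] (- K))"
    using line_limits[OF A z g] by metis
  have "crosses G A (g \<otimes> t) z' \<longleftrightarrow> A (g \<otimes> z [^] K) \<noteq> A (g \<otimes> z [^] (- K))"
  proof (rule crosses_iff[of "max K (N + 1)"])
    fix k assume k: "k \<ge> max K (N + 1)"
    then have "\<bar>k\<bar> > N" "\<bar>- k\<bar> > N" by auto
    with k show "A (g \<otimes> t \<otimes> z' [^] k) = A (g \<otimes> z [^] K) \<and>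
        A (g \<otimes> t \<otimes> z' [^] (- k)) = A (g \<otimes> z [^] (- K))"
      using eq[of k] eq[of "- k"] K(2)[of k] K(3)[of k] by simp
  qed
  also have "\<dots> \<longleftrightarrow> crosses G A g z"
    by (rule crosses_iff[symmetric, of K]) (use K(2,3) in blast)
  finally show "crosses G A (g \<otimes> t) z' \<longleftrightarrow> crosses G A g z" .
qed

text \<open>\<open>M\<close> is a union of lines, and on each of them \<open>A\<close> has the same
  limit in both directions. Let \<open>P\<close> be the set of points where \<open>A\<close> differs
  from this limit: it is finite, and \<open>A\<close> changes along \<open>z\<close> exactly where
  the indicator of \<open>P\<close> does. So the changes are the mod 2 boundary of \<open>P\<close>.
  The weight \<open>W\<close> is arbitrary, since it will be specialised both to the constant 1 and
  to chains of edges.\<close>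

lemma sum_noncrossing:
  assumes A: "almost_invariant G A" and z: "infinite_order G z"
    and M: "M \<subseteq> carrier G" "\<And>h. h \<in> M \<Longrightarrow> h \<otimes> z \<in> M" "\<And>h. h \<in> M \<Longrightarrow> h \<otimes> inv z \<in> M"
    and nc: "\<And>h. h \<in> M \<Longrightarrow> \<not> crosses G A h z"
  shows "\<exists>P. finite P \<and> P \<subseteq> M \<and>
    (\<forall>W::'a \<Rightarrow> bit. (\<Sum>h | h \<in> M \<and> A (h \<otimes> z) \<noteq> A h. W h) = (\<Sum>h\<in>P. W h + W (h \<otimes> inv z)))"
proof -
  have zc: "z \<in> carrier G" using z by (simp add: infinite_order_def)
  \<comment> \<open>Only the limit in the positive direction is used; \<open>nc\<close> says that
    the other one equals it.\<close>
  define lim where "lim h a \<longleftrightarrow> (\<exists>K. \<forall>k::int. k \<ge> K \<longrightarrow> A (h \<otimes> z [^] k) = a)" for h a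
  define L where "L h = (THE a. lim h a)" for h
  have uniq: "a = b" if "lim h a" "lim h b" for h a b
  proof -
    from that obtain K K' :: int where "\<forall>k\<ge>K. A (h \<otimes> z [^] k) = a" "\<forall>k\<ge>K'. A (h \<otimes> z [^] k) = b"
      unfolding lim_def by blast
    moreover have "K \<le> max K K'" "K' \<le> max K K'" by simp_all
    ultimately have "A (h \<otimes> z [^] (max K K')) = a" "A (h \<otimes> z [^] (max K K')) = b" by blast+
    then show ?thesis by simp
  qed
  have Leq: "L h = a" if "lim h a" for h a
    unfolding L_def using that uniq by blast
  have L: "lim h (L h)" if h: "h \<in> carrier G" for h
  proof -
    obtain K :: int where "\<And>k. k \<ge> K \<Longrightarrow> A (h \<otimes> z [^] k) = A (h \<otimes> z [^] K)"
      using line_limits[OF A z h] by metis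
    then have "lim h (A (h \<otimes> z [^] K))" unfolding lim_def by blast
    then show ?thesis using Leq by simp
  qed
  have Lshift: "L (h \<otimes> z [^] (j::int)) = L h" if h: "h \<in> carrier G" for h j
  proof (rule Leq)
    obtain K :: int where K: "\<And>k. k \<ge> K \<Longrightarrow> A (h \<otimes> z [^] k) = L h" using L[OF h] unfolding lim_def by blast
    show "lim (h \<otimes> z [^] j) (L h)" unfolding lim_def
    proof (intro exI allI impI)
      fix k assume "K - j \<le> k"
      then have "A (h \<otimes> z [^] (j + k)) = L h" using K[of "j + k"] by simp
      then show "A (h \<otimes> z [^] j \<otimes> z [^] k) = L h" using h zc by (simp add: m_assoc int_pow_mult)
    qed
  qed
  have Lz: "L (h \<otimes> z) = L h" if "h \<in> carrier G" for h
    using Lshift[OF that, of 1] zc by (simp add: int_pow_1)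
  have Mpow: "h \<otimes> z [^] (k::int) \<in> M" if h: "h \<in> M" for h k
  proof (induction k rule: int_induct[of _ 0])
    case base then show ?case using h M by auto
  next
    case (step1 i)
    then show ?case using M(2)[OF step1(2)] h M(1) zc by (auto simp: line_step)
  next
    case (step2 i)
    have "z [^] (i - 1) = z [^] i \<otimes> inv z" using zc by (simp add: int_pow_diff)
    then show ?case using M(3)[OF step2(2)] h M(1) zc by (auto simp: m_assoc)
  qed
  define D where "D = {h \<in> M. A (h \<otimes> z) \<noteq> A h}"
  have D: "finite D"
  proof (rule finite_subset)
    show "D \<subseteq> {x \<in> carrier G. A (x \<otimes> z) \<noteq> A x}" using M(1) by (auto simp: D_def)
  qed (use A zc in \<open>simp add: almost_invariant_def\<close>)
  define P where "P = {h \<in> M. A h \<noteq> L h}"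
  have Pline: "finite {k::int. h \<otimes> z [^] k \<in> P}" if h: "h \<in> M" for h
  proof -
    have hc: "h \<in> carrier G" using h M by auto
    obtain K :: int where K: "K > 0" "\<And>k. k \<ge> K \<Longrightarrow> A (h \<otimes> z [^] k) = A (h \<otimes> z [^] K)"
      "\<And>k. k \<ge> K \<Longrightarrow> A (h \<otimes> z [^] (- k)) = A (h \<otimes> z [^] (- K))"
      using line_limits[OF A z hc] by metis
    have "crosses G A h z \<longleftrightarrow> A (h \<otimes> z [^] K) \<noteq> A (h \<otimes> z [^] (- K))"
      by (rule crosses_iff[of K]) (use K(2,3) in blast)
    then have e: "A (h \<otimes> z [^] K) = A (h \<otimes> z [^] (- K))" using nc[OF h] by simp
    have "lim h (A (h \<otimes> z [^] K))" using K(2) unfolding lim_def by blast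
    then have Lh: "L h = A (h \<otimes> z [^] K)" by (rule Leq)
    have "k \<in> {-K..K}" if "h \<otimes> z [^] k \<in> P" for k
    proof (rule ccontr)
      assume "k \<notin> {-K..K}"
      then consider "k \<ge> K" | "- k \<ge> K" by force
      then have "A (h \<otimes> z [^] k) = L h"
        using K(2)[of k] K(3)[of "- k"] e Lh by cases auto
      then show False using that Lshift[OF hc] by (simp add: P_def)
    qed
    then have "{k::int. h \<otimes> z [^] k \<in> P} \<subseteq> {-K..K}" by blast
    then show ?thesis by (rule finite_subset) simp
  qed
  \<comment> \<open>A line along which \<open>A\<close> never changes has its limit as constant
    value and does not meet \<open>P\<close>. So \<open>P\<close> lies on the lines through the
    finite set \<open>D\<close>.\<close>
  have "P \<subseteq> (\<Union>h\<in>D. (\<lambda>k::int. h \<otimes> z [^] k) ` {k. h \<otimes> z [^] k \<in> P})"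
  proof
    fix h assume h: "h \<in> P"
    then have hM: "h \<in> M" "h \<in> carrier G" using M by (auto simp: P_def)
    have "\<exists>k::int. A (h \<otimes> z [^] (k + 1)) \<noteq> A (h \<otimes> z [^] k)"
    proof (rule ccontr)
      assume "\<not> ?thesis"
      then have stp: "A (h \<otimes> z [^] (k + 1)) = A (h \<otimes> z [^] k)" for k :: int by blast
      have "A (h \<otimes> z [^] k) = A h" if "k \<ge> 0" for k :: int
        using that
      proof (induction k rule: int_ge_induct)
        case base show ?case using hM by simp
      next
        case (step i) then show ?case using stp[of i] by simp
      qed
      then have "lim h (A h)" unfolding lim_def by blast
      then show False using h Leq by (auto simp: P_def)
    qed
    then obtain k :: int where k: "h \<otimes> z [^] k \<in> D"
      using Mpow[OF hM(1)] zc hM by (auto simp: D_def line_step)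
    have "h = (h \<otimes> z [^] k) \<otimes> z [^] (- k)" using hM zc by (simp add: m_assoc int_pow_mult[symmetric])
    with k h show "h \<in> (\<Union>h\<in>D. (\<lambda>k::int. h \<otimes> z [^] k) ` {k. h \<otimes> z [^] k \<in> P})"
      by (intro UN_I[OF k] image_eqI[of _ _ "- k"]) auto
  qed
  moreover have "finite (\<Union>h\<in>D. (\<lambda>k::int. h \<otimes> z [^] k) ` {k. h \<otimes> z [^] k \<in> P})"
    using D Pline by (intro finite_UN_I finite_imageI) (auto simp: D_def)
  ultimately have P: "finite P" by (rule finite_subset)
  define Q where "Q = (\<lambda>h. h \<otimes> inv z) ` P"
  have Q: "finite Q" using P by (simp add: Q_def)
  have Qiff: "h \<in> Q \<longleftrightarrow> h \<in> M \<and> h \<otimes> z \<in> P" for h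
  proof
    assume "h \<in> Q"
    then show "h \<in> M \<and> h \<otimes> z \<in> P" using M zc by (auto simp: Q_def P_def m_assoc)
  next
    assume a: "h \<in> M \<and> h \<otimes> z \<in> P"
    then have "h = (h \<otimes> z) \<otimes> inv z" using M zc by (auto simp: m_assoc)
    with a show "h \<in> Q" unfolding Q_def by blast
  qed
  \<comment> \<open>As \<open>L\<close> is constant along lines, \<open>A\<close> changes between
    \<open>h\<close> and \<open>h \<otimes> z\<close> iff exactly one of these two points is in
    \<open>P\<close>; and \<open>h \<otimes> z\<close> is in \<open>P\<close> iff \<open>h\<close>
    is in \<open>Q\<close>.\<close>
  have Deq: "D = (P - Q) \<union> (Q - P)"
  proof -
    have "A (h \<otimes> z) \<noteq> A h \<longleftrightarrow> (A h \<noteq> L h) \<noteq> (A (h \<otimes> z) \<noteq> L h)" for h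
      by (cases "A h"; cases "A (h \<otimes> z)"; cases "L h") auto
    then show ?thesis using Qiff M Lz by (auto simp: D_def P_def)
  qed
  have "(\<Sum>h\<in>D. W h) = (\<Sum>h\<in>P. W h + W (h \<otimes> inv z))" for W :: "'a \<Rightarrow> bit"
  proof -
    have "inj_on (\<lambda>h. h \<otimes> inv z) (carrier G)" using zc by (auto simp: inj_on_def)
    then have "inj_on (\<lambda>h. h \<otimes> inv z) P" by (rule inj_on_subset) (use M(1) in \<open>auto simp: P_def\<close>)
    then have "sum W Q = (\<Sum>h\<in>P. W (h \<otimes> inv z))" unfolding Q_def by (simp add: sum.reindex)
    then show ?thesis unfolding Deq using sum_bit_sym_diff[OF P Q, of W] by (simp add: sum.distrib)
  qed
  then show ?thesis using P unfolding D_def by (intro exI[of _ P]) (auto simp: P_def)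
qed

text \<open>The number of changes telescopes modulo 2 to the sum of the two limits, which
  differ.\<close>

lemma sum_crossing_line:
  assumes A: "almost_invariant G A" and z: "infinite_order G z" and g: "g \<in> carrier G"
    and cr: "crosses G A g z"
  shows "(\<Sum>h | h \<in> range (\<lambda>k::int. g \<otimes> z [^] k) \<and> A (h \<otimes> z) \<noteq> A h. (1::bit)) = 1"
proof -
  have zc: "z \<in> carrier G" using z by (simp add: infinite_order_def)
  define f where "f k = A (g \<otimes> z [^] (k::int))" for k
  define D where "D = {k. f (k + 1) \<noteq> f k}"
  obtain K :: int where K: "K > 0" "\<And>k. k \<ge> K \<Longrightarrow> f k = f K" "\<And>k. k \<ge> K \<Longrightarrow> f (- k) = f (- K)"
    using line_limits[OF A z g] unfolding f_def by metis
  have "crosses G A g z \<longleftrightarrow> f K \<noteq> f (- K)"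
    by (rule crosses_iff[of K]) (use K(2,3) in \<open>unfold f_def, blast\<close>)
  with cr have fK: "f K \<noteq> f (- K)" by simp
  have DK: "D \<subseteq> {-K..<K}"
  proof
    fix k assume k: "k \<in> D"
    show "k \<in> {-K..<K}"
    proof (rule ccontr)
      assume "k \<notin> {-K..<K}"
      then consider "k \<ge> K" | "- k \<ge> K" "- (k + 1) \<ge> K" by force
      then have "f (k + 1) = f k"
        using K(2)[of k] K(2)[of "k + 1"] K(3)[of "- k"] K(3)[of "- (k + 1)"]
        by cases (auto simp: add.commute)
      with k show False by (simp add: D_def)
    qed
  qed
  have "{h. h \<in> range (\<lambda>k::int. g \<otimes> z [^] k) \<and> A (h \<otimes> z) \<noteq> A h} = (\<lambda>k. g \<otimes> z [^] k) ` D"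
    using zc g by (auto simp: D_def f_def line_step)
  moreover have "inj_on (\<lambda>k. g \<otimes> z [^] k) D"
    using line_inj[OF z g] by (rule inj_on_subset) simp
  ultimately have "(\<Sum>h | h \<in> range (\<lambda>k::int. g \<otimes> z [^] k) \<and> A (h \<otimes> z) \<noteq> A h. (1::bit)) = (\<Sum>k\<in>D. 1)"
    by (simp add: sum.reindex del: sum_constant)
  also have "\<dots> = (\<Sum>k\<in>D. f (k + 1) + f k)"
    by (rule sum.cong) (auto simp: D_def bit_add_eq_1_iff)
  also have "\<dots> = (\<Sum>k\<in>{-K..<K}. f (k + 1) + f k)"
    by (rule sum.mono_neutral_left) (use DK in \<open>auto simp: D_def bit_add_eq_0_iff\<close>)
  also have "\<dots> = f K + f (- K)"
    using sum_telescope_bit[of f "- K" "nat (2 * K)"] K(1) by simp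
  also have "\<dots> = 1" using fK by (simp add: bit_add_eq_1_iff)
  finally show ?thesis .
qed

end

section \<open>Quadratic words and surface groups\<close>

text \<open>The letters of \<open>I\<close> label edges with a face on each of two sides, those of
  \<open>B\<close> edges of the boundary. Building the relator block by block in fresh letters makes
  an induction possible in which the link of a vertex grows by one arc per block.\<close>

inductive quadratic_word :: "'x word \<Rightarrow> 'x set \<Rightarrow> 'x set \<Rightarrow> bool" where
  empty: "quadratic_word [] {} {}"
| boundary: "quadratic_word r I B \<Longrightarrow> x \<notin> I \<union> B \<Longrightarrow> quadratic_word (r @ [gen x]) I (insert x B)"
| handle: "quadratic_word r I B \<Longrightarrow> a \<notin> I \<union> B \<Longrightarrow> b \<notin> I \<union> B \<Longrightarrow> a \<noteq> b \<Longrightarrow>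
    quadratic_word (r @ [gen a, gen b, gen_inv a, gen_inv b]) (insert a (insert b I)) B"
| crosscap: "quadratic_word r I B \<Longrightarrow> a \<notin> I \<union> B \<Longrightarrow>
    quadratic_word (r @ [gen a, gen a]) (insert a I) B"

lemma quadratic_word_finite: "quadratic_word r I B \<Longrightarrow> finite I \<and> finite B"
  by (induction rule: quadratic_word.induct) auto

lemma quadratic_word_disjoint: "quadratic_word r I B \<Longrightarrow> I \<inter> B = {}"
  by (induction rule: quadratic_word.induct) auto

lemma quadratic_word_letters: "quadratic_word r I B \<Longrightarrow> fst ` set r = I \<union> B"
  by (induction rule: quadratic_word.induct) auto

lemma quadratic_surface_relator:
  "quadratic_word (surface_relator ot g m)
     (GenA ` {..<g} \<union> (if ot then GenB ` {..<g} else {})) (GenP ` {..<m})"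
proof (induction g)
  case 0
  have "quadratic_word (map (\<lambda>k. gen (GenP k)) [0..<m]) {} (GenP ` {..<m})"
  proof (induction m)
    case (Suc m)
    then have "quadratic_word (map (\<lambda>k. gen (GenP k)) [0..<m] @ [gen (GenP m)]) {} (insert (GenP m) (GenP ` {..<m}))"
      by (rule quadratic_word.boundary) auto
    then show ?case by (simp add: lessThan_Suc)
  qed (simp add: quadratic_word.empty)
  then show ?case by (simp add: surface_relator_def)
next
  case (Suc g)
  show ?case
  proof (cases ot)
    case True
    have "quadratic_word (surface_relator ot g m @ [gen (GenA g), gen (GenB g), gen_inv (GenA g), gen_inv (GenB g)])
      (insert (GenA g) (insert (GenB g) (GenA ` {..<g} \<union> GenB ` {..<g}))) (GenP ` {..<m})"
      using Suc True by (intro quadratic_word.handle) auto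
    then show ?thesis using True by (simp add: surface_relator_def lessThan_Suc insert_commute)
  next
    case False
    have "quadratic_word (surface_relator ot g m @ [gen (GenA g), gen (GenA g)])
      (insert (GenA g) (GenA ` {..<g})) (GenP ` {..<m})"
      using Suc False by (intro quadratic_word.crosscap) auto
    then show ?thesis using False by (simp add: surface_relator_def lessThan_Suc)
  qed
qed

text \<open>
  In the Cayley complex of \<open>\<langle>X | r\<rangle>\<close>, position \<open>i\<close> of the face read off from \<open>r\<close> runs along the edge that
  leaves the vertex at offset \<open>edge_start r i\<close> and enters the vertex at offset \<open>edge_end r i\<close>.
\<close>

definition edge_start :: "'x word \<Rightarrow> nat \<Rightarrow> nat" where
  "edge_start r i = (if snd (r ! i) then i else Suc i)"

definition edge_end :: "'x word \<Rightarrow> nat \<Rightarrow> nat" where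
  "edge_end r i = (if snd (r ! i) then Suc i else i)"

definition occurrences :: "'x word \<Rightarrow> 'x \<Rightarrow> nat set" where
  "occurrences r x = {i. i < length r \<and> fst (r ! i) = x}"

text \<open>Chains of edges are functions of a vertex \<open>k\<close> and a label \<open>y\<close>,
  standing for the edge that leaves \<open>k\<close> with label \<open>y\<close>. This is the chain
  of a single edge.\<close>

definition point_chain :: "'h \<Rightarrow> 'x \<Rightarrow> 'h \<Rightarrow> 'x \<Rightarrow> bit" where
  "point_chain h x k y = of_bool (k = h \<and> y = x)"

text \<open>Two positions \<open>i\<close> and \<open>j\<close> of the relator run along the edge
  from \<open>h\<close> labelled \<open>x\<close>, one for each adjacent face. At the start of the
  edge, and again at its end, the corners of these two faces are separated by this edge
  alone.\<close>

definition interior_letter :: "('h, 'b) monoid_scheme \<Rightarrow> ('x \<Rightarrow> 'h) \<Rightarrow> 'x word \<Rightarrow>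
    (nat \<Rightarrow> 'h \<Rightarrow> 'h \<Rightarrow> 'x \<Rightarrow> bit) \<Rightarrow> 'x \<Rightarrow> bool" where
  "interior_letter H c r s x \<longleftrightarrow> (\<exists>i j. i \<noteq> j \<and> occurrences r x = {i, j} \<and> (\<forall>h\<in>carrier H. \<forall>k y.
     s (edge_start r i) h k y + s (edge_start r j) h k y = point_chain h x k y \<and>
     s (edge_end r i) (h \<otimes>\<^bsub>H\<^esub> c x) k y + s (edge_end r j) (h \<otimes>\<^bsub>H\<^esub> c x) k y = point_chain h x k y))"

text \<open>Here the two corners lie at the same vertex \<open>h\<close>: one in the face along the
  boundary edge leaving \<open>h\<close>, the other in the face along the boundary edge entering
  \<open>h\<close>. Turning from one to the other through the missing outer side counts both of
  these edges.\<close>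

definition boundary_letter :: "('h, 'b) monoid_scheme \<Rightarrow> ('x \<Rightarrow> 'h) \<Rightarrow> 'x word \<Rightarrow>
    (nat \<Rightarrow> 'h \<Rightarrow> 'h \<Rightarrow> 'x \<Rightarrow> bit) \<Rightarrow> 'x \<Rightarrow> bool" where
  "boundary_letter H c r s x \<longleftrightarrow> (\<exists>i. snd (r ! i) \<and> occurrences r x = {i} \<and> (\<forall>h\<in>carrier H. \<forall>k y.
     s (edge_start r i) h k y + s (edge_end r i) h k y =
     point_chain h x k y + point_chain (h \<otimes>\<^bsub>H\<^esub> inv\<^bsub>H\<^esub> (c x)) x k y))"

text \<open>
  The corners at a vertex \<open>h\<close> are indexed by the offsets of the faces, and turning around \<open>h\<close> from one
  corner to the next crosses an edge; \<open>s i h\<close> is the sum of the edges crossed between the corners \<open>0\<close>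
  and \<open>i\<close>. Since the link of \<open>h\<close> is a circle (once both ends of each boundary line through \<open>h\<close> are joined),
  the full turn crosses every edge at \<open>h\<close> once.
\<close>

definition corner_sums :: "('h, 'b) monoid_scheme \<Rightarrow> ('x \<Rightarrow> 'h) \<Rightarrow> 'x word \<Rightarrow> 'x set \<Rightarrow> 'x set \<Rightarrow>
    (nat \<Rightarrow> 'h \<Rightarrow> 'h \<Rightarrow> 'x \<Rightarrow> bit) \<Rightarrow> bool" where
  "corner_sums H c r I B s \<longleftrightarrow>
    (\<forall>h k y. s 0 h k y = 0) \<and>
    (\<forall>i h k y. y \<notin> I \<union> B \<longrightarrow> s i h k y = 0) \<and>
    (\<forall>h\<in>carrier H. \<forall>k\<in>carrier H. \<forall>y\<in>I \<union> B.
       s (length r) h k y = of_bool (k = h) + of_bool (k \<otimes>\<^bsub>H\<^esub> c y = h)) \<and>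
    (\<forall>x\<in>I. interior_letter H c r s x) \<and> (\<forall>x\<in>B. boundary_letter H c r s x)"

lemma occurrences_append_old:
  "x \<notin> fst ` set v \<Longrightarrow> occurrences (r @ v) x = occurrences r x"
proof -
  assume "x \<notin> fst ` set v"
  then have *: "fst (v ! i) \<noteq> x" if "i < length v" for i using that by (metis image_eqI nth_mem)
  show ?thesis
  proof (intro Set.set_eqI iffI)
    fix i assume i: "i \<in> occurrences (r @ v) x"
    have "i < length r"
    proof (rule ccontr)
      assume "\<not> i < length r"
      then have "i - length r < length v" "fst (v ! (i - length r)) = x"
        using i by (auto simp: occurrences_def nth_append)
      then show False using * by blast
    qed
    then show "i \<in> occurrences r x" using i by (simp add: occurrences_def nth_append)
  qed (simp add: occurrences_def nth_append)
qed

lemma occurrences_append_new: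
  "x \<notin> fst ` set r \<Longrightarrow> occurrences (r @ v) x = (\<lambda>i. length r + i) ` occurrences v x"
proof -
  assume "x \<notin> fst ` set r"
  then have *: "fst (r ! i) \<noteq> x" if "i < length r" for i using that by (metis image_eqI nth_mem)
  show ?thesis
  proof (intro Set.set_eqI iffI)
    fix i assume i: "i \<in> occurrences (r @ v) x"
    then have "i \<ge> length r" using * by (auto simp: occurrences_def nth_append not_less split: if_splits)
    then show "i \<in> (\<lambda>i. length r + i) ` occurrences v x"
      using i by (intro image_eqI[of _ _ "i - length r"]) (auto simp: occurrences_def nth_append)
  qed (auto simp: occurrences_def nth_append)
qed

lemma edge_start_append: "i < length r \<Longrightarrow> edge_start (r @ v) i = edge_start r i"
  by (simp add: edge_start_def nth_append)

lemma edge_end_append: "i < length r \<Longrightarrow> edge_end (r @ v) i = edge_end r i"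
  by (simp add: edge_end_def nth_append)

lemma edge_bounds: "i < length r \<Longrightarrow> edge_start r i \<le> length r" "i < length r \<Longrightarrow> edge_end r i \<le> length r"
  by (auto simp: edge_start_def edge_end_def)

lemma occurrences_less: "i \<in> occurrences r x \<Longrightarrow> i < length r"
  by (simp add: occurrences_def)

text \<open>The turn through the corners of the new block \<open>v\<close> starts where the turn for
  \<open>r\<close> ended, so its sums are shifted by the constant \<open>s (length r)\<close>. This
  constant cancels modulo 2 because every condition on a letter adds up two corners.\<close>

lemma corner_sums_extend:
  assumes s: "corner_sums H c r I B s" and letters: "fst ` set r = I \<union> B"
    and new: "(I' \<union> B') \<inter> (I \<union> B) = {}" "fst ` set v = I' \<union> B'"
    and s': "\<And>i h k y. i \<le> length r \<Longrightarrow> s' i h k y = s i h k y"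
      "\<And>i h k y. length r \<le> i \<Longrightarrow> s' i h k y = s (length r) h k y + t (i - length r) h k y"
    and t0: "\<And>i h k y. y \<notin> I' \<union> B' \<Longrightarrow> t i h k y = 0"
    and tn: "\<And>h k y. h \<in> carrier H \<Longrightarrow> k \<in> carrier H \<Longrightarrow> y \<in> I' \<union> B' \<Longrightarrow>
       t (length v) h k y = of_bool (k = h) + of_bool (k \<otimes>\<^bsub>H\<^esub> c y = h)"
    and tI: "\<And>x. x \<in> I' \<Longrightarrow> interior_letter H c v t x"
    and tB: "\<And>x. x \<in> B' \<Longrightarrow> boundary_letter H c v t x"
  shows "corner_sums H c (r @ v) (I' \<union> I) (B' \<union> B) s'"
proof -
  note sd = s[unfolded corner_sums_def]
  have es: "edge_start (r @ v) (length r + i) = length r + edge_start v i"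
    "edge_end (r @ v) (length r + i) = length r + edge_end v i" for i
    by (auto simp: edge_start_def edge_end_def)
  have s'new: "s' (length r + i) h k y = s (length r) h k y + t i h k y" for i h k y
    using s'(2)[of "length r + i"] by simp
  have cancel: "a + b + (a + d) = b + d" for a b d :: bit
    by (cases a; cases b; cases d) auto
  show ?thesis
    unfolding corner_sums_def
  proof (intro conjI)
    show "\<forall>h k y. s' 0 h k y = 0" using s'(1)[of 0] sd by simp
    show "\<forall>i h k y. y \<notin> I' \<union> I \<union> (B' \<union> B) \<longrightarrow> s' i h k y = 0"
    proof (intro allI impI)
      fix i h k y assume "y \<notin> I' \<union> I \<union> (B' \<union> B)"
      then have "s i h k y = 0" "s (length r) h k y = 0" "t (i - length r) h k y = 0" using sd t0 by auto
      then show "s' i h k y = 0" using s'(1)[of i h k y] s'(2)[of i h k y] by (cases "i \<le> length r") auto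
    qed
    show "\<forall>h\<in>carrier H. \<forall>k\<in>carrier H. \<forall>y\<in>I' \<union> I \<union> (B' \<union> B).
       s' (length (r @ v)) h k y = of_bool (k = h) + of_bool (k \<otimes>\<^bsub>H\<^esub> c y = h)"
    proof (intro ballI)
      fix h k y assume hk: "h \<in> carrier H" "k \<in> carrier H" and y: "y \<in> I' \<union> I \<union> (B' \<union> B)"
      show "s' (length (r @ v)) h k y = of_bool (k = h) + of_bool (k \<otimes>\<^bsub>H\<^esub> c y = h)"
      proof (cases "y \<in> I' \<union> B'")
        case True
        then have "y \<notin> I \<union> B" using new by auto
        then show ?thesis using tn[OF hk True] sd by (simp add: s'new)
      next
        case False
        then have "y \<in> I \<union> B" using y by auto
        then show ?thesis using t0[OF False] sd hk by (simp add: s'new)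
      qed
    qed
    show "\<forall>x\<in>I' \<union> I. interior_letter H c (r @ v) s' x"
    proof
      fix x assume x: "x \<in> I' \<union> I"
      show "interior_letter H c (r @ v) s' x"
      proof (cases "x \<in> I'")
        case True
        then have "x \<notin> fst ` set r" using new letters by auto
        moreover from tI[OF True] obtain i j where ij: "i \<noteq> j" "occurrences v x = {i, j}"
          "\<forall>h\<in>carrier H. \<forall>k y. t (edge_start v i) h k y + t (edge_start v j) h k y = point_chain h x k y \<and>
           t (edge_end v i) (h \<otimes>\<^bsub>H\<^esub> c x) k y + t (edge_end v j) (h \<otimes>\<^bsub>H\<^esub> c x) k y = point_chain h x k y"
          unfolding interior_letter_def by blast
        ultimately have "occurrences (r @ v) x = {length r + i, length r + j}"
          by (simp add: occurrences_append_new)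
        then show ?thesis using ij unfolding interior_letter_def
          by (intro exI[of _ "length r + i"] exI[of _ "length r + j"]) (simp add: es s'new cancel)
      next
        case False
        then have "x \<in> I" "x \<notin> fst ` set v" using x new by auto
        moreover from this sd obtain i j where ij: "i \<noteq> j" "occurrences r x = {i, j}"
          "\<forall>h\<in>carrier H. \<forall>k y. s (edge_start r i) h k y + s (edge_start r j) h k y = point_chain h x k y \<and>
           s (edge_end r i) (h \<otimes>\<^bsub>H\<^esub> c x) k y + s (edge_end r j) (h \<otimes>\<^bsub>H\<^esub> c x) k y = point_chain h x k y"
          unfolding interior_letter_def by metis
        moreover have "i < length r" "j < length r" using ij(2) occurrences_less[of _ r x] by auto
        ultimately show ?thesis unfolding interior_letter_def
          by (intro exI[of _ i] exI[of _ j])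
            (simp add: occurrences_append_old edge_start_append edge_end_append s'(1) edge_bounds)
      qed
    qed
    show "\<forall>x\<in>B' \<union> B. boundary_letter H c (r @ v) s' x"
    proof
      fix x assume x: "x \<in> B' \<union> B"
      show "boundary_letter H c (r @ v) s' x"
      proof (cases "x \<in> B'")
        case True
        then have "x \<notin> fst ` set r" using new letters by auto
        moreover from tB[OF True] obtain i where i: "snd (v ! i)" "occurrences v x = {i}"
          "\<forall>h\<in>carrier H. \<forall>k y. t (edge_start v i) h k y + t (edge_end v i) h k y =
            point_chain h x k y + point_chain (h \<otimes>\<^bsub>H\<^esub> inv\<^bsub>H\<^esub> (c x)) x k y"
          unfolding boundary_letter_def by blast
        ultimately have "occurrences (r @ v) x = {length r + i}"
          by (simp add: occurrences_append_new)
        then show ?thesis using i unfolding boundary_letter_def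
          by (intro exI[of _ "length r + i"]) (simp add: es s'new cancel)
      next
        case False
        then have "x \<in> B" "x \<notin> fst ` set v" using x new by auto
        moreover from this sd obtain i where i: "snd (r ! i)" "occurrences r x = {i}"
          "\<forall>h\<in>carrier H. \<forall>k y. s (edge_start r i) h k y + s (edge_end r i) h k y =
            point_chain h x k y + point_chain (h \<otimes>\<^bsub>H\<^esub> inv\<^bsub>H\<^esub> (c x)) x k y"
          unfolding boundary_letter_def by metis
        moreover have "i < length r" using i(2) occurrences_less[of _ r x] by auto
        ultimately show ?thesis unfolding boundary_letter_def
          by (intro exI[of _ i])
            (simp add: occurrences_append_old edge_start_append edge_end_append s'(1) edge_bounds nth_append)
      qed
    qed
  qed
qed

lemma less_numeral_cases:
  "i < Suc 0 \<longleftrightarrow> i = 0" "i < Suc (Suc 0) \<longleftrightarrow> i = 0 \<or> i = 1"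
  "i < Suc (Suc (Suc (Suc 0))) \<longleftrightarrow> i = 0 \<or> i = 1 \<or> i = 2 \<or> i = (3::nat)"
  by auto

text \<open>The sums \<open>t\<close> of each kind of block are found by walking around the vertex
  \<open>h\<close>, noting the order in which the corners of the block are met and which edge
  separates neighbours. An edge entering \<open>h\<close> with label \<open>x\<close> appears as the
  chain of the edge leaving \<open>h \<otimes> inv (c x)\<close>.\<close>

lemma (in group) corner_sums_exist:
  assumes "quadratic_word r I B" "\<And>x. x \<in> I \<union> B \<Longrightarrow> c x \<in> carrier G"
  shows "\<exists>s. corner_sums G c r I B s"
  using assms
proof (induction rule: quadratic_word.induct)
  case empty
  show ?case by (rule exI[of _ "\<lambda>i h k y. 0"]) (simp add: corner_sums_def)
next
  case (boundary r I B x)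
  then obtain s where s: "corner_sums G c r I B s" by auto
  have x: "c x \<in> carrier G" using boundary.prems by simp
  have sol: "k \<otimes> c x = h \<longleftrightarrow> k = h \<otimes> inv (c x)" if "h \<in> carrier G" "k \<in> carrier G" for h k
    using that x by (metis inv_solve_right')
  define t where "t i h k y = (if i = 0 then 0 else
    point_chain h x k y + point_chain (h \<otimes> inv (c x)) x k y)" for i :: nat and h k y
  define s' where "s' i h k y = (if i \<le> length r then s i h k y
    else s (length r) h k y + t (i - length r) h k y)" for i h k y
  have "corner_sums G c (r @ [gen x]) ({} \<union> I) ({x} \<union> B) s'"
  proof (rule corner_sums_extend[OF s quadratic_word_letters[OF boundary.hyps(1)], of _ _ _ _ t])
    show "boundary_letter G c [gen x] t y" if "y \<in> {x}" for y
      unfolding boundary_letter_def using that by (intro exI[of _ 0])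
        (auto simp: occurrences_def edge_start_def edge_end_def t_def)
  qed (use boundary.hyps x in \<open>auto simp: s'_def t_def point_chain_def sol\<close>)
  then show ?case by auto
next
  case (crosscap r I B a)
  then obtain s where s: "corner_sums G c r I B s" by auto
  have a: "c a \<in> carrier G" using crosscap.prems by simp
  have sol: "k \<otimes> c a = h \<longleftrightarrow> k = h \<otimes> inv (c a)" if "h \<in> carrier G" "k \<in> carrier G" for h k
    using that a by (metis inv_solve_right')
  \<comment> \<open>The corners are met in the order 0, 1, 2; between them lie the edge of
    \<open>a\<close> leaving \<open>h\<close> and the edge of \<open>a\<close> entering it.\<close>
  define t where "t i h k y = (if i = 0 then 0 else if i = 1 then point_chain h a k y
    else point_chain h a k y + point_chain (h \<otimes> inv (c a)) a k y)" for i :: nat and h k y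
  define s' where "s' i h k y = (if i \<le> length r then s i h k y
    else s (length r) h k y + t (i - length r) h k y)" for i h k y
  have "corner_sums G c (r @ [gen a, gen a]) ({a} \<union> I) ({} \<union> B) s'"
  proof (rule corner_sums_extend[OF s quadratic_word_letters[OF crosscap.hyps(1)], of _ _ _ _ t])
    show "interior_letter G c [gen a, gen a] t y" if "y \<in> {a}" for y
      unfolding interior_letter_def using that a by (intro exI[of _ 0] exI[of _ 1])
        (auto simp: occurrences_def edge_start_def edge_end_def t_def m_assoc less_numeral_cases)
  qed (use crosscap.hyps a in \<open>auto simp: s'_def t_def point_chain_def sol\<close>)
  then show ?case by auto
next
  case (handle r I B a b)
  then obtain s where s: "corner_sums G c r I B s" by auto
  have ab: "c a \<in> carrier G" "c b \<in> carrier G" using handle.prems by simp_all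
  have sol: "k \<otimes> c a = h \<longleftrightarrow> k = h \<otimes> inv (c a)" "k \<otimes> c b = h \<longleftrightarrow> k = h \<otimes> inv (c b)"
    if "h \<in> carrier G" "k \<in> carrier G" for h k
    using that ab by (metis inv_solve_right')+
  let ?v = "[gen a, gen b, gen_inv a, gen_inv b]"
  \<comment> \<open>For a handle the corners are met in the order 0, 3, 2, 1, 4. The edges between
    them are \<open>a\<close> leaving, \<open>b\<close> entering, \<open>a\<close> entering and
    \<open>b\<close> leaving.\<close>
  define t where "t i h k y = (if i = 0 then 0
    else if i = 1 then point_chain h a k y + point_chain (h \<otimes> inv (c b)) b k y + point_chain (h \<otimes> inv (c a)) a k y
    else if i = 2 then point_chain h a k y + point_chain (h \<otimes> inv (c b)) b k y
    else if i = 3 then point_chain h a k y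
    else point_chain h a k y + point_chain (h \<otimes> inv (c b)) b k y + point_chain (h \<otimes> inv (c a)) a k y + point_chain h b k y)"
    for i :: nat and h k y
  define s' where "s' i h k y = (if i \<le> length r then s i h k y
    else s (length r) h k y + t (i - length r) h k y)" for i h k y
  have c1: "p + q + z + (p + q) = z" "p + q + p = q" "p + (p + q) = q" "p + q + z + (p + q + z + w) = w"
    for p q z w :: bit by (cases p; cases q; cases z; cases w; simp)+
  have "corner_sums G c (r @ ?v) ({a, b} \<union> I) ({} \<union> B) s'"
  proof (rule corner_sums_extend[OF s quadratic_word_letters[OF handle.hyps(1)], of _ _ _ _ t])
    show "interior_letter G c ?v t y" if "y \<in> {a, b}" for y
    proof (cases "y = a")
      case True
      have "occurrences ?v a = {0, 2}" using handle.hyps(4)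
        by (auto simp: occurrences_def less_numeral_cases)
      moreover have "edge_start ?v 0 = 0" "edge_start ?v 2 = 3" "edge_end ?v 0 = 1" "edge_end ?v 2 = 2"
        by (auto simp: edge_start_def edge_end_def)
      ultimately show ?thesis using True ab unfolding interior_letter_def
        by (intro exI[of _ 0] exI[of _ 2]) (simp add: t_def m_assoc c1)
    next
      case False
      then have "y = b" using that by simp
      have "occurrences ?v b = {1, 3}" using handle.hyps(4)
        by (auto simp: occurrences_def less_numeral_cases)
      moreover have "edge_start ?v 1 = 1" "edge_start ?v 3 = 4" "edge_end ?v 1 = 2" "edge_end ?v 3 = 3"
        by (auto simp: edge_start_def edge_end_def)
      ultimately show ?thesis using \<open>y = b\<close> ab unfolding interior_letter_def
        by (intro exI[of _ 1] exI[of _ 3]) (simp add: t_def m_assoc c1)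
    qed
  qed (use handle.hyps ab in \<open>auto simp: m_assoc s'_def t_def point_chain_def sol\<close>)
  then show ?case by auto
qed

section \<open>The Cayley complex of a quadratic presentation and its dual paths\<close>

locale quadratic_presentation =
  fixes r :: "'x word" and I B :: "'x set"
  assumes quadratic: "quadratic_word r I B"
begin

abbreviation "X \<equiv> I \<union> B"
abbreviation "H \<equiv> presented_group X {r}"
abbreviation "cls \<equiv> word_class X {r}"
abbreviation "c x \<equiv> cls [gen x]"
abbreviation mult_H (infixl "\<cdot>" 70) where "x \<cdot> y \<equiv> x \<otimes>\<^bsub>H\<^esub> y"

sublocale H: group H by (rule group_presented_group)

lemma cls_closed: "w \<in> words X \<Longrightarrow> cls w \<in> carrier H"
  by (simp add: presented_group_def)

lemma cls_append: "u \<in> words X \<Longrightarrow> v \<in> words X \<Longrightarrow> cls (u @ v) = cls u \<cdot> cls v"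
  by (simp add: presented_group_mult)

lemma cls_Nil: "cls [] = \<one>\<^bsub>H\<^esub>"
  by (simp add: presented_group_def)

lemma letter_word: "x \<in> X \<Longrightarrow> [(x, \<sigma>)] \<in> words X"
  by (simp add: words_def)

lemma c_closed: "x \<in> X \<Longrightarrow> c x \<in> carrier H"
  by (intro cls_closed letter_word)

lemma cls_inv: "x \<in> X \<Longrightarrow> cls [gen_inv x] = inv\<^bsub>H\<^esub> c x"
  using word_class_inverse[of x X "{r}" True] by simp

lemma carrier_cls: "h \<in> carrier H \<Longrightarrow> \<exists>w\<in>words X. h = cls w"
  by (auto simp: presented_group_def)

lemma r_letters: "i < length r \<Longrightarrow> fst (r ! i) \<in> X"
  using quadratic_word_letters[OF quadratic] by (metis image_eqI nth_mem)

lemma r_words: "r \<in> words X"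
proof -
  have "set r \<subseteq> X \<times> UNIV" using quadratic_word_letters[OF quadratic] by force
  then show ?thesis by (auto simp: words_def lists_eq_set)
qed

lemma cls_r: "cls r = \<one>\<^bsub>H\<^esub>"
proof -
  have "word_eq X {r} ([] @ r @ []) ([] @ [])" by (rule word_eq.relator) (use r_words in auto)
  then show ?thesis using word_class_eq_iff[OF r_words, of "{r}" "[]"] by (simp add: cls_Nil)
qed

lemma finite_X: "finite X"
  using quadratic_word_finite[OF quadratic] by simp

definition s where "s = (SOME s. corner_sums H c r I B s)"

lemma corner_sums_s: "corner_sums H c r I B s"
proof -
  have "\<exists>s. corner_sums H c r I B s"
    by (rule H.corner_sums_exist[OF quadratic]) (rule c_closed)
  then show ?thesis unfolding s_def by (rule someI_ex)
qed

lemma s_0: "s 0 h k y = 0"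
  using corner_sums_s by (simp add: corner_sums_def)

lemma s_length: "h \<in> carrier H \<Longrightarrow> k \<in> carrier H \<Longrightarrow> y \<in> X \<Longrightarrow>
    s (length r) h k y = of_bool (k = h) + of_bool (k \<cdot> c y = h)"
  using corner_sums_s by (simp add: corner_sums_def)

lemma interior_occurrences:
  assumes "x \<in> I"
  obtains i j where "i \<noteq> j" "occurrences r x = {i, j}"
    "\<And>h k y. h \<in> carrier H \<Longrightarrow> s (edge_start r i) h k y + s (edge_start r j) h k y = point_chain h x k y"
    "\<And>h k y. h \<in> carrier H \<Longrightarrow> s (edge_end r i) (h \<cdot> c x) k y + s (edge_end r j) (h \<cdot> c x) k y = point_chain h x k y"
proof -
  have "interior_letter H c r s x" using corner_sums_s assms by (simp add: corner_sums_def)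
  then show ?thesis using that unfolding interior_letter_def by blast
qed

lemma boundary_occurrence:
  assumes "x \<in> B"
  obtains i where "snd (r ! i)" "occurrences r x = {i}"
    "\<And>h k y. h \<in> carrier H \<Longrightarrow> s (edge_start r i) h k y + s (edge_end r i) h k y =
       point_chain h x k y + point_chain (h \<cdot> inv\<^bsub>H\<^esub> (c x)) x k y"
proof -
  have "boundary_letter H c r s x" using corner_sums_s assms by (simp add: corner_sums_def)
  then show ?thesis using that unfolding boundary_letter_def by blast
qed

text \<open>
  \<open>path_chain w h\<close> is the chain of edges crossed by a path of faces and corners that follows the word \<open>w\<close>
  from the vertex \<open>h\<close>, keeping to the side of the face in which the letters first occur.
\<close>

definition side_chain :: "'x \<Rightarrow> 'x word set \<Rightarrow> 'x word set \<Rightarrow> 'x \<Rightarrow> bit" where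
  "side_chain x h k y = (let i = SOME i. i \<in> occurrences r x in
     s (edge_end r i) (h \<cdot> c x) k y + s (edge_start r i) h k y)"

definition letter_chain :: "'x \<times> bool \<Rightarrow> 'x word set \<Rightarrow> 'x word set \<Rightarrow> 'x \<Rightarrow> bit" where
  "letter_chain l h = side_chain (fst l) (if snd l then h else h \<cdot> cls [l])"

fun path_chain :: "'x word \<Rightarrow> 'x word set \<Rightarrow> 'x word set \<Rightarrow> 'x \<Rightarrow> bit" where
  "path_chain [] h k y = 0"
| "path_chain (l # w) h k y = letter_chain l h k y + path_chain w (h \<cdot> cls [l]) k y"

text \<open>Using the face on the other side of the edge alters the corner sum at either end by that
  same edge, and the two alterations cancel. So the choice in \<open>side_chain\<close> is
  immaterial.\<close>

lemma side_chain_eq: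
  assumes i: "i \<in> occurrences r x" and h: "h \<in> carrier H"
  shows "side_chain x h k y = s (edge_end r i) (h \<cdot> c x) k y + s (edge_start r i) h k y"
proof -
  define j where "j = (SOME i. i \<in> occurrences r x)"
  have j: "j \<in> occurrences r x" unfolding j_def by (rule someI) (rule i)
  have x: "x \<in> X" using i r_letters by (auto simp: occurrences_def)
  have swap: "a + b = e \<Longrightarrow> d + f = e \<Longrightarrow> d + a = f + b" "b + a = e \<Longrightarrow> f + d = e \<Longrightarrow> d + a = f + b" for a b d e f :: bit
    by (cases a; cases b; cases d; cases f; simp)+
  have "s (edge_end r j) (h \<cdot> c x) k y + s (edge_start r j) h k y =
     s (edge_end r i) (h \<cdot> c x) k y + s (edge_start r i) h k y"
  proof (cases "x \<in> I")
    case True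
    then obtain p q where pq: "p \<noteq> q" "occurrences r x = {p, q}"
      "\<And>h k y. h \<in> carrier H \<Longrightarrow> s (edge_start r p) h k y + s (edge_start r q) h k y = point_chain h x k y"
      "\<And>h k y. h \<in> carrier H \<Longrightarrow> s (edge_end r p) (h \<cdot> c x) k y + s (edge_end r q) (h \<cdot> c x) k y = point_chain h x k y"
      by (rule interior_occurrences) blast
    have "(i = p \<or> i = q) \<and> (j = p \<or> j = q)" using i j pq(2) by blast
    then show ?thesis using swap(1)[OF pq(3)[OF h] pq(4)[OF h]] by auto
  next
    case False
    then have "x \<in> B" using x by auto
    then obtain p where "occurrences r x = {p}" by (rule boundary_occurrence)
    then show ?thesis using i j by simp
  qed
  then show ?thesis unfolding side_chain_def Let_def j_def .
qed

text \<open>While the path stays inside one face it crosses nothing, so only the turns at the two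
  ends of the letter remain. For an inverse letter the ends trade places.\<close>

lemma letter_chain_index:
  assumes i: "i < length r" and h: "h \<in> carrier H"
  shows "letter_chain (r ! i) h k y = s (Suc i) (h \<cdot> cls [r ! i]) k y + s i h k y"
proof -
  obtain x \<sigma> where l: "r ! i = (x, \<sigma>)" by (cases "r ! i")
  have x: "x \<in> X" "i \<in> occurrences r x" using r_letters[OF i] l i by (auto simp: occurrences_def)
  show ?thesis
  proof (cases \<sigma>)
    case True
    then show ?thesis using side_chain_eq[OF x(2) h]
      by (simp add: letter_chain_def l edge_start_def edge_end_def)
  next
    case False
    then have "h \<cdot> cls [r ! i] \<in> carrier H" "h \<cdot> cls [r ! i] \<cdot> c x = h"
      using l h x c_closed by (simp_all add: cls_inv H.m_assoc)
    then show ?thesis using side_chain_eq[OF x(2), of "h \<cdot> cls [r ! i]"] False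
      by (simp add: letter_chain_def l edge_start_def edge_end_def add.commute)
  qed
qed

lemma cls_Cons: "l # w \<in> words X \<Longrightarrow> cls (l # w) = cls [l] \<cdot> cls w"
  using cls_append[of "[l]" w] by (simp add: words_Cons_iff)

lemma path_chain_append:
  assumes "u \<in> words X" "v \<in> words X" "h \<in> carrier H"
  shows "path_chain (u @ v) h k y = path_chain u h k y + path_chain v (h \<cdot> cls u) k y"
  using assms
proof (induction u arbitrary: h)
  case Nil then show ?case by (simp add: cls_Nil)
next
  case (Cons l u)
  then have lu: "[l] \<in> words X" "u \<in> words X" by (auto simp: words_Cons_iff)
  have h: "h \<cdot> cls [l] \<in> carrier H" using Cons.prems cls_closed[OF lu(1)] by simp
  show ?case using Cons.IH[OF lu(2) Cons.prems(2) h] Cons.prems cls_closed[OF lu(1)] cls_closed[OF lu(2)]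
    by (simp add: cls_Cons H.m_assoc add.assoc)
qed

abbreviation "offset i \<equiv> cls (take i r)"

lemma take_words: "take i r \<in> words X"
proof -
  have "take i r @ drop i r \<in> words X" using r_words by simp
  then show ?thesis by (simp only: words_append)
qed

lemma offset_closed: "offset i \<in> carrier H"
  using take_words by (rule cls_closed)

lemma offset_Suc: "i < length r \<Longrightarrow> offset (Suc i) = offset i \<cdot> cls [r ! i]"
  using cls_append[of "take i r" "[r ! i]"] take_words[of i] take_words[of "Suc i"]
  by (simp add: take_Suc_conv_app_nth)

text \<open>Along the boundary of one face the corner sums telescope. The term at the start vanishes
  because corner 0 is the reference corner at every vertex.\<close>

lemma path_chain_prefix:
  assumes "i \<le> length r" "h \<in> carrier H"
  shows "path_chain (take i r) h k y = s i (h \<cdot> offset i) k y"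
  using assms(1)
proof (induction i)
  case 0 then show ?case by (simp add: s_0)
next
  case (Suc i)
  then have i: "i < length r" by simp
  have w: "[r ! i] \<in> words X" "take i r \<in> words X"
    using take_words[of "Suc i"] take_words[of i] i by (simp_all add: take_Suc_conv_app_nth)
  have "path_chain (take (Suc i) r) h k y =
    path_chain (take i r) h k y + letter_chain (r ! i) (h \<cdot> offset i) k y"
    using path_chain_append[OF w(2,1) assms(2)] i by (simp add: take_Suc_conv_app_nth)
  also have "\<dots> = s i (h \<cdot> offset i) k y +
      (s (Suc i) (h \<cdot> offset (Suc i)) k y + s i (h \<cdot> offset i) k y)"
    using letter_chain_index[OF i, of "h \<cdot> offset i"] Suc assms(2) offset_closed[of i] cls_closed[OF w(1)] i
    by (simp add: offset_Suc H.m_assoc)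
  finally show ?case by (simp add: add_ac)
qed

text \<open>
  Going once around a face amounts to a full turn around a vertex, the coboundary of that vertex. So modulo
  coboundaries of finite sets the chain of a path depends only on its end points.
\<close>

definition null_chain :: "('x word set \<Rightarrow> 'x \<Rightarrow> bit) \<Rightarrow> bool" where
  "null_chain e \<longleftrightarrow> (\<exists>b. finite {h \<in> carrier H. b h \<noteq> 0} \<and>
     (\<forall>k\<in>carrier H. \<forall>y\<in>X. e k y = b k + b (k \<cdot> c y)))"

lemma null_chain_cong:
  assumes "null_chain e" "\<And>k y. k \<in> carrier H \<Longrightarrow> y \<in> X \<Longrightarrow> e k y = e' k y"
  shows "null_chain e'"
proof -
  from assms(1) obtain b where "finite {h \<in> carrier H. b h \<noteq> 0}"
    "\<And>k y. k \<in> carrier H \<Longrightarrow> y \<in> X \<Longrightarrow> e k y = b k + b (k \<cdot> c y)"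
    unfolding null_chain_def by blast
  then show ?thesis unfolding null_chain_def using assms(2) by (intro exI[of _ b]) simp
qed

lemma null_chain_zero: "null_chain (\<lambda>k y. 0)"
  unfolding null_chain_def by (rule exI[of _ "\<lambda>h. 0"]) simp

lemma null_chain_add:
  assumes "null_chain e" "null_chain e'"
  shows "null_chain (\<lambda>k y. e k y + e' k y)"
proof -
  from assms(1) obtain b where b1: "finite {h \<in> carrier H. b h \<noteq> 0}"
    "\<And>k y. k \<in> carrier H \<Longrightarrow> y \<in> X \<Longrightarrow> e k y = b k + b (k \<cdot> c y)"
    unfolding null_chain_def by blast
  from assms(2) obtain b' where b2: "finite {h \<in> carrier H. b' h \<noteq> 0}"
    "\<And>k y. k \<in> carrier H \<Longrightarrow> y \<in> X \<Longrightarrow> e' k y = b' k + b' (k \<cdot> c y)"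
    unfolding null_chain_def by blast
  have "finite {h \<in> carrier H. b h + b' h \<noteq> 0}"
    by (rule finite_subset[OF _ finite_UnI[OF b1(1) b2(1)]]) auto
  then show ?thesis unfolding null_chain_def using b1(2) b2(2)
    by (intro exI[of _ "\<lambda>h. b h + b' h"]) (simp add: add_ac)
qed

lemma null_chain_sum:
  assumes "\<And>i. i \<in> S \<Longrightarrow> null_chain (e i)"
  shows "null_chain (\<lambda>k y. \<Sum>i\<in>S. e i k y)"
  using assms
proof (induction S rule: infinite_finite_induct)
  case (insert i S)
  then have "null_chain (\<lambda>k y. e i k y + (\<Sum>i\<in>S. e i k y))" by (intro null_chain_add) auto
  then show ?case using insert by simp
qed (simp_all add: null_chain_zero)

lemma null_chain_star:
  assumes "h \<in> carrier H"
  shows "null_chain (s (length r) h)"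
  unfolding null_chain_def using assms
  by (intro exI[of _ "\<lambda>k. of_bool (k = h)"]) (auto simp: s_length)

lemma path_chain_word_eq:
  assumes "word_eq X {r} u v" "h \<in> carrier H"
  shows "null_chain (\<lambda>k y. path_chain u h k y + path_chain v h k y)"
  using assms
proof (induction arbitrary: h rule: word_eq.induct)
  case (refl w) then show ?case by (simp add: null_chain_zero)
next
  case (sym u w) then show ?case by (simp add: add.commute)
next
  case (trans u v w)
  then have "null_chain (\<lambda>k y. path_chain u h k y + path_chain v h k y + (path_chain v h k y + path_chain w h k y))"
    using null_chain_add[OF trans.IH(1)[OF trans.prems] trans.IH(2)[OF trans.prems]] by simp
  then show ?case by (rule null_chain_cong) (simp add: add_ac)
next
  case (cancel u w x \<sigma>)
  let ?h = "h \<cdot> cls u"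
  have h: "?h \<in> carrier H" using cancel cls_closed by simp
  have w: "[(x, \<tau>)] \<in> words X" "[(x, \<sigma>), (x, \<not> \<sigma>)] \<in> words X" for \<tau> using cancel by (auto simp: words_def)
  have cc: "cls [(x, \<sigma>)] \<in> carrier H" "c x \<in> carrier H"
    "cls [(x, \<not> \<sigma>)] = inv\<^bsub>H\<^esub> cls [(x, \<sigma>)]"
    using w(1) cls_closed word_class_inverse[OF cancel(3)] by simp_all
  \<comment> \<open>The second letter runs back along the edge of the first, so both contribute the
    same \<open>side_chain\<close>.\<close>
  have z: "?h \<cdot> cls [(x, \<sigma>)] \<cdot> cls [(x, \<not> \<sigma>)] = ?h"
    unfolding cc(3) using h cc(1) by (simp add: H.m_assoc)
  have "letter_chain (x, \<sigma>) ?h k y + letter_chain (x, \<not> \<sigma>) (?h \<cdot> cls [(x, \<sigma>)]) k y = 0" for k y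
    unfolding letter_chain_def using z by (cases \<sigma>) auto
  then have "path_chain (u @ [(x, \<sigma>), (x, \<not> \<sigma>)] @ w) h k y = path_chain (u @ w) h k y" for k y
    using cancel w h z path_chain_append[of u "[(x, \<sigma>), (x, \<not> \<sigma>)] @ w"] path_chain_append[of u w]
    by (simp flip: add.assoc add: words_Cons_iff)
  then show ?case by (simp add: null_chain_zero)
next
  case (relator u w q)
  then have q: "q = r" by simp
  let ?h = "h \<cdot> cls u"
  have h: "?h \<in> carrier H" using relator cls_closed by simp
  have pr: "path_chain r ?h k y = s (length r) ?h k y" for k y
    using path_chain_prefix[of "length r" ?h] h by (simp add: cls_r)
  have "path_chain (u @ q @ w) h k y + path_chain (u @ w) h k y = s (length r) ?h k y" for k y
    using relator h r_words path_chain_append[of u "r @ w" h] path_chain_append[of u w h]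
      path_chain_append[of r w ?h]
    by (simp add: q pr cls_r add_ac)
  then show ?case using null_chain_star[OF h] by simp
qed

text \<open>The edges crossed on some way from the face based at the identity to the face based at
  \<open>h\<close>. Another word for \<open>h\<close> changes the chain by a null chain
  only.\<close>

definition face_chain :: "'x word set \<Rightarrow> 'x word set \<Rightarrow> 'x \<Rightarrow> bit" where
  "face_chain h = path_chain (SOME w. w \<in> words X \<and> cls w = h) \<one>\<^bsub>H\<^esub>"

lemma face_chain_step:
  assumes "h \<in> carrier H" "u \<in> words X"
  shows "null_chain (\<lambda>k y. face_chain h k y + face_chain (h \<cdot> cls u) k y + path_chain u h k y)"
proof -
  define wd where "wd h = (SOME w. w \<in> words X \<and> cls w = h)" for h
  have wd: "wd h \<in> words X \<and> cls (wd h) = h" if "h \<in> carrier H" for h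
  proof -
    have "\<exists>w. w \<in> words X \<and> cls w = h" using carrier_cls[OF that] by blast
    then show ?thesis unfolding wd_def by (rule someI_ex)
  qed
  have hu: "h \<cdot> cls u \<in> carrier H" using assms cls_closed by simp
  have "cls (wd h @ u) = cls (wd (h \<cdot> cls u))"
    using wd[OF assms(1)] wd[OF hu] assms(2) by (simp add: cls_append)
  then have "word_eq X {r} (wd h @ u) (wd (h \<cdot> cls u))"
    using word_class_eq_iff[of "wd h @ u" X "{r}"] wd[OF assms(1)] assms(2) by simp
  then have "null_chain (\<lambda>k y. path_chain (wd h @ u) \<one>\<^bsub>H\<^esub> k y + path_chain (wd (h \<cdot> cls u)) \<one>\<^bsub>H\<^esub> k y)"
    by (rule path_chain_word_eq) simp
  then show ?thesis
    using wd[OF assms(1)] assms path_chain_append[of "wd h" u "\<one>\<^bsub>H\<^esub>"]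
    by (simp add: face_chain_def wd_def[symmetric] add_ac)
qed

text \<open>The face based at \<open>h \<cdot> inv (offset i)\<close> has its corner
  \<open>i\<close> at \<open>h\<close>. It is therefore also reached by going to the face based at
  \<open>h\<close> and turning around \<open>h\<close> from corner 0 to corner
  \<open>i\<close>.\<close>

lemma face_chain_corner:
  assumes "i \<le> length r" "h \<in> carrier H"
  shows "null_chain (\<lambda>k y. face_chain (h \<cdot> inv\<^bsub>H\<^esub> offset i) k y + face_chain h k y + s i h k y)"
proof -
  let ?f = "h \<cdot> inv\<^bsub>H\<^esub> offset i"
  have f: "?f \<in> carrier H" "?f \<cdot> offset i = h" using assms(2) offset_closed by (simp_all add: H.m_assoc)
  show ?thesis
    using face_chain_step[OF f(1) take_words[of i]] path_chain_prefix[OF assms(1) f(1)] f(2) by simp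
qed

end

section \<open>Counting the coboundary of an almost invariant function over the faces\<close>

lemma sum_bit_telescope_nat: "(\<Sum>i<n. a i + a (Suc i)) = a 0 + (a n :: bit)"
  by (induction n) (auto simp: add_ac)

context quadratic_presentation
begin

lemma sum_occurrences: "(\<Sum>x\<in>X. \<Sum>i\<in>occurrences r x. g i) = (\<Sum>i<length r. g i)"
proof -
  have "occurrences r x = {i \<in> {..<length r}. fst (r ! i) = x}" for x
    by (auto simp: occurrences_def)
  then show ?thesis
    using sum.group[of "{..<length r}" X "\<lambda>i. fst (r ! i)" g] finite_X r_letters by (auto simp: image_subset_iff)
qed

definition changes :: "('x word set \<Rightarrow> bit) \<Rightarrow> 'x \<Rightarrow> 'x word set set" where
  "changes A x = {h \<in> carrier H. A (h \<cdot> c x) \<noteq> A h}"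

lemma finite_changes: "almost_invariant H A \<Longrightarrow> x \<in> X \<Longrightarrow> finite (changes A x)"
  using c_closed by (simp add: almost_invariant_def changes_def)

text \<open>This double count vanishes because every face meets the coboundary of \<open>A\<close> in an even number of edges.\<close>

lemma sum_over_faces:
  assumes A: "almost_invariant H A"
  shows "(\<Sum>x\<in>X. \<Sum>i\<in>occurrences r x. \<Sum>h\<in>changes A x.
    W (h \<cdot> inv\<^bsub>H\<^esub> offset (edge_start r i))) = (0::bit)"
proof -
  define v where "v i = offset (edge_start r i)" for i
  define xi where "xi i = fst (r ! i)" for i
  \<comment> \<open>The face whose position \<open>i\<close> runs along the edge from
    \<open>h\<close> is based at \<open>h \<cdot> inv (v i)\<close>. So \<open>im i\<close> consists
    of the faces whose side \<open>i\<close> lies in the coboundary of \<open>A\<close>.\<close>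
  define im where "im i = (\<lambda>h. h \<cdot> inv\<^bsub>H\<^esub> v i) ` changes A (xi i)" for i
  define F where "F = (\<Union>i<length r. im i)"
  have v: "v i \<in> carrier H" for i using offset_closed by (simp add: v_def)
  have F: "finite F" "F \<subseteq> carrier H"
    unfolding F_def im_def using finite_changes[OF A] r_letters v
    by (auto simp: xi_def changes_def)
  have im_iff: "f \<in> im i \<longleftrightarrow> A (f \<cdot> offset i) \<noteq> A (f \<cdot> offset (Suc i))"
    if i: "i < length r" and f: "f \<in> carrier H" for f i
  proof -
    obtain x \<sigma> where l: "r ! i = (x, \<sigma>)" by (cases "r ! i")
    have x: "c x \<in> carrier H" "cls [gen_inv x] = inv\<^bsub>H\<^esub> c x"
      using r_letters[OF i] l c_closed cls_inv by auto
    have "f \<in> im i \<longleftrightarrow> f \<cdot> v i \<in> changes A x"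
    proof
      assume "f \<in> im i"
      then obtain h where h: "h \<in> changes A x" "f = h \<cdot> inv\<^bsub>H\<^esub> v i" by (auto simp: im_def xi_def l)
      then have "h \<in> carrier H" by (simp add: changes_def)
      then have "f \<cdot> v i = h" using h v by (simp add: H.m_assoc)
      then show "f \<cdot> v i \<in> changes A x" using h by simp
    next
      assume a: "f \<cdot> v i \<in> changes A x"
      have "f = f \<cdot> v i \<cdot> inv\<^bsub>H\<^esub> v i" using f v by (simp add: H.m_assoc)
      then show "f \<in> im i" unfolding im_def using a by (auto simp: xi_def l)
    qed
    also have "\<dots> \<longleftrightarrow> A (f \<cdot> v i \<cdot> c x) \<noteq> A (f \<cdot> v i)"
      using f v by (simp add: changes_def)
    also have "\<dots> \<longleftrightarrow> A (f \<cdot> offset i) \<noteq> A (f \<cdot> offset (Suc i))"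
    proof (cases \<sigma>)
      case True
      then show ?thesis using f x offset_closed[of i] offset_Suc[OF i]
        by (auto simp: v_def edge_start_def l H.m_assoc)
    next
      case False
      then have "offset (Suc i) = offset i \<cdot> inv\<^bsub>H\<^esub> c x" using offset_Suc[OF i] l x by simp
      then show ?thesis using False f x offset_closed[of i]
        by (simp add: v_def edge_start_def l H.m_assoc)
    qed
    finally show ?thesis .
  qed
  have inner: "(\<Sum>h\<in>changes A (xi i). W (h \<cdot> inv\<^bsub>H\<^esub> v i)) =
      (\<Sum>f\<in>F. (A (f \<cdot> offset i) + A (f \<cdot> offset (Suc i))) * W f)" if i: "i < length r" for i
  proof -
    have "inj_on (\<lambda>h. h \<cdot> inv\<^bsub>H\<^esub> v i) (changes A (xi i))"
      using v by (auto simp: inj_on_def changes_def)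
    then have "(\<Sum>h\<in>changes A (xi i). W (h \<cdot> inv\<^bsub>H\<^esub> v i)) = sum W (im i)"
      unfolding im_def by (simp add: sum.reindex)
    also have "\<dots> = (\<Sum>f\<in>F. (A (f \<cdot> offset i) + A (f \<cdot> offset (Suc i))) * W f)"
    proof (rule sum.mono_neutral_cong_left[OF F(1)])
      show "im i \<subseteq> F" using i by (auto simp: F_def)
      show "\<forall>f\<in>F - im i. (A (f \<cdot> offset i) + A (f \<cdot> offset (Suc i))) * W f = 0"
        using im_iff[OF i] F(2) by auto
      show "W f = (A (f \<cdot> offset i) + A (f \<cdot> offset (Suc i))) * W f" if "f \<in> im i" for f
      proof -
        have "f \<in> carrier H" using that i F(2) by (auto simp: F_def)
        then have "A (f \<cdot> offset i) + A (f \<cdot> offset (Suc i)) = 1"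
          using im_iff[OF i] that bit_add_eq_1_iff by blast
        then show ?thesis by simp
      qed
    qed
    finally show ?thesis .
  qed
  have "(\<Sum>x\<in>X. \<Sum>i\<in>occurrences r x. \<Sum>h\<in>changes A x. W (h \<cdot> inv\<^bsub>H\<^esub> v i)) =
    (\<Sum>x\<in>X. \<Sum>i\<in>occurrences r x. \<Sum>h\<in>changes A (xi i). W (h \<cdot> inv\<^bsub>H\<^esub> v i))"
    by (intro sum.cong HOL.refl) (simp add: occurrences_def xi_def)
  also have "\<dots> = (\<Sum>i<length r. \<Sum>h\<in>changes A (xi i). W (h \<cdot> inv\<^bsub>H\<^esub> v i))"
    by (rule sum_occurrences)
  also have "\<dots> = (\<Sum>i<length r. \<Sum>f\<in>F. (A (f \<cdot> offset i) + A (f \<cdot> offset (Suc i))) * W f)"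
    by (intro sum.cong HOL.refl inner) simp
  also have "\<dots> = (\<Sum>f\<in>F. (\<Sum>i<length r. A (f \<cdot> offset i) + A (f \<cdot> offset (Suc i))) * W f)"
    by (subst sum.swap) (simp add: sum_distrib_right)
  \<comment> \<open>Once around the face based at \<open>f\<close> the values of \<open>A\<close>
    telescope to \<open>A f + A f\<close>, because the full relator is trivial.\<close>
  also have "\<dots> = (\<Sum>f\<in>F. 0)"
  proof (intro sum.cong HOL.refl)
    fix f assume "f \<in> F"
    then have "f \<in> carrier H" using F by auto
    then show "(\<Sum>i<length r. A (f \<cdot> offset i) + A (f \<cdot> offset (Suc i))) * W f = 0"
      using sum_bit_telescope_nat[of "\<lambda>i. A (f \<cdot> offset i)" "length r"]
      by (simp add: cls_r cls_Nil)
  qed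
  finally show ?thesis by (simp add: v_def)
qed

lemma interior_boundary_disjoint: "I \<inter> B = {}" "finite I" "finite B"
  using quadratic_word_disjoint[OF quadratic] quadratic_word_finite[OF quadratic] by auto

text \<open>With constant weight, an edge with an interior label is counted for both of its faces
  and drops out, whereas a boundary edge is counted once.\<close>

lemma even_boundary_changes:
  assumes A: "almost_invariant H A"
  shows "(\<Sum>x\<in>B. \<Sum>h\<in>changes A x. (1::bit)) = 0"
proof -
  have "0 = (\<Sum>x\<in>X. \<Sum>i\<in>occurrences r x. \<Sum>h\<in>changes A x. (1::bit))"
    using sum_over_faces[OF A, of "\<lambda>_. 1"] by simp
  also have "\<dots> = (\<Sum>x\<in>I. \<Sum>i\<in>occurrences r x. \<Sum>h\<in>changes A x. 1) + (\<Sum>x\<in>B. \<Sum>i\<in>occurrences r x. \<Sum>h\<in>changes A x. 1)"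
    using interior_boundary_disjoint by (simp add: sum.union_disjoint)
  also have "(\<Sum>x\<in>I. \<Sum>i\<in>occurrences r x. \<Sum>h\<in>changes A x. 1) = (\<Sum>x\<in>I. (0::bit))"
  proof (intro sum.cong HOL.refl)
    fix x assume "x \<in> I"
    then obtain i j where "i \<noteq> j" "occurrences r x = {i, j}" by (rule interior_occurrences) blast
    then show "(\<Sum>i\<in>occurrences r x. \<Sum>h\<in>changes A x. (1::bit)) = 0" by (simp del: sum_constant)
  qed
  also have "(\<Sum>x\<in>B. \<Sum>i\<in>occurrences r x. \<Sum>h\<in>changes A x. 1) = (\<Sum>x\<in>B. \<Sum>h\<in>changes A x. (1::bit))"
  proof (intro sum.cong HOL.refl)
    fix x assume "x \<in> B"
    then obtain i where "occurrences r x = {i}" by (rule boundary_occurrence) blast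
    then show "(\<Sum>i\<in>occurrences r x. \<Sum>h\<in>changes A x. (1::bit)) = (\<Sum>h\<in>changes A x. 1)"
      by (simp del: sum_constant)
  qed
  finally show ?thesis by simp
qed

text \<open>A crossing line contributes an odd number of changes and a family of lines without
  crossing an even one, while the total over all boundary lines is even. So there cannot be exactly
  one crossing line.\<close>

theorem another_crossing_line:
  assumes A: "almost_invariant H A" and inf: "\<And>x. x \<in> B \<Longrightarrow> infinite_order H (c x)"
    and x0: "x0 \<in> B" "h0 \<in> carrier H" "crosses H A h0 (c x0)"
  shows "\<exists>x\<in>B. \<exists>h\<in>carrier H. crosses H A h (c x) \<and>
    (x = x0 \<longrightarrow> h \<notin> range (\<lambda>k::int. h0 \<cdot> c x0 [^]\<^bsub>H\<^esub> k))"
proof (rule ccontr)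
  assume no: "\<not> ?thesis"
  let ?l = "range (\<lambda>k::int. h0 \<cdot> c x0 [^]\<^bsub>H\<^esub> k)"
  \<comment> \<open>For \<open>x0\<close> the given line is taken out; by the assumption for
    contradiction no line of \<open>M x\<close> crosses.\<close>
  define M where "M x = (if x = x0 then carrier H - ?l else carrier H)" for x
  have cx: "c x \<in> carrier H" if "x \<in> B" for x using that c_closed by auto
  have lstep: "h \<cdot> c x0 \<in> ?l \<longleftrightarrow> h \<in> ?l" if h: "h \<in> carrier H" for h
  proof
    assume "h \<cdot> c x0 \<in> ?l"
    then obtain k :: int where "h \<cdot> c x0 = h0 \<cdot> c x0 [^]\<^bsub>H\<^esub> k" by auto
    then have "h \<cdot> c x0 \<cdot> inv\<^bsub>H\<^esub> c x0 = h0 \<cdot> c x0 [^]\<^bsub>H\<^esub> k \<cdot> inv\<^bsub>H\<^esub> c x0" by simp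
    then have "h = h0 \<cdot> c x0 [^]\<^bsub>H\<^esub> (k - 1)"
      using h cx x0 by (simp add: H.m_assoc H.int_pow_diff)
    then show "h \<in> ?l" by blast
  next
    assume "h \<in> ?l"
    then obtain k :: int where "h = h0 \<cdot> c x0 [^]\<^bsub>H\<^esub> k" by auto
    then have "h \<cdot> c x0 = h0 \<cdot> c x0 [^]\<^bsub>H\<^esub> (k + 1)" using cx x0 H.line_step by simp
    then show "h \<cdot> c x0 \<in> ?l" by blast
  qed
  have even: "(\<Sum>h | h \<in> M x \<and> A (h \<cdot> c x) \<noteq> A h. (1::bit)) = 0" if x: "x \<in> B" for x
  proof -
    have "\<exists>P. finite P \<and> P \<subseteq> M x \<and> (\<forall>W::_ \<Rightarrow> bit.
        (\<Sum>h | h \<in> M x \<and> A (h \<cdot> c x) \<noteq> A h. W h) = (\<Sum>h\<in>P. W h + W (h \<cdot> inv\<^bsub>H\<^esub> c x)))"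
    proof (rule H.sum_noncrossing[OF A inf[OF x]])
      show "M x \<subseteq> carrier H" by (auto simp: M_def)
      show "h \<cdot> c x \<in> M x" if "h \<in> M x" for h
        using that lstep[of h] cx[OF x] by (auto simp: M_def split: if_splits)
      show "h \<cdot> inv\<^bsub>H\<^esub> c x \<in> M x" if "h \<in> M x" for h
        using that lstep[of "h \<cdot> inv\<^bsub>H\<^esub> c x"] cx[OF x]
        by (auto simp: M_def H.m_assoc split: if_splits)
      show "\<not> crosses H A h (c x)" if "h \<in> M x" for h
        using that no x by (auto simp: M_def split: if_splits)
    qed
    then obtain P where "\<forall>W::_ \<Rightarrow> bit.
        (\<Sum>h | h \<in> M x \<and> A (h \<cdot> c x) \<noteq> A h. W h) = (\<Sum>h\<in>P. W h + W (h \<cdot> inv\<^bsub>H\<^esub> c x))"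
      by blast
    from this[rule_format, of "\<lambda>_. 1"] show ?thesis by (simp del: sum_constant)
  qed
  have other: "(\<Sum>h\<in>changes A x. (1::bit)) = 0" if "x \<in> B" "x \<noteq> x0" for x
    using even[OF that(1)] that(2) by (simp add: M_def changes_def del: sum_constant)
  have ch: "changes A x0 = {h. h \<in> M x0 \<and> A (h \<cdot> c x0) \<noteq> A h} \<union>
      {h. h \<in> ?l \<and> A (h \<cdot> c x0) \<noteq> A h}"
    using x0 cx by (auto simp: changes_def M_def)
  have fin: "finite (changes A x0)" using finite_changes[OF A] x0 by auto
  have "(\<Sum>h\<in>changes A x0. (1::bit)) = (\<Sum>h | h \<in> M x0 \<and> A (h \<cdot> c x0) \<noteq> A h. 1) +
      (\<Sum>h | h \<in> ?l \<and> A (h \<cdot> c x0) \<noteq> A h. 1)"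
    unfolding ch by (rule sum.union_disjoint) (use fin ch in \<open>auto simp: M_def\<close>)
  also have "\<dots> = 1"
    using even[OF x0(1)] H.sum_crossing_line[OF A inf[OF x0(1)] x0(2,3)] by simp
  finally have one: "(\<Sum>h\<in>changes A x0. (1::bit)) = 1" .
  have "(\<Sum>x\<in>B. \<Sum>h\<in>changes A x. (1::bit)) = (\<Sum>x\<in>B. if x = x0 then 1 else 0)"
    using other one by (intro sum.cong HOL.refl) (simp del: sum_constant)
  also have "\<dots> = 1" using x0 interior_boundary_disjoint by simp
  finally show False using even_boundary_changes[OF A] by simp
qed

section \<open>Duality: almost invariant functions without crossing boundary lines\<close>

lemma constant_if_invariant:
  assumes "\<And>h x. h \<in> carrier H \<Longrightarrow> x \<in> X \<Longrightarrow> f (h \<cdot> c x) = f h" "h \<in> carrier H"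
  shows "f h = f \<one>\<^bsub>H\<^esub>"
proof -
  have "f (\<one>\<^bsub>H\<^esub> \<cdot> h) = f \<one>\<^bsub>H\<^esub>"
  proof (rule H.invariant_generate)
    show "c ` X \<subseteq> carrier H" using c_closed by blast
    show "h \<in> generate H (c ` X)" using assms(2) by (simp only: generate_presented_group)
    fix g u assume g: "g \<in> carrier H" and "u \<in> c ` X"
    then obtain x where x: "x \<in> X" "u = c x" by (elim imageE)
    show "f (g \<cdot> u) = f g" unfolding x(2) by (rule assms(1)[OF g x(1)])
  qed simp
  then show ?thesis using assms(2) by simp
qed

text \<open>The ways out to the two faces beside the edge, together with the edge itself, form a
  dual loop. Both ways are compared with the way to the face based at \<open>h\<close>; the two
  turns left over differ by exactly this edge.\<close>

lemma null_chain_interior: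
  assumes "x \<in> I" "h \<in> carrier H"
  shows "null_chain (\<lambda>k y. (\<Sum>i\<in>occurrences r x. face_chain (h \<cdot> inv\<^bsub>H\<^esub> offset (edge_start r i)) k y)
    + point_chain h x k y)"
proof -
  obtain i j where ij: "i \<noteq> j" "occurrences r x = {i, j}"
    "\<And>h k y. h \<in> carrier H \<Longrightarrow> s (edge_start r i) h k y + s (edge_start r j) h k y = point_chain h x k y"
    using assms(1) by (rule interior_occurrences) blast
  have b: "edge_start r i \<le> length r" "edge_start r j \<le> length r"
    using ij(2) occurrences_less[of _ r x] by (auto intro!: edge_bounds)
  have comb: "p + q + t + (p' + q + t') = p + p' + u" if "t + t' = u" for p q t p' t' u :: bit
    using that by (cases q; cases t; cases t') (auto simp: add_ac)
  show ?thesis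
    by (rule null_chain_cong[OF null_chain_add[OF face_chain_corner[OF b(1) assms(2)] face_chain_corner[OF b(2) assms(2)]]])
      (simp add: ij(1,2) comb[OF ij(3)[OF assms(2)]])
qed

text \<open>A boundary edge has a face on one side only, so its dual edge cannot be closed up to a
  loop. The two consecutive boundary edges meeting at \<open>h\<close> can be closed up together,
  through the missing side at \<open>h\<close>.\<close>

lemma null_chain_boundary:
  assumes x: "x \<in> B" and h: "h \<in> carrier H" and i: "occurrences r x = {i}" 
  defines "q \<equiv> \<lambda>h k y. face_chain (h \<cdot> inv\<^bsub>H\<^esub> offset (edge_start r i)) k y + point_chain h x k y"
  shows "null_chain (\<lambda>k y. q h k y + q (h \<cdot> inv\<^bsub>H\<^esub> c x) k y)"
proof -
  obtain i' where i': "snd (r ! i')" "occurrences r x = {i'}"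
    "\<And>h k y. h \<in> carrier H \<Longrightarrow> s (edge_start r i') h k y + s (edge_end r i') h k y =
       point_chain h x k y + point_chain (h \<cdot> inv\<^bsub>H\<^esub> (c x)) x k y"
    using x by (rule boundary_occurrence) blast
  have "i' = i" using i i'(2) by simp
  note i' = i'[unfolded this]
  have il: "i < length r" and ri: "r ! i = gen x"
    using i'(1,2) by (auto simp: occurrences_def prod_eq_iff)
  have es: "edge_start r i = i" "edge_end r i = Suc i" using i'(1) by (simp_all add: edge_start_def edge_end_def)
  have cx: "c x \<in> carrier H" using x by (auto intro: c_closed)
  have o: "offset (Suc i) = offset i \<cdot> c x" using offset_Suc[OF il] ri by simp
  \<comment> \<open>The face along the edge entering \<open>h\<close> has its corner
    \<open>Suc i\<close> at \<open>h\<close>, while the face along the edge leaving \<open>h\<close>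
    has its corner \<open>i\<close> there.\<close>
  have shift: "h \<cdot> inv\<^bsub>H\<^esub> offset (Suc i) = h \<cdot> inv\<^bsub>H\<^esub> c x \<cdot> inv\<^bsub>H\<^esub> offset i"
    using h cx offset_closed[of i] by (simp add: o H.inv_mult_group H.m_assoc)
  have comb: "p + w + t + (p' + w + t') = p + u + (p' + u')" if "t + t' = u + u'" for p w t p' t' u u' :: bit
    using that by (cases p; cases p'; cases w; cases t; cases t'; cases u; cases u') auto
  have "null_chain (\<lambda>k y. face_chain (h \<cdot> inv\<^bsub>H\<^esub> offset i) k y + face_chain h k y + s i h k y +
      (face_chain (h \<cdot> inv\<^bsub>H\<^esub> offset (Suc i)) k y + face_chain h k y + s (Suc i) h k y))"
    by (intro null_chain_add face_chain_corner) (use il h in auto)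
  then show ?thesis
    unfolding q_def es shift by (rule null_chain_cong) (rule comb[OF i'(3)[OF h, unfolded es]])
qed

text \<open>Each edge of the coboundary is completed by the ways out to the faces beside it. The
  completed sum is null and the ways out cancel, so \<open>A\<close> has the same coboundary as some
  finitely supported \<open>b\<close>. Then \<open>A + b\<close> is constant because the Cayley
  graph is connected.\<close>

theorem almost_constant_if_no_crossing:
  assumes A: "almost_invariant H A" and inf: "\<And>x. x \<in> B \<Longrightarrow> infinite_order H (c x)"
    and nc: "\<And>x h. x \<in> B \<Longrightarrow> h \<in> carrier H \<Longrightarrow> \<not> crosses H A h (c x)"
  shows "\<exists>b. finite {h \<in> carrier H. A h \<noteq> b}"
proof -
  define T where "T x k y = (\<Sum>h\<in>changes A x. (\<Sum>i\<in>occurrences r x.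
    face_chain (h \<cdot> inv\<^bsub>H\<^esub> offset (edge_start r i)) k y) + point_chain h x k y)" for x k y
  have "null_chain (T x)" if x: "x \<in> X" for x
  proof (cases "x \<in> I")
    case True
    show ?thesis unfolding T_def
      by (intro null_chain_sum null_chain_interior[OF True]) (simp add: changes_def)
  next
    case False
    then have xB: "x \<in> B" using x by auto
    then obtain i where i: "occurrences r x = {i}" by (rule boundary_occurrence) blast
    define q where "q h k y = face_chain (h \<cdot> inv\<^bsub>H\<^esub> offset (edge_start r i)) k y + point_chain h x k y" for h k y
    \<comment> \<open>Each \<open>h\<close> in \<open>P\<close> stands for the pair of boundary
      edges leaving and entering \<open>h\<close>; the changes along \<open>x\<close> are the sum of
      these pairs, to which \<open>null_chain_boundary\<close> applies.\<close>
    have "\<exists>P. finite P \<and> P \<subseteq> carrier H \<and> (\<forall>W::_ \<Rightarrow> bit.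
        (\<Sum>h | h \<in> carrier H \<and> A (h \<cdot> c x) \<noteq> A h. W h) = (\<Sum>h\<in>P. W h + W (h \<cdot> inv\<^bsub>H\<^esub> c x)))"
      by (rule H.sum_noncrossing[OF A inf[OF xB]]) (use c_closed[OF x] nc[OF xB] in auto)
    then obtain P where P: "P \<subseteq> carrier H"
      "\<And>W::_ \<Rightarrow> bit. (\<Sum>h\<in>changes A x. W h) = (\<Sum>h\<in>P. W h + W (h \<cdot> inv\<^bsub>H\<^esub> c x))"
      unfolding changes_def by blast
    have "null_chain (\<lambda>k y. \<Sum>h\<in>P. q h k y + q (h \<cdot> inv\<^bsub>H\<^esub> c x) k y)"
      unfolding q_def by (intro null_chain_sum null_chain_boundary[OF xB _ i]) (use P in auto)
    then show ?thesis
      by (rule null_chain_cong) (simp add: T_def i q_def[symmetric], rule P(2)[symmetric])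
  qed
  then have nT: "null_chain (\<lambda>k y. \<Sum>x\<in>X. T x k y)" by (rule null_chain_sum)
  have "(\<Sum>x\<in>X. T x k y) = A k + A (k \<cdot> c y)" if k: "k \<in> carrier H" and y: "y \<in> X" for k y
  proof -
    have "(\<Sum>x\<in>X. T x k y) =
      (\<Sum>x\<in>X. \<Sum>h\<in>changes A x. \<Sum>i\<in>occurrences r x. face_chain (h \<cdot> inv\<^bsub>H\<^esub> offset (edge_start r i)) k y)
      + (\<Sum>x\<in>X. \<Sum>h\<in>changes A x. point_chain h x k y)"
      by (simp add: T_def sum.distrib)
    also have "(\<Sum>x\<in>X. \<Sum>h\<in>changes A x. \<Sum>i\<in>occurrences r x. face_chain (h \<cdot> inv\<^bsub>H\<^esub> offset (edge_start r i)) k y)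
      = (\<Sum>x\<in>X. \<Sum>i\<in>occurrences r x. \<Sum>h\<in>changes A x. face_chain (h \<cdot> inv\<^bsub>H\<^esub> offset (edge_start r i)) k y)"
      by (intro sum.cong HOL.refl sum.swap)
    \<comment> \<open>The weight of a face is here the coefficient of its \<open>face_chain\<close>
      at the fixed edge \<open>k\<close>, \<open>y\<close>.\<close>
    also have "\<dots> = 0" by (rule sum_over_faces[OF A])
    also have "(\<Sum>x\<in>X. \<Sum>h\<in>changes A x. point_chain h x k y) = (\<Sum>x\<in>X. if x = y then of_bool (k \<in> changes A y) else 0)"
    proof (intro sum.cong HOL.refl)
      fix x assume x: "x \<in> X"
      have "(\<Sum>h\<in>changes A x. point_chain h x k y) = (\<Sum>h\<in>changes A x. if h = k then of_bool (x = y) else 0)"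
        by (intro sum.cong HOL.refl) (auto simp: point_chain_def)
      also have "\<dots> = (if x = y then of_bool (k \<in> changes A y) else 0)"
        using finite_changes[OF A x] by (simp add: sum.delta)
      finally show "(\<Sum>h\<in>changes A x. point_chain h x k y) = (if x = y then of_bool (k \<in> changes A y) else 0)" .
    qed
    also have "\<dots> = of_bool (k \<in> changes A y)" using y finite_X by (simp add: sum.delta')
    also have "\<dots> = A k + A (k \<cdot> c y)"
      using k by (cases "A k"; cases "A (k \<cdot> c y)") (auto simp: changes_def)
    finally show ?thesis by simp
  qed
  with nT have "null_chain (\<lambda>k y. A k + A (k \<cdot> c y))"
    by (rule null_chain_cong)
  then obtain b where b: "finite {h \<in> carrier H. b h \<noteq> 0}"
    "\<And>k y. k \<in> carrier H \<Longrightarrow> y \<in> X \<Longrightarrow> A k + A (k \<cdot> c y) = b k + b (k \<cdot> c y)"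
    unfolding null_chain_def by blast
  have swap: "p + p' = u + u' \<Longrightarrow> p' + u' = p + u" for p p' u u' :: bit
    by (cases p; cases p'; cases u; cases u') auto
  have const: "A h + b h = A \<one>\<^bsub>H\<^esub> + b \<one>\<^bsub>H\<^esub>" if "h \<in> carrier H" for h
    using constant_if_invariant[of "\<lambda>h. A h + b h", OF swap[OF b(2)] that] .
  have "{h \<in> carrier H. A h \<noteq> A \<one>\<^bsub>H\<^esub> + b \<one>\<^bsub>H\<^esub>} \<subseteq> {h \<in> carrier H. b h \<noteq> 0}"
  proof clarify
    fix h assume "h \<in> carrier H" "A h \<noteq> A \<one>\<^bsub>H\<^esub> + b \<one>\<^bsub>H\<^esub>" "b h = 0"
    then show False using const[of h] by simp
  qed
  then show ?thesis using b(1) finite_subset by blast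
qed

end

section \<open>Coset representatives\<close>

definition image_coset :: "('a, 'b) monoid_scheme \<Rightarrow> ('c, 'd) monoid_scheme \<Rightarrow> ('c \<Rightarrow> 'a) \<Rightarrow> 'a \<Rightarrow> 'a set" where
  "image_coset G C f x = (\<lambda>c. x \<otimes>\<^bsub>G\<^esub> f c) ` carrier C"

text \<open>The subgroup itself is represented by the identity, so that a step turning back along
  the edge just passed is recognised by the representative 1.\<close>

definition coset_rep :: "('a, 'b) monoid_scheme \<Rightarrow> ('c, 'd) monoid_scheme \<Rightarrow> ('c \<Rightarrow> 'a) \<Rightarrow> 'a \<Rightarrow> 'a" where
  "coset_rep G C f x = (if \<one>\<^bsub>G\<^esub> \<in> image_coset G C f x then \<one>\<^bsub>G\<^esub> else SOME y. y \<in> image_coset G C f x)"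

definition coset_part :: "('a, 'b) monoid_scheme \<Rightarrow> ('c, 'd) monoid_scheme \<Rightarrow> ('c \<Rightarrow> 'a) \<Rightarrow> 'a \<Rightarrow> 'c" where
  "coset_part G C f x = (SOME c. c \<in> carrier C \<and> x = coset_rep G C f x \<otimes>\<^bsub>G\<^esub> f c)"

locale inj_group_hom = group_hom C G f for C (structure) and G (structure) and f +
  assumes inj: "inj_on f (carrier C)"
begin

abbreviation "crep \<equiv> coset_rep G C f"
abbreviation "cpart \<equiv> coset_part G C f"

lemma image_coset_shift:
  assumes "x \<in> carrier G" "c \<in> carrier C"
  shows "image_coset G C f (x \<otimes>\<^bsub>G\<^esub> f c) = image_coset G C f x"
proof (intro Set.set_eqI iffI)
  fix y assume "y \<in> image_coset G C f (x \<otimes>\<^bsub>G\<^esub> f c)"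
  then obtain d where "d \<in> carrier C" "y = x \<otimes>\<^bsub>G\<^esub> f c \<otimes>\<^bsub>G\<^esub> f d" by (auto simp: image_coset_def)
  then show "y \<in> image_coset G C f x"
    using assms by (auto simp: image_coset_def H.m_assoc intro!: image_eqI[of _ _ "c \<otimes>\<^bsub>C\<^esub> d"])
next
  fix y assume "y \<in> image_coset G C f x"
  then obtain d where d: "d \<in> carrier C" "y = x \<otimes>\<^bsub>G\<^esub> f d" by (auto simp: image_coset_def)
  then have "f c \<otimes>\<^bsub>G\<^esub> f (inv\<^bsub>C\<^esub> c \<otimes>\<^bsub>C\<^esub> d) = f d" using assms by (simp flip: hom_mult G.m_assoc)
  then have "y = x \<otimes>\<^bsub>G\<^esub> f c \<otimes>\<^bsub>G\<^esub> f (inv\<^bsub>C\<^esub> c \<otimes>\<^bsub>C\<^esub> d)" using assms d by (simp add: H.m_assoc)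
  then show "y \<in> image_coset G C f (x \<otimes>\<^bsub>G\<^esub> f c)" unfolding image_coset_def
    by (rule image_eqI) (use assms d in simp)
qed

lemma rep_in_coset:
  assumes "x \<in> carrier G" shows "crep x \<in> image_coset G C f x"
proof -
  have "x \<otimes>\<^bsub>G\<^esub> f \<one>\<^bsub>C\<^esub> \<in> image_coset G C f x" unfolding image_coset_def by (rule imageI) simp
  then show ?thesis by (auto simp: coset_rep_def intro: someI)
qed

lemma rep_shift: "x \<in> carrier G \<Longrightarrow> c \<in> carrier C \<Longrightarrow> crep (x \<otimes>\<^bsub>G\<^esub> f c) = crep x"
  by (simp add: coset_rep_def image_coset_shift)

lemma rep_part:
  assumes "x \<in> carrier G"
  shows "crep x \<in> carrier G" "cpart x \<in> carrier C" "x = crep x \<otimes>\<^bsub>G\<^esub> f (cpart x)"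
proof -
  obtain c where c: "c \<in> carrier C" "crep x = x \<otimes>\<^bsub>G\<^esub> f c"
    using rep_in_coset[OF assms] by (auto simp: image_coset_def)
  then show "crep x \<in> carrier G" using assms by simp
  have "x = crep x \<otimes>\<^bsub>G\<^esub> f (inv\<^bsub>C\<^esub> c)" using c assms by (simp add: H.m_assoc)
  then have "\<exists>c. c \<in> carrier C \<and> x = crep x \<otimes>\<^bsub>G\<^esub> f c" using c by blast
  then have "cpart x \<in> carrier C \<and> x = crep x \<otimes>\<^bsub>G\<^esub> f (cpart x)"
    unfolding coset_part_def by (rule someI_ex)
  then show "cpart x \<in> carrier C" "x = crep x \<otimes>\<^bsub>G\<^esub> f (cpart x)" by auto
qed

lemma rep_idem: "x \<in> carrier G \<Longrightarrow> crep (crep x) = crep x"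
  using rep_shift[OF rep_part(1) rep_part(2), of x x] rep_part(3)[of x] by simp

lemma rep_mult_part:
  assumes "y \<in> carrier G" "crep y = y" "c \<in> carrier C"
  shows "crep (y \<otimes>\<^bsub>G\<^esub> f c) = y" "cpart (y \<otimes>\<^bsub>G\<^esub> f c) = c"
proof -
  show r: "crep (y \<otimes>\<^bsub>G\<^esub> f c) = y" using assms rep_shift by simp
  have "y \<otimes>\<^bsub>G\<^esub> f c \<in> carrier G" using assms by simp
  note rp = rep_part[OF this]
  have "y \<otimes>\<^bsub>G\<^esub> f c = y \<otimes>\<^bsub>G\<^esub> f (cpart (y \<otimes>\<^bsub>G\<^esub> f c))" using rp(3) r by simp
  then have "f c = f (cpart (y \<otimes>\<^bsub>G\<^esub> f c))" using assms rp(2) by simp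
  then show "cpart (y \<otimes>\<^bsub>G\<^esub> f c) = c" using inj assms rp(2) by (metis inj_onD)
qed

lemma part_shift:
  assumes "x \<in> carrier G" "c \<in> carrier C"
  shows "cpart (x \<otimes>\<^bsub>G\<^esub> f c) = cpart x \<otimes>\<^bsub>C\<^esub> c"
proof -
  note rp = rep_part[OF assms(1)]
  have "x \<otimes>\<^bsub>G\<^esub> f c = crep x \<otimes>\<^bsub>G\<^esub> f (cpart x) \<otimes>\<^bsub>G\<^esub> f c" using rp(3) by simp
  also have "\<dots> = crep x \<otimes>\<^bsub>G\<^esub> f (cpart x \<otimes>\<^bsub>C\<^esub> c)" using rp(1,2) assms by (simp add: H.m_assoc)
  finally have eq: "x \<otimes>\<^bsub>G\<^esub> f c = crep x \<otimes>\<^bsub>G\<^esub> f (cpart x \<otimes>\<^bsub>C\<^esub> c)" .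
  show ?thesis unfolding eq
    by (rule rep_mult_part(2)[OF rp(1) rep_idem[OF assms(1)]]) (use rp(2) assms in simp)
qed

lemma rep_one_iff:
  assumes "x \<in> carrier G"
  shows "crep x = \<one>\<^bsub>G\<^esub> \<longleftrightarrow> x \<in> f ` carrier C"
proof
  assume "crep x = \<one>\<^bsub>G\<^esub>"
  then show "x \<in> f ` carrier C" using rep_part[OF assms] by auto
next
  assume "x \<in> f ` carrier C"
  then obtain c where c: "c \<in> carrier C" "x = f c" by auto
  then have "crep x = crep \<one>\<^bsub>G\<^esub>" using rep_shift[of "\<one>\<^bsub>G\<^esub>" c] by simp
  also have "\<one>\<^bsub>G\<^esub> \<in> image_coset G C f \<one>\<^bsub>G\<^esub>" unfolding image_coset_def by (rule image_eqI[of _ _ "\<one>\<^bsub>C\<^esub>"]) auto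
  then have "crep \<one>\<^bsub>G\<^esub> = \<one>\<^bsub>G\<^esub>" by (simp add: coset_rep_def)
  finally show "crep x = \<one>\<^bsub>G\<^esub>" .
qed

end

section \<open>Potentials on forests\<close>

definition edge_steps :: "('e \<Rightarrow> bool \<Rightarrow> 'v) \<Rightarrow> 'e set \<Rightarrow> ('v \<times> 'v) set" where
  "edge_steps p T = {(p e s, p e (\<not> s)) | e s. e \<in> T}"

lemma sym_edge_steps: "sym (edge_steps p T)"
proof (rule symI)
  fix a b assume "(a, b) \<in> edge_steps p T"
  then obtain e s where "e \<in> T" "a = p e s" "b = p e (\<not> s)" by (auto simp: edge_steps_def)
  then have "(b, a) = (p e (\<not> s), p e (\<not> \<not> s))" "e \<in> T" by simp_all
  then show "(b, a) \<in> edge_steps p T" unfolding edge_steps_def by blast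
qed

lemma edge_steps_mono: "S \<subseteq> T \<Longrightarrow> (edge_steps p S)\<^sup>* \<subseteq> (edge_steps p T)\<^sup>*"
  by (rule rtrancl_mono) (auto simp: edge_steps_def)

lemma edge_steps_constant:
  assumes "(u, w) \<in> (edge_steps p T)\<^sup>*" "\<And>e. e \<in> T \<Longrightarrow> f (p e True) = f (p e False)"
  shows "f u = f w"
  using assms(1)
proof (induction rule: rtrancl_induct)
  case (step y z)
  then obtain e s where "e \<in> T" "y = p e s" "z = p e (\<not> s)" by (auto simp: edge_steps_def)
  then have "f y = f z" using assms(2) by (cases s) auto
  then show ?case using step by simp
qed simp

text \<open>The induction adds one edge at a time and so passes through disconnected forests, which
  is why there is a root for every component. A new edge is a bridge: the potential on one side of
  it can be rebased through the edge without disturbing the other side.\<close>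

lemma forest_potential:
  fixes p :: "'e \<Rightarrow> bool \<Rightarrow> 'v" and N :: "'v \<Rightarrow> 's set" and \<beta> :: "'e \<Rightarrow> bool \<Rightarrow> 's \<Rightarrow> 's"
  assumes "finite T"
    and "\<And>e s. e \<in> T \<Longrightarrow> p e s \<in> V"
    and "\<And>e. e \<in> T \<Longrightarrow> (p e True, p e False) \<notin> (edge_steps p (T - {e}))\<^sup>*"
    and "\<And>e s \<omega>. e \<in> T \<Longrightarrow> \<omega> \<in> N (p e s) \<Longrightarrow> \<beta> e s \<omega> \<in> N (p e (\<not> s)) \<and> \<beta> e (\<not> s) (\<beta> e s \<omega>) = \<omega>"
  shows "\<exists>root \<tau> \<tau>i. (\<forall>u\<in>V. root u \<in> V \<and>
      (\<forall>\<omega>\<in>N (root u). \<tau> u \<omega> \<in> N u \<and> \<tau>i u (\<tau> u \<omega>) = \<omega>) \<and>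
      (\<forall>\<omega>\<in>N u. \<tau>i u \<omega> \<in> N (root u) \<and> \<tau> u (\<tau>i u \<omega>) = \<omega>)) \<and>
    (\<forall>e\<in>T. root (p e True) = root (p e False) \<and>
      (\<forall>\<omega>\<in>N (root (p e False)). \<tau> (p e True) \<omega> = \<beta> e False (\<tau> (p e False) \<omega>)))"
  using assms
proof (induction T rule: finite_induct)
  case empty
  show ?case by (rule exI[of _ "\<lambda>u. u"], rule exI[of _ "\<lambda>u \<omega>. \<omega>"], rule exI[of _ "\<lambda>u \<omega>. \<omega>"]) simp
next
  case (insert e T)
  have "\<exists>root \<tau> \<tau>i. (\<forall>u\<in>V. root u \<in> V \<and>
      (\<forall>\<omega>\<in>N (root u). \<tau> u \<omega> \<in> N u \<and> \<tau>i u (\<tau> u \<omega>) = \<omega>) \<and>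
      (\<forall>\<omega>\<in>N u. \<tau>i u \<omega> \<in> N (root u) \<and> \<tau> u (\<tau>i u \<omega>) = \<omega>)) \<and>
    (\<forall>e\<in>T. root (p e True) = root (p e False) \<and>
      (\<forall>\<omega>\<in>N (root (p e False)). \<tau> (p e True) \<omega> = \<beta> e False (\<tau> (p e False) \<omega>)))"
  proof (rule insert.IH)
    show "(p e' True, p e' False) \<notin> (edge_steps p (T - {e'}))\<^sup>*" if "e' \<in> T" for e'
      using insert.prems(2)[of e'] that edge_steps_mono[of "T - {e'}" "insert e T - {e'}" p] by auto
  qed (use insert.prems(1,3) in blast)+
  then obtain root \<tau> \<tau>i where pot: "\<forall>u\<in>V. root u \<in> V \<and>
      (\<forall>\<omega>\<in>N (root u). \<tau> u \<omega> \<in> N u \<and> \<tau>i u (\<tau> u \<omega>) = \<omega>) \<and>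
      (\<forall>\<omega>\<in>N u. \<tau>i u \<omega> \<in> N (root u) \<and> \<tau> u (\<tau>i u \<omega>) = \<omega>)"
    "\<forall>e\<in>T. root (p e True) = root (p e False) \<and>
      (\<forall>\<omega>\<in>N (root (p e False)). \<tau> (p e True) \<omega> = \<beta> e False (\<tau> (p e False) \<omega>))"
    by (elim exE conjE)
  have V: "root u \<in> V" if "u \<in> V" for u using pot(1) that by blast
  have \<tau>: "\<tau> u \<omega> \<in> N u \<and> \<tau>i u (\<tau> u \<omega>) = \<omega>" if "u \<in> V" "\<omega> \<in> N (root u)" for u \<omega>
    using pot(1) that by blast
  have \<tau>i: "\<tau>i u \<omega> \<in> N (root u) \<and> \<tau> u (\<tau>i u \<omega>) = \<omega>" if "u \<in> V" "\<omega> \<in> N u" for u \<omega>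
    using pot(1) that by blast
  have root: "root (p e True) = root (p e False)" if "e \<in> T" for e
    using pot(2) that by blast
  have edge: "\<tau> (p e True) \<omega> = \<beta> e False (\<tau> (p e False) \<omega>)"
    if "e \<in> T" "\<omega> \<in> N (root (p e False))" for e \<omega>
    using pot(2) that by blast
  define v w where "v = p e False" and "w = p e True"
  \<comment> \<open>The component of the \<open>True\<close> end \<open>w\<close> before
    \<open>e\<close> is added. It is the side to be rebased; the bridge property gives that
    \<open>v\<close> is not in it.\<close>
  define W where "W = {u. (w, u) \<in> (edge_steps p T)\<^sup>*}"
  have vw: "v \<in> V" "w \<in> V" using insert.prems(1) by (auto simp: v_def w_def)
  have "insert e T - {e} = T" using insert.hyps by auto
  then have vW: "v \<notin> W" "w \<in> W" using insert.prems(2)[of e] by (auto simp: W_def v_def w_def)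
  have rootW: "root u = root w" if "u \<in> W" for u
    using edge_steps_constant[of w u p T root] that root by (simp add: W_def)
  have Wiff: "p e' True \<in> W \<longleftrightarrow> p e' False \<in> W" if "e' \<in> T" for e'
  proof -
    have "(p e' s, p e' (\<not> s)) \<in> edge_steps p T" for s using that by (auto simp: edge_steps_def)
    from this[of True] this[of False] show ?thesis unfolding W_def by (auto intro: rtrancl_into_rtrancl)
  qed
  have \<beta>: "\<omega> \<in> N v \<Longrightarrow> \<beta> e False \<omega> \<in> N w \<and> \<beta> e True (\<beta> e False \<omega>) = \<omega>"
    "\<omega> \<in> N w \<Longrightarrow> \<beta> e True \<omega> \<in> N v \<and> \<beta> e False (\<beta> e True \<omega>) = \<omega>" for \<omega>
    using insert.prems(3)[of e \<omega> False] insert.prems(3)[of e \<omega> True] by (auto simp: v_def w_def)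
  define root' where "root' u = (if u \<in> W then root v else root u)" for u
  \<comment> \<open>From the new root to \<open>v\<close>, across \<open>e\<close> to
    \<open>w\<close>, back to the old root of \<open>W\<close>, and from there to
    \<open>u\<close>.\<close>
  define \<tau>' where "\<tau>' u \<omega> = (if u \<in> W then \<tau> u (\<tau>i w (\<beta> e False (\<tau> v \<omega>))) else \<tau> u \<omega>)" for u \<omega>
  define \<tau>i' where "\<tau>i' u \<omega> = (if u \<in> W then \<tau>i v (\<beta> e True (\<tau> w (\<tau>i u \<omega>))) else \<tau>i u \<omega>)" for u \<omega>
  have 1: "root' u \<in> V" if "u \<in> V" for u using that V vw by (simp add: root'_def)
  have 2: "\<tau>' u \<omega> \<in> N u \<and> \<tau>i' u (\<tau>' u \<omega>) = \<omega>" if u: "u \<in> V" "\<omega> \<in> N (root' u)" for u \<omega>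
  proof (cases "u \<in> W")
    case True
    then have "\<omega> \<in> N (root v)" using u by (simp add: root'_def)
    note a = \<tau>[OF vw(1) this]
    note b = \<beta>(1)[OF conjunct1[OF a]]
    note d = \<tau>i[OF vw(2) conjunct1[OF b]]
    have "\<tau>i w (\<beta> e False (\<tau> v \<omega>)) \<in> N (root u)" using d rootW[OF True] by simp
    note f = \<tau>[OF u(1) this]
    show ?thesis using True a b d f by (simp add: \<tau>'_def \<tau>i'_def)
  next
    case False
    then show ?thesis using \<tau> u by (simp add: \<tau>'_def \<tau>i'_def root'_def)
  qed
  have 3: "\<tau>i' u \<omega> \<in> N (root' u) \<and> \<tau>' u (\<tau>i' u \<omega>) = \<omega>" if u: "u \<in> V" "\<omega> \<in> N u" for u \<omega>
  proof (cases "u \<in> W")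
    case True
    note a = \<tau>i[OF u]
    have "\<tau>i u \<omega> \<in> N (root w)" using a rootW[OF True] by simp
    note b = \<tau>[OF vw(2) this]
    note d = \<beta>(2)[OF conjunct1[OF b]]
    note f = \<tau>i[OF vw(1) conjunct1[OF d]]
    show ?thesis using True a b d f by (simp add: \<tau>'_def \<tau>i'_def root'_def)
  next
    case False
    then show ?thesis using \<tau>i u by (simp add: \<tau>'_def \<tau>i'_def root'_def)
  qed
  have 4: "root' (p e' True) = root' (p e' False) \<and>
      (\<forall>\<omega>\<in>N (root' (p e' False)). \<tau>' (p e' True) \<omega> = \<beta> e' False (\<tau>' (p e' False) \<omega>))"
    if e': "e' \<in> insert e T" for e'
  proof (cases "e' = e")
    case True
    have "\<tau>' w \<omega> = \<beta> e False (\<tau>' v \<omega>)" if "\<omega> \<in> N (root v)" for \<omega>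
    proof -
      note a = \<tau>[OF vw(1) that]
      note b = \<tau>i[OF vw(2) conjunct1[OF \<beta>(1)[OF conjunct1[OF a]]]]
      show ?thesis using vW b by (simp add: \<tau>'_def)
    qed
    then show ?thesis using True vW by (simp add: root'_def v_def[symmetric] w_def[symmetric])
  next
    case False
    then have eT: "e' \<in> T" using e' by simp
    have pV: "p e' s \<in> V" for s using insert.prems(1) e' by simp
    show ?thesis
    proof (cases "p e' False \<in> W")
      case True
      have "\<tau>i w (\<beta> e False (\<tau> v \<omega>)) \<in> N (root (p e' False))" if "\<omega> \<in> N (root v)" for \<omega>
      proof -
        note a = \<tau>[OF vw(1) that]
        note b = \<tau>i[OF vw(2) conjunct1[OF \<beta>(1)[OF conjunct1[OF a]]]]
        then show ?thesis using rootW[OF True] by simp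
      qed
      then show ?thesis using True Wiff[OF eT] edge[OF eT] by (simp add: root'_def \<tau>'_def)
    next
      case False
      then show ?thesis using Wiff[OF eT] edge[OF eT] root[OF eT] by (simp add: root'_def \<tau>'_def)
    qed
  qed
  show ?case
    by (rule exI[of _ root'], rule exI[of _ \<tau>'], rule exI[of _ \<tau>i']) (use 1 2 3 4 in blast)
qed

section \<open>The Bass-Serre tree via normal forms\<close>

locale gog_tree =
  fixes \<Gamma> :: "('v, 'e, 'a, 'c) gog" and T :: "'e set"
  assumes gog: "graph_of_groups \<Gamma>" and tree: "spanning_tree \<Gamma> T" and finite_edges: "finite (edges \<Gamma>)"
begin

abbreviation "G \<equiv> pi1 \<Gamma> T"
abbreviation "X \<equiv> pi1_gens \<Gamma>"
abbreviation "R \<equiv> pi1_relators \<Gamma> T"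
abbreviation "cls \<equiv> word_class X R"
abbreviation mult_G (infixl "\<cdot>" 70) where "g \<cdot> h \<equiv> g \<otimes>\<^bsub>G\<^esub> h"

lemma pi1_presented: "G = presented_group X R"
  by (simp add: pi1_def)

sublocale G: group G
  unfolding pi1_presented by (rule group_presented_group)

lemma vgroup: "v \<in> verts \<Gamma> \<Longrightarrow> group (vgroup \<Gamma> v)"
  using gog by (simp add: graph_of_groups_def)

lemma endpt_verts: "e \<in> edges \<Gamma> \<Longrightarrow> endpt \<Gamma> e s \<in> verts \<Gamma>"
  using gog by (simp add: graph_of_groups_def)

lemma bdry_inj: "e \<in> edges \<Gamma> \<Longrightarrow> inj_group_hom (egroup \<Gamma> e) (vgroup \<Gamma> (endpt \<Gamma> e s)) (bdry \<Gamma> e s)"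
  using gog vgroup[OF endpt_verts]
  by (simp add: graph_of_groups_def inj_group_hom_def inj_group_hom_axioms_def group_hom_def group_hom_axioms_def)

lemma T_edges: "T \<subseteq> edges \<Gamma>"
  using tree by (simp add: spanning_tree_def)

definition base where "base = (SOME v. v \<in> verts \<Gamma>)"

lemma base: "base \<in> verts \<Gamma>"
  unfolding base_def using gog by (auto simp: graph_of_groups_def intro: someI)

text \<open>
  A normal form at \<open>v\<close> is a reduced path from \<open>base\<close> to \<open>v\<close>, stored with its last edge first, together
  with an element of the group at \<open>v\<close>. An entry \<open>(e, s, y)\<close> records the coset representative \<open>y\<close>
  followed by the passage of \<open>e\<close> from its end \<open>s\<close> to the other end.
\<close>

fun stack :: "('e \<times> bool \<times> 'a) list \<Rightarrow> 'v \<Rightarrow> bool" where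
  "stack [] v \<longleftrightarrow> v = base"
| "stack ((e, s, y) # L) v \<longleftrightarrow> e \<in> edges \<Gamma> \<and> endpt \<Gamma> e (\<not> s) = v \<and>
     y \<in> carrier (vgroup \<Gamma> (endpt \<Gamma> e s)) \<and>
     coset_rep (vgroup \<Gamma> (endpt \<Gamma> e s)) (egroup \<Gamma> e) (bdry \<Gamma> e s) y = y \<and>
     stack L (endpt \<Gamma> e s) \<and>
     \<not> (L \<noteq> [] \<and> fst (hd L) = e \<and> fst (snd (hd L)) = (\<not> s) \<and> y = \<one>\<^bsub>vgroup \<Gamma> (endpt \<Gamma> e s)\<^esub>)"

definition normal_forms :: "'v \<Rightarrow> (('e \<times> bool \<times> 'a) list \<times> 'a) set" where
  "normal_forms v = {(L, x). stack L v \<and> x \<in> carrier (vgroup \<Gamma> v)}"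

definition translate :: "'v \<Rightarrow> 'a \<Rightarrow> ('e \<times> bool \<times> 'a) list \<times> 'a \<Rightarrow> ('e \<times> bool \<times> 'a) list \<times> 'a" where
  "translate v g \<omega> = (fst \<omega>, snd \<omega> \<otimes>\<^bsub>vgroup \<Gamma> v\<^esub> g)"

text \<open>The element is split as the representative \<open>y\<close> times the image of an edge
  group element. That factor crosses the edge and becomes \<open>z\<close>, while \<open>y\<close>
  is stored. If the step would turn back along the last entry, this entry is removed instead and its
  stored representative multiplied on.\<close>

definition pass :: "'e \<Rightarrow> bool \<Rightarrow> ('e \<times> bool \<times> 'a) list \<times> 'a \<Rightarrow> ('e \<times> bool \<times> 'a) list \<times> 'a" where
  "pass e s \<omega> = (let G1 = vgroup \<Gamma> (endpt \<Gamma> e s); y = coset_rep G1 (egroup \<Gamma> e) (bdry \<Gamma> e s) (snd \<omega>);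
       z = bdry \<Gamma> e (\<not> s) (coset_part G1 (egroup \<Gamma> e) (bdry \<Gamma> e s) (snd \<omega>)); L = fst \<omega> in
     if L \<noteq> [] \<and> fst (hd L) = e \<and> fst (snd (hd L)) = (\<not> s) \<and> y = \<one>\<^bsub>G1\<^esub>
     then (tl L, snd (snd (hd L)) \<otimes>\<^bsub>vgroup \<Gamma> (endpt \<Gamma> e (\<not> s))\<^esub> z)
     else ((e, s, y) # L, z))"

lemma translate_closed:
  "v \<in> verts \<Gamma> \<Longrightarrow> \<omega> \<in> normal_forms v \<Longrightarrow> g \<in> carrier (vgroup \<Gamma> v) \<Longrightarrow> translate v g \<omega> \<in> normal_forms v"
  using vgroup[of v] by (auto simp: normal_forms_def translate_def intro: group.is_monoid monoid.m_closed)

lemma translate_translate: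
  assumes "v \<in> verts \<Gamma>" "\<omega> \<in> normal_forms v" "g \<in> carrier (vgroup \<Gamma> v)" "h \<in> carrier (vgroup \<Gamma> v)"
  shows "translate v h (translate v g \<omega>) = translate v (g \<otimes>\<^bsub>vgroup \<Gamma> v\<^esub> h) \<omega>"
proof -
  interpret group "vgroup \<Gamma> v" by (rule vgroup[OF assms(1)])
  show ?thesis using assms by (auto simp: normal_forms_def translate_def m_assoc)
qed

lemma translate_one:
  assumes "v \<in> verts \<Gamma>" "\<omega> \<in> normal_forms v"
  shows "translate v \<one>\<^bsub>vgroup \<Gamma> v\<^esub> \<omega> = \<omega>"
proof -
  interpret group "vgroup \<Gamma> v" by (rule vgroup[OF assms(1)])
  show ?thesis using assms by (auto simp: normal_forms_def translate_def)
qed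

text \<open>The two branches of \<open>pass\<close> undo each other. After a removal, passing back
  must push the entry again and not remove a further one, which the last clause of
  \<open>stack\<close> ensures. After a push, the element at the new end lies in the image of the
  edge group and triggers the removal.\<close>

lemma pass_inverse:
  assumes e: "e \<in> edges \<Gamma>" and \<omega>: "\<omega> \<in> normal_forms (endpt \<Gamma> e s)"
  shows "pass e s \<omega> \<in> normal_forms (endpt \<Gamma> e (\<not> s)) \<and> pass e (\<not> s) (pass e s \<omega>) = \<omega>"
proof -
  interpret A: inj_group_hom "egroup \<Gamma> e" "vgroup \<Gamma> (endpt \<Gamma> e s)" "bdry \<Gamma> e s" by (rule bdry_inj[OF e])
  interpret B: inj_group_hom "egroup \<Gamma> e" "vgroup \<Gamma> (endpt \<Gamma> e (\<not> s))" "bdry \<Gamma> e (\<not> s)" by (rule bdry_inj[OF e])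
  obtain L x where \<omega>': "\<omega> = (L, x)" "stack L (endpt \<Gamma> e s)" "x \<in> carrier (vgroup \<Gamma> (endpt \<Gamma> e s))"
    using \<omega> by (auto simp: normal_forms_def)
  note rp = A.rep_part[OF \<omega>'(3)]
  show ?thesis
  proof (cases "L \<noteq> [] \<and> fst (hd L) = e \<and> fst (snd (hd L)) = (\<not> s) \<and> A.crep x = \<one>\<^bsub>vgroup \<Gamma> (endpt \<Gamma> e s)\<^esub>")
    case True
    then obtain y L' where L: "L = (e, \<not> s, y) # L'" by (cases L) (auto simp: prod_eq_iff)
    have p: "pass e s \<omega> = (L', y \<otimes>\<^bsub>vgroup \<Gamma> (endpt \<Gamma> e (\<not> s))\<^esub> bdry \<Gamma> e (\<not> s) (A.cpart x))"
      using True by (simp add: pass_def Let_def \<omega>' L)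
    have y: "y \<in> carrier (vgroup \<Gamma> (endpt \<Gamma> e (\<not> s)))" "B.crep y = y" "stack L' (endpt \<Gamma> e (\<not> s))"
      "\<not> (L' \<noteq> [] \<and> fst (hd L') = e \<and> fst (snd (hd L')) = s \<and> y = \<one>\<^bsub>vgroup \<Gamma> (endpt \<Gamma> e (\<not> s))\<^esub>)"
      using \<omega>'(2) by (auto simp: L)
    have "bdry \<Gamma> e s (A.cpart x) = x" using rp True by simp
    then have "pass e (\<not> s) (pass e s \<omega>) = \<omega>"
      unfolding p using y B.rep_mult_part[OF y(1,2) rp(2)] by (auto simp: pass_def Let_def \<omega>' L)
    moreover have "pass e s \<omega> \<in> normal_forms (endpt \<Gamma> e (\<not> s))"
      unfolding p using y rp(2) by (simp add: normal_forms_def)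
    ultimately show ?thesis by simp
  next
    case False
    have p: "pass e s \<omega> = ((e, s, A.crep x) # L, bdry \<Gamma> e (\<not> s) (A.cpart x))"
      using False by (auto simp: pass_def Let_def \<omega>')
    have "B.crep \<one>\<^bsub>vgroup \<Gamma> (endpt \<Gamma> e (\<not> s))\<^esub> = \<one>\<^bsub>vgroup \<Gamma> (endpt \<Gamma> e (\<not> s))\<^esub>"
      by (subst B.rep_one_iff) (auto intro!: image_eqI[of _ _ "\<one>\<^bsub>egroup \<Gamma> e\<^esub>"])
    from B.rep_mult_part[OF _ this rp(2)]
    have "B.crep (bdry \<Gamma> e (\<not> s) (A.cpart x)) = \<one>\<^bsub>vgroup \<Gamma> (endpt \<Gamma> e (\<not> s))\<^esub>"
      "B.cpart (bdry \<Gamma> e (\<not> s) (A.cpart x)) = A.cpart x" using rp(2) by auto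
    then have "pass e (\<not> s) (pass e s \<omega>) = \<omega>"
      unfolding p using rp by (simp add: pass_def Let_def \<omega>')
    moreover have "pass e s \<omega> \<in> normal_forms (endpt \<Gamma> e (\<not> s))"
      unfolding p using rp e \<omega>' False A.rep_idem[OF \<omega>'(3)] by (auto simp: normal_forms_def)
    ultimately show ?thesis by simp
  qed
qed

text \<open>A factor from the edge group affects only the part that crosses the edge; the stored
  representative depends on the coset alone. This is the edge relation of the fundamental group on
  normal forms.\<close>

lemma pass_translate:
  assumes e: "e \<in> edges \<Gamma>" and \<omega>: "\<omega> \<in> normal_forms (endpt \<Gamma> e s)" and d: "d \<in> carrier (egroup \<Gamma> e)"
  shows "pass e s (translate (endpt \<Gamma> e s) (bdry \<Gamma> e s d) \<omega>) =
    translate (endpt \<Gamma> e (\<not> s)) (bdry \<Gamma> e (\<not> s) d) (pass e s \<omega>)"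
proof -
  interpret A: inj_group_hom "egroup \<Gamma> e" "vgroup \<Gamma> (endpt \<Gamma> e s)" "bdry \<Gamma> e s" by (rule bdry_inj[OF e])
  interpret B: inj_group_hom "egroup \<Gamma> e" "vgroup \<Gamma> (endpt \<Gamma> e (\<not> s))" "bdry \<Gamma> e (\<not> s)" by (rule bdry_inj[OF e])
  obtain L x where \<omega>': "\<omega> = (L, x)" "stack L (endpt \<Gamma> e s)" "x \<in> carrier (vgroup \<Gamma> (endpt \<Gamma> e s))"
    using \<omega> by (auto simp: normal_forms_def)
  have y: "snd (snd (hd L)) \<in> carrier (vgroup \<Gamma> (endpt \<Gamma> e (\<not> s)))"
    if "L \<noteq> []" "fst (hd L) = e" "fst (snd (hd L)) = (\<not> s)"
    using that \<omega>'(2) by (cases L) auto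
  show ?thesis
    using A.rep_part[OF \<omega>'(3)] d y
    by (auto simp: pass_def Let_def translate_def \<omega>' A.rep_shift A.part_shift B.H.m_assoc)
qed

lemma length_pass:
  assumes e: "e \<in> edges \<Gamma>" and \<omega>: "\<omega> \<in> normal_forms (endpt \<Gamma> e s)"
  shows "length (fst (pass e s \<omega>)) = Suc (length (fst \<omega>)) \<or>
    (Suc (length (fst (pass e s \<omega>))) = length (fst \<omega>) \<and>
     fst (hd (fst \<omega>)) = e \<and> fst (snd (hd (fst \<omega>))) = (\<not> s) \<and> snd \<omega> \<in> bdry \<Gamma> e s ` carrier (egroup \<Gamma> e))"
proof -
  interpret A: inj_group_hom "egroup \<Gamma> e" "vgroup \<Gamma> (endpt \<Gamma> e s)" "bdry \<Gamma> e s" by (rule bdry_inj[OF e])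
  obtain L x where \<omega>': "\<omega> = (L, x)" "x \<in> carrier (vgroup \<Gamma> (endpt \<Gamma> e s))"
    using \<omega> by (auto simp: normal_forms_def)
  show ?thesis using A.rep_one_iff[OF \<omega>'(2)] by (auto simp: pass_def Let_def \<omega>')
qed

text \<open>If the end points of \<open>e\<close> could be joined without \<open>e\<close>, this
  detour would replace every use of \<open>e\<close>, and the tree would remain connected after its
  removal.\<close>

lemma bridge:
  assumes "e \<in> T"
  shows "(endpt \<Gamma> e True, endpt \<Gamma> e False) \<notin> (edge_steps (endpt \<Gamma>) (T - {e}))\<^sup>*"
proof
  let ?E = "edge_steps (endpt \<Gamma>)"
  assume a: "(endpt \<Gamma> e True, endpt \<Gamma> e False) \<in> (?E (T - {e}))\<^sup>*"
  then have b: "(endpt \<Gamma> e False, endpt \<Gamma> e True) \<in> (?E (T - {e}))\<^sup>*"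
    using symD[OF sym_rtrancl[OF sym_edge_steps]] by metis
  have "(u, w) \<in> (?E (T - {e}))\<^sup>*" if uw: "(u, w) \<in> ?E T" for u w
  proof -
    from uw obtain e' s where e': "e' \<in> T" "u = endpt \<Gamma> e' s" "w = endpt \<Gamma> e' (\<not> s)"
      by (auto simp: edge_steps_def)
    show ?thesis
    proof (cases "e' = e")
      case True
      then show ?thesis using e' a b by (cases s) auto
    next
      case False
      then show ?thesis using e' by (intro r_into_rtrancl) (auto simp: edge_steps_def)
    qed
  qed
  then have "?E T \<subseteq> (?E (T - {e}))\<^sup>*" by auto
  then have "(?E T)\<^sup>* \<subseteq> (?E (T - {e}))\<^sup>*" by (rule rtrancl_subset_rtrancl)
  then have "joins_verts \<Gamma> (T - {e})"
    using tree unfolding spanning_tree_def joins_verts_def edge_steps_def[symmetric] by blast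
  then show False using tree assms by (simp add: spanning_tree_def)
qed

lemma potential_exists:
  "\<exists>r0 \<tau> \<tau>i. r0 \<in> verts \<Gamma> \<and>
    (\<forall>u\<in>verts \<Gamma>. (\<forall>\<omega>\<in>normal_forms r0. \<tau> u \<omega> \<in> normal_forms u \<and> \<tau>i u (\<tau> u \<omega>) = \<omega>) \<and>
      (\<forall>\<omega>\<in>normal_forms u. \<tau>i u \<omega> \<in> normal_forms r0 \<and> \<tau> u (\<tau>i u \<omega>) = \<omega>)) \<and>
    (\<forall>e\<in>T. \<forall>\<omega>\<in>normal_forms r0. \<tau> (endpt \<Gamma> e True) \<omega> = pass e False (\<tau> (endpt \<Gamma> e False) \<omega>))"
proof -
  have "\<exists>root \<tau> \<tau>i. (\<forall>u\<in>verts \<Gamma>. root u \<in> verts \<Gamma> \<and>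
      (\<forall>\<omega>\<in>normal_forms (root u). \<tau> u \<omega> \<in> normal_forms u \<and> \<tau>i u (\<tau> u \<omega>) = \<omega>) \<and>
      (\<forall>\<omega>\<in>normal_forms u. \<tau>i u \<omega> \<in> normal_forms (root u) \<and> \<tau> u (\<tau>i u \<omega>) = \<omega>)) \<and>
    (\<forall>e\<in>T. root (endpt \<Gamma> e True) = root (endpt \<Gamma> e False) \<and>
      (\<forall>\<omega>\<in>normal_forms (root (endpt \<Gamma> e False)). \<tau> (endpt \<Gamma> e True) \<omega> = pass e False (\<tau> (endpt \<Gamma> e False) \<omega>)))"
  proof (rule forest_potential)
    show "finite T" using finite_edges T_edges finite_subset by blast
  qed (use T_edges endpt_verts bridge pass_inverse in auto)
  then obtain root \<tau> \<tau>i where *: "\<forall>u\<in>verts \<Gamma>. root u \<in> verts \<Gamma> \<and>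
      (\<forall>\<omega>\<in>normal_forms (root u). \<tau> u \<omega> \<in> normal_forms u \<and> \<tau>i u (\<tau> u \<omega>) = \<omega>) \<and>
      (\<forall>\<omega>\<in>normal_forms u. \<tau>i u \<omega> \<in> normal_forms (root u) \<and> \<tau> u (\<tau>i u \<omega>) = \<omega>)"
    and **: "\<And>e. e \<in> T \<Longrightarrow> root (endpt \<Gamma> e True) = root (endpt \<Gamma> e False)"
    "\<And>e \<omega>. e \<in> T \<Longrightarrow> \<omega> \<in> normal_forms (root (endpt \<Gamma> e False)) \<Longrightarrow>
       \<tau> (endpt \<Gamma> e True) \<omega> = pass e False (\<tau> (endpt \<Gamma> e False) \<omega>)"
    by (elim exE conjE) blast
  \<comment> \<open>The potential has a root for each component, but the tree joins all
    vertices.\<close>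
  have root: "root u = root base" if "u \<in> verts \<Gamma>" for u
  proof -
    have "(u, base) \<in> (edge_steps (endpt \<Gamma>) T)\<^sup>*"
      using tree that base unfolding spanning_tree_def joins_verts_def edge_steps_def by blast
    then show ?thesis using edge_steps_constant[of u base "endpt \<Gamma>" T root] **(1) by blast
  qed
  have r1: "root (endpt \<Gamma> e False) = root base" if "e \<in> T" for e
    using root endpt_verts T_edges that by blast
  show ?thesis
  proof (rule exI[of _ "root base"], rule exI[of _ \<tau>], rule exI[of _ \<tau>i], intro conjI ballI)
    show "root base \<in> verts \<Gamma>" using * base by blast
    show "\<tau> (endpt \<Gamma> e True) \<omega> = pass e False (\<tau> (endpt \<Gamma> e False) \<omega>)"
      if "e \<in> T" "\<omega> \<in> normal_forms (root base)" for e \<omega>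
      using **(2)[OF that(1)] that r1 by simp
  qed (use * root in \<open>simp_all\<close>)
qed

abbreviation \<iota> :: "'v \<Rightarrow> 'a \<Rightarrow> ('v, 'e, 'a) pi1_gen word set" where
  "\<iota> v x \<equiv> cls [gen (VGen v x)]"

text \<open>The relator says that $t_e$ times the image at the \<open>True\<close> end equals the
  image at the \<open>False\<close> end times $t_e$. So right multiplication by $t_e$ leads from the
  \<open>False\<close> end to the \<open>True\<close> end, whence the negation.\<close>

abbreviation stable :: "'e \<Rightarrow> bool \<Rightarrow> ('v, 'e, 'a) pi1_gen word set" where
  "stable e s \<equiv> cls [(EGen e, \<not> s)]"

text \<open>The intended \<open>state g v\<close> is the normal form of \<open>g\<close> at
  \<open>v\<close>. These conditions isolate what is used later from the choice of root and of
  identifications.\<close>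

definition equivariant where
  "equivariant state \<longleftrightarrow> (\<forall>g\<in>carrier G. \<forall>v\<in>verts \<Gamma>. state g v \<in> normal_forms v) \<and>
    (\<forall>g\<in>carrier G. \<forall>v\<in>verts \<Gamma>. \<forall>x\<in>carrier (vgroup \<Gamma> v). state (g \<cdot> \<iota> v x) v = translate v x (state g v)) \<and>
    (\<forall>g\<in>carrier G. \<forall>e\<in>edges \<Gamma>. \<forall>s. state (g \<cdot> stable e s) (endpt \<Gamma> e (\<not> s)) = pass e s (state g (endpt \<Gamma> e s)))"

end

text \<open>
  Passing along an edge identifies the normal forms at its ends. On a tree these identifications can be
  trivialised: \<open>\<tau> u\<close> identifies the normal forms at \<open>r0\<close> with those at \<open>u\<close> so that the stable letters of
  tree edges act trivially, as the presentation of the fundamental group requires.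
\<close>

locale gog_potential = gog_tree \<Gamma> T for \<Gamma> :: "('v, 'e, 'a, 'c) gog" and T +
  fixes r0 :: 'v and \<tau> \<tau>i :: "'v \<Rightarrow> ('e \<times> bool \<times> 'a) list \<times> 'a \<Rightarrow> ('e \<times> bool \<times> 'a) list \<times> 'a"
  assumes r0: "r0 \<in> verts \<Gamma>"
    and \<tau>: "\<And>u \<omega>. u \<in> verts \<Gamma> \<Longrightarrow> \<omega> \<in> normal_forms r0 \<Longrightarrow> \<tau> u \<omega> \<in> normal_forms u \<and> \<tau>i u (\<tau> u \<omega>) = \<omega>"
    and \<tau>i: "\<And>u \<omega>. u \<in> verts \<Gamma> \<Longrightarrow> \<omega> \<in> normal_forms u \<Longrightarrow> \<tau>i u \<omega> \<in> normal_forms r0 \<and> \<tau> u (\<tau>i u \<omega>) = \<omega>"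
    and \<tau>_tree: "\<And>e \<omega>. e \<in> T \<Longrightarrow> \<omega> \<in> normal_forms r0 \<Longrightarrow>
       \<tau> (endpt \<Gamma> e True) \<omega> = pass e False (\<tau> (endpt \<Gamma> e False) \<omega>)"
begin

abbreviation "\<Omega> \<equiv> normal_forms r0"

text \<open>Each letter acts where it lives: \<open>\<tau>\<close> carries the normal form there
  from \<open>r0\<close> and \<open>\<tau>i\<close> brings the result back. This is a right action,
  with the first letter of a word applied first.\<close>

fun act :: "('v, 'e, 'a) pi1_gen \<times> bool \<Rightarrow> ('e \<times> bool \<times> 'a) list \<times> 'a \<Rightarrow> ('e \<times> bool \<times> 'a) list \<times> 'a" where
  "act (VGen v x, \<sigma>) \<omega> = \<tau>i v (translate v (if \<sigma> then x else inv\<^bsub>vgroup \<Gamma> v\<^esub> x) (\<tau> v \<omega>))"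
| "act (EGen e, \<sigma>) \<omega> = \<tau>i (endpt \<Gamma> e \<sigma>) (pass e (\<not> \<sigma>) (\<tau> (endpt \<Gamma> e (\<not> \<sigma>)) \<omega>))"

definition acts where "acts w \<omega> = fold act w \<omega>"

lemma acts_simps [simp]: "acts [] \<omega> = \<omega>" "acts (l # w) \<omega> = acts w (act l \<omega>)" "acts (u @ w) \<omega> = acts w (acts u \<omega>)"
  by (simp_all add: acts_def)

lemma act_closed:
  assumes "fst l \<in> X" "\<omega> \<in> \<Omega>"
  shows "act l \<omega> \<in> \<Omega>"
proof -
  obtain x \<sigma> where l: "l = (x, \<sigma>)" by (cases l)
  show ?thesis
  proof (cases x)
    case (VGen v g)
    then have v: "v \<in> verts \<Gamma>" "g \<in> carrier (vgroup \<Gamma> v)" using assms l by (auto simp: pi1_gens_def)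
    then have "(if \<sigma> then g else inv\<^bsub>vgroup \<Gamma> v\<^esub> g) \<in> carrier (vgroup \<Gamma> v)"
      using vgroup[OF v(1)] by (simp add: group.inv_closed)
    then show ?thesis using v VGen l \<tau>[OF v(1) assms(2)] translate_closed[OF v(1)] \<tau>i[OF v(1)] by simp
  next
    case (EGen e)
    then have e: "e \<in> edges \<Gamma>" using assms l by (auto simp: pi1_gens_def)
    have "pass e (\<not> \<sigma>) (\<tau> (endpt \<Gamma> e (\<not> \<sigma>)) \<omega>) \<in> normal_forms (endpt \<Gamma> e \<sigma>)"
      using pass_inverse[OF e, of _ "\<not> \<sigma>"] \<tau>[OF endpt_verts[OF e] assms(2)] by simp
    then show ?thesis using EGen l \<tau>i[OF endpt_verts[OF e]] by simp
  qed
qed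

lemma acts_closed: "w \<in> words X \<Longrightarrow> \<omega> \<in> \<Omega> \<Longrightarrow> acts w \<omega> \<in> \<Omega>"
proof (induction w arbitrary: \<omega>)
  case (Cons l w)
  then have "fst l \<in> X" "w \<in> words X" by (cases l; auto simp: words_def)+
  then show ?case using Cons act_closed by simp
qed simp

lemma act_VGen:
  assumes "v \<in> verts \<Gamma>" "g \<in> carrier (vgroup \<Gamma> v)" "\<omega> \<in> \<Omega>"
  shows "\<tau> v (act (gen (VGen v g)) \<omega>) = translate v g (\<tau> v \<omega>)"
    "\<tau> v (act (gen_inv (VGen v g)) \<omega>) = translate v (inv\<^bsub>vgroup \<Gamma> v\<^esub> g) (\<tau> v \<omega>)"
  using assms \<tau> \<tau>i translate_closed group.inv_closed[OF vgroup] by simp_all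

lemma act_EGen:
  assumes "e \<in> edges \<Gamma>" "\<omega> \<in> \<Omega>"
  shows "\<tau> (endpt \<Gamma> e \<sigma>) (act (EGen e, \<sigma>) \<omega>) = pass e (\<not> \<sigma>) (\<tau> (endpt \<Gamma> e (\<not> \<sigma>)) \<omega>)"
proof -
  have "pass e (\<not> \<sigma>) (\<tau> (endpt \<Gamma> e (\<not> \<sigma>)) \<omega>) \<in> normal_forms (endpt \<Gamma> e \<sigma>)"
    using pass_inverse[OF assms(1), of _ "\<not> \<sigma>"] \<tau>[OF endpt_verts[OF assms(1)] assms(2)] by simp
  then show ?thesis using \<tau>i[OF endpt_verts[OF assms(1)]] by simp
qed

lemma \<tau>_inj:
  assumes "v \<in> verts \<Gamma>" "\<omega> \<in> \<Omega>" "\<omega>' \<in> \<Omega>" "\<tau> v \<omega> = \<tau> v \<omega>'"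
  shows "\<omega> = \<omega>'"
  using \<tau>[OF assms(1,2)] \<tau>[OF assms(1,3)] assms(4) by metis

lemma act_cancel:
  assumes x: "x \<in> X" and \<omega>: "\<omega> \<in> \<Omega>"
  shows "act (x, \<not> \<sigma>) (act (x, \<sigma>) \<omega>) = \<omega>"
proof (cases x)
  case (VGen v g)
  then have v: "v \<in> verts \<Gamma>" "g \<in> carrier (vgroup \<Gamma> v)" using x by (auto simp: pi1_gens_def)
  interpret group "vgroup \<Gamma> v" by (rule vgroup[OF v(1)])
  have a: "act (x, \<tau>) \<omega> \<in> \<Omega>" if "\<omega> \<in> \<Omega>" for \<tau> \<omega> using act_closed x that by simp
  note \<tau>\<omega> = conjunct1[OF \<tau>[OF v(1) \<omega>]]
  have "\<tau> v (act (x, \<not> \<sigma>) (act (x, \<sigma>) \<omega>)) = \<tau> v \<omega>"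
    using act_VGen[OF v] a[OF \<omega>, of True] a[OF \<omega>, of False] \<omega> v \<tau>\<omega> VGen
    by (cases \<sigma>) (simp_all del: act.simps add: translate_translate translate_one)
  then show ?thesis using \<tau>_inj[OF v(1)] a \<omega> by blast
next
  case (EGen e)
  then have e: "e \<in> edges \<Gamma>" using x by (auto simp: pi1_gens_def)
  have a: "act (x, \<tau>) \<omega> \<in> \<Omega>" if "\<omega> \<in> \<Omega>" for \<tau> \<omega> using act_closed x that by simp
  have "\<tau> (endpt \<Gamma> e (\<not> \<sigma>)) (act (EGen e, \<not> \<sigma>) (act (EGen e, \<sigma>) \<omega>)) =
      pass e \<sigma> (pass e (\<not> \<sigma>) (\<tau> (endpt \<Gamma> e (\<not> \<sigma>)) \<omega>))"
    using act_EGen[OF e a[OF \<omega>, of \<sigma>], of "\<not> \<sigma>"] act_EGen[OF e \<omega>, of \<sigma>] EGen by (simp del: act.simps)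
  also have "\<dots> = \<tau> (endpt \<Gamma> e (\<not> \<sigma>)) \<omega>"
    using pass_inverse[OF e, of _ "\<not> \<sigma>"] \<tau>[OF endpt_verts[OF e] \<omega>] by simp
  finally show ?thesis using \<tau>_inj[OF endpt_verts[OF e]] a \<omega> EGen by blast
qed

text \<open>Multiplication tables are respected because translations compose, edge relators by
  \<open>pass_translate\<close>, and the letters of tree edges act trivially by the choice of
  \<open>\<tau>\<close>.\<close>

lemma acts_relator:
  assumes q: "q \<in> R" and \<omega>: "\<omega> \<in> \<Omega>"
  shows "acts q \<omega> = \<omega>"
proof -
  consider (mult) v x y where "v \<in> verts \<Gamma>" "x \<in> carrier (vgroup \<Gamma> v)" "y \<in> carrier (vgroup \<Gamma> v)"
      "q = [gen (VGen v x), gen (VGen v y), gen_inv (VGen v (x \<otimes>\<^bsub>vgroup \<Gamma> v\<^esub> y))]"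
    | (edge) e d where "e \<in> edges \<Gamma>" "d \<in> carrier (egroup \<Gamma> e)"
      "q = [gen (EGen e), gen (VGen (endpt \<Gamma> e True) (bdry \<Gamma> e True d)),
      gen_inv (EGen e), gen_inv (VGen (endpt \<Gamma> e False) (bdry \<Gamma> e False d))]"
    | (tree) e where "e \<in> T" "q = [gen (EGen e)]"
    using q unfolding pi1_relators_def by blast
  then show ?thesis
  proof cases
    case mult
    interpret group "vgroup \<Gamma> v" by (rule vgroup[OF mult(1)])
    let ?x = "gen (VGen v x)" and ?y = "gen (VGen v y)"
    have X: "VGen v x \<in> X" "VGen v y \<in> X" "VGen v (x \<otimes>\<^bsub>vgroup \<Gamma> v\<^esub> y) \<in> X"
      using mult by (auto simp: pi1_gens_def)
    have c: "act ?x \<omega> \<in> \<Omega>" "act ?y (act ?x \<omega>) \<in> \<Omega>" "acts q \<omega> \<in> \<Omega>"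
      using X \<omega> mult by (simp_all del: act.simps add: act_closed)
    note \<tau>\<omega> = conjunct1[OF \<tau>[OF mult(1) \<omega>]]
    have "\<tau> v (acts q \<omega>) = \<tau> v \<omega>"
      using mult c \<omega> \<tau>\<omega> by (simp del: act.simps add: act_VGen translate_translate translate_one)
    then show ?thesis using \<tau>_inj[OF mult(1)] c \<omega> by blast
  next
    case edge
    interpret P: inj_group_hom "egroup \<Gamma> e" "vgroup \<Gamma> (endpt \<Gamma> e True)" "bdry \<Gamma> e True" by (rule bdry_inj[OF edge(1)])
    interpret M: inj_group_hom "egroup \<Gamma> e" "vgroup \<Gamma> (endpt \<Gamma> e False)" "bdry \<Gamma> e False" by (rule bdry_inj[OF edge(1)])
    let ?t = "gen (EGen e)" and ?ti = "gen_inv (EGen e)" and ?p = "gen (VGen (endpt \<Gamma> e True) (bdry \<Gamma> e True d))"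
    let ?m = "gen_inv (VGen (endpt \<Gamma> e False) (bdry \<Gamma> e False d))"
    have v: "endpt \<Gamma> e True \<in> verts \<Gamma>" "endpt \<Gamma> e False \<in> verts \<Gamma>" using endpt_verts edge by auto
    have X: "EGen e \<in> X" "VGen (endpt \<Gamma> e True) (bdry \<Gamma> e True d) \<in> X" "VGen (endpt \<Gamma> e False) (bdry \<Gamma> e False d) \<in> X"
      using edge v by (auto simp: pi1_gens_def)
    have c: "act ?t \<omega> \<in> \<Omega>" "act ?p (act ?t \<omega>) \<in> \<Omega>" "act ?ti (act ?p (act ?t \<omega>)) \<in> \<Omega>"
      "acts q \<omega> \<in> \<Omega>"
      using X \<omega> edge by (simp_all del: act.simps add: act_closed)
    let ?n = "\<tau> (endpt \<Gamma> e False) \<omega>"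
    have n: "?n \<in> normal_forms (endpt \<Gamma> e False)" using \<tau>[OF v(2) \<omega>] by simp
    have pn: "pass e False ?n \<in> normal_forms (endpt \<Gamma> e True)" "pass e True (pass e False ?n) = ?n"
      using pass_inverse[OF edge(1) n] by simp_all
    have "\<tau> (endpt \<Gamma> e True) (act ?p (act ?t \<omega>)) = translate (endpt \<Gamma> e True) (bdry \<Gamma> e True d) (pass e False ?n)"
      using act_VGen(1)[OF v(1) _ c(1)] act_EGen[OF edge(1) \<omega>, of True] edge(2) by (simp del: act.simps)
    then have "\<tau> (endpt \<Gamma> e False) (act ?ti (act ?p (act ?t \<omega>))) =
        translate (endpt \<Gamma> e False) (bdry \<Gamma> e False d) ?n"
      using act_EGen[OF edge(1) c(2), of False] pass_translate[OF edge(1) pn(1) edge(2)] pn(2)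
      by (simp del: act.simps)
    then have "\<tau> (endpt \<Gamma> e False) (act ?m (act ?ti (act ?p (act ?t \<omega>)))) = ?n"
      using act_VGen(2)[OF v(2) _ c(3)] edge(2) n v(2)
      by (simp del: act.simps add: translate_translate translate_one)
    then have "\<tau> (endpt \<Gamma> e False) (acts q \<omega>) = ?n" using edge by (simp del: act.simps)
    then show ?thesis using \<tau>_inj[OF v(2)] c(4) \<omega> by blast
  next
    case tree
    then have e: "e \<in> edges \<Gamma>" using T_edges by auto
    then show ?thesis using tree \<tau>_tree[OF tree(1) \<omega>] \<tau>[OF endpt_verts[OF e] \<omega>, of True] by simp
  qed
qed

lemma acts_word_eq:
  assumes "word_eq X R u w" "\<omega> \<in> \<Omega>"
  shows "acts u \<omega> = acts w \<omega>"
  using assms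
proof (induction arbitrary: \<omega> rule: word_eq.induct)
  case (cancel u w x \<sigma>)
  then show ?case using act_cancel[OF cancel(3) acts_closed[OF cancel(1) cancel(4)]] by (simp del: act.simps)
next
  case (relator u w q)
  then show ?case using acts_relator[OF relator(3) acts_closed[OF relator(1) relator(5)]] by simp
qed auto

definition origin where "origin = \<tau>i base ([], \<one>\<^bsub>vgroup \<Gamma> base\<^esub>)"

lemma origin: "origin \<in> \<Omega>"
proof -
  interpret group "vgroup \<Gamma> base" by (rule vgroup[OF base])
  have "([], \<one>\<^bsub>vgroup \<Gamma> base\<^esub>) \<in> normal_forms base" by (simp add: normal_forms_def)
  then show ?thesis unfolding origin_def using \<tau>i[OF base] by simp
qed

definition state where
  "state g v = \<tau> v (acts (SOME w. w \<in> words X \<and> cls w = g) origin)"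

lemma state_cls:
  assumes "w \<in> words X"
  shows "state (cls w) v = \<tau> v (acts w origin)"
proof -
  define w' where "w' = (SOME w'. w' \<in> words X \<and> cls w' = cls w)"
  have "w' \<in> words X \<and> cls w' = cls w" unfolding w'_def by (rule someI[of _ w]) (simp add: assms)
  then have "word_eq X R w' w" using word_class_eq_iff by metis
  from acts_word_eq[OF this origin] show ?thesis by (simp add: state_def w'_def)
qed

lemma equivariant_state: "equivariant state"
proof -
  have carr: "\<exists>w\<in>words X. g = cls w" if "g \<in> carrier G" for g
    using that unfolding pi1_presented by (auto simp: presented_group_def)
  have mult: "cls u \<cdot> cls w = cls (u @ w)" if "u \<in> words X" "w \<in> words X" for u w
    using that unfolding pi1_presented by (rule presented_group_mult)
  have "\<forall>g\<in>carrier G. \<forall>v\<in>verts \<Gamma>. state g v \<in> normal_forms v"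
    using carr state_cls acts_closed[OF _ origin] \<tau> by fastforce
  moreover have "\<forall>g\<in>carrier G. \<forall>v\<in>verts \<Gamma>. \<forall>x\<in>carrier (vgroup \<Gamma> v). state (g \<cdot> \<iota> v x) v = translate v x (state g v)"
  proof (intro ballI)
    fix g v x assume g: "g \<in> carrier G" and v: "v \<in> verts \<Gamma>" "x \<in> carrier (vgroup \<Gamma> v)"
    from carr[OF g] obtain w where w: "w \<in> words X" "g = cls w" by blast
    have l: "[gen (VGen v x)] \<in> words X" using v by (auto simp: words_def pi1_gens_def)
    show "state (g \<cdot> \<iota> v x) v = translate v x (state g v)"
      using w l mult[OF w(1) l] state_cls[of "w @ [gen (VGen v x)]" v] state_cls[OF w(1), of v]
        act_VGen(1)[OF v acts_closed[OF w(1) origin]] by (simp del: act.simps)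
  qed
  moreover have "\<forall>g\<in>carrier G. \<forall>e\<in>edges \<Gamma>. \<forall>s. state (g \<cdot> stable e s) (endpt \<Gamma> e (\<not> s)) = pass e s (state g (endpt \<Gamma> e s))"
  proof (intro ballI allI)
    fix g e s assume g: "g \<in> carrier G" and e: "e \<in> edges \<Gamma>"
    from carr[OF g] obtain w where w: "w \<in> words X" "g = cls w" by blast
    have l: "[(EGen e, \<not> s)] \<in> words X" using e by (auto simp: words_def pi1_gens_def)
    show "state (g \<cdot> stable e s) (endpt \<Gamma> e (\<not> s)) = pass e s (state g (endpt \<Gamma> e s))"
      using w l mult[OF w(1) l] state_cls[of "w @ [(EGen e, \<not> s)]"] state_cls[OF w(1)]
        act_EGen[OF e acts_closed[OF w(1) origin], of "\<not> s"] by (simp del: act.simps)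
  qed
  ultimately show ?thesis unfolding equivariant_def by blast
qed

end

context gog_tree
begin

lemma state_exists:
  "\<exists>state. equivariant state"
proof -
  from potential_exists obtain r0 \<tau> \<tau>i where *: "r0 \<in> verts \<Gamma>"
    "\<forall>u\<in>verts \<Gamma>. (\<forall>\<omega>\<in>normal_forms r0. \<tau> u \<omega> \<in> normal_forms u \<and> \<tau>i u (\<tau> u \<omega>) = \<omega>) \<and>
      (\<forall>\<omega>\<in>normal_forms u. \<tau>i u \<omega> \<in> normal_forms r0 \<and> \<tau> u (\<tau>i u \<omega>) = \<omega>)"
    "\<forall>e\<in>T. \<forall>\<omega>\<in>normal_forms r0. \<tau> (endpt \<Gamma> e True) \<omega> = pass e False (\<tau> (endpt \<Gamma> e False) \<omega>)"
    by (elim exE conjE) blast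
  interpret gog_potential \<Gamma> T r0 \<tau> \<tau>i
    by unfold_locales (use * in auto)
  show ?thesis using equivariant_state by blast
qed

end

section \<open>Surface groups as quadratic presentations, and pullback along injective
  homomorphisms\<close>

lemma surface_gens_eq:
  "surface_gens ot g m = (GenA ` {..<g} \<union> (if ot then GenB ` {..<g} else {})) \<union> GenP ` {..<m}"
  by (simp add: surface_gens_def)

lemma surface_another_crossing_line:
  assumes A: "almost_invariant (surface_group ot g m) A"
    and inf: "\<And>k. k < m \<Longrightarrow> infinite_order (surface_group ot g m) (boundary_class ot g m k)"
    and k0: "k0 < m" "h0 \<in> carrier (surface_group ot g m)"
      "crosses (surface_group ot g m) A h0 (boundary_class ot g m k0)"
  shows "\<exists>k<m. \<exists>h\<in>carrier (surface_group ot g m). crosses (surface_group ot g m) A h (boundary_class ot g m k) \<and>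
    (k = k0 \<longrightarrow> h \<notin> range (\<lambda>j::int. h0 \<otimes>\<^bsub>surface_group ot g m\<^esub>
       boundary_class ot g m k0 [^]\<^bsub>surface_group ot g m\<^esub> j))"
proof -
  interpret quadratic_presentation "surface_relator ot g m"
    "GenA ` {..<g} \<union> (if ot then GenB ` {..<g} else {})" "GenP ` {..<m}"
    by unfold_locales (rule quadratic_surface_relator)
  have H: "H = surface_group ot g m" by (simp add: surface_group_def surface_gens_eq)
  have c: "c (GenP k) = boundary_class ot g m k" for k by (simp add: boundary_class_def surface_gens_eq)
  from another_crossing_line[unfolded H, of A "GenP k0" h0] A inf k0
  show ?thesis by (fastforce simp: c)
qed

lemma surface_almost_constant:
  assumes A: "almost_invariant (surface_group ot g m) A"
    and inf: "\<And>k. k < m \<Longrightarrow> infinite_order (surface_group ot g m) (boundary_class ot g m k)"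
    and nc: "\<And>k h. k < m \<Longrightarrow> h \<in> carrier (surface_group ot g m) \<Longrightarrow>
      \<not> crosses (surface_group ot g m) A h (boundary_class ot g m k)"
  shows "\<exists>b. finite {h \<in> carrier (surface_group ot g m). A h \<noteq> b}"
proof -
  interpret quadratic_presentation "surface_relator ot g m"
    "GenA ` {..<g} \<union> (if ot then GenB ` {..<g} else {})" "GenP ` {..<m}"
    by unfold_locales (rule quadratic_surface_relator)
  have H: "H = surface_group ot g m" by (simp add: surface_group_def surface_gens_eq)
  have c: "c (GenP k) = boundary_class ot g m k" for k by (simp add: boundary_class_def surface_gens_eq)
  show ?thesis
  proof (rule almost_constant_if_no_crossing[unfolded H, OF A])
    fix x assume "x \<in> GenP ` {..<m}"
    then obtain k where k: "k < m" "x = GenP k" by auto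
    show "infinite_order (surface_group ot g m) (c x)" unfolding k(2) c using inf k(1) .
    show "\<not> crosses (surface_group ot g m) A h (c x)" if "h \<in> carrier (surface_group ot g m)" for h
      unfolding k(2) c using nc k(1) that .
  qed
qed

lemma infinite_cyclic_generator:
  assumes "group K" "infinite_cyclic K"
  obtains z where "infinite_order K z" "carrier K = range (\<lambda>k::int. z [^]\<^bsub>K\<^esub> k)"
proof -
  interpret group K by (rule assms)
  from assms(2) have "integer_group \<cong> K" by (simp add: infinite_cyclic_def iso_sym)
  then obtain f where f: "f \<in> iso integer_group K" by (auto simp: is_iso_def)
  then have fh: "f \<in> hom integer_group K" and b: "bij_betw f UNIV (carrier K)" by (auto simp: iso_def)
  have p: "f k = f 1 [^]\<^bsub>K\<^esub> k" for k :: int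
    using hom_int_pow[OF fh _ group_integer_group assms(1), of 1 k] by simp
  have "f 1 \<in> carrier K" using b by (auto simp: bij_betw_def)
  moreover have "inj (\<lambda>k::int. f 1 [^]\<^bsub>K\<^esub> k)" using b by (simp add: bij_betw_def p[symmetric])
  moreover have "carrier K = range (\<lambda>k::int. f 1 [^]\<^bsub>K\<^esub> k)" using b by (simp add: bij_betw_def p[symmetric])
  ultimately show ?thesis by (intro that[of "f 1"]) (auto simp: infinite_order_def)
qed

lemma inj_group_hom_infinite_order:
  assumes "inj_group_hom C G f" "z \<in> carrier C"
  shows "infinite_order G (f z) \<longleftrightarrow> infinite_order C z"
proof -
  interpret inj_group_hom C G f by (rule assms)
  have "f z [^]\<^bsub>G\<^esub> k = f (z [^]\<^bsub>C\<^esub> k)" for k :: int using assms(2) by (simp add: hom_int_pow)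
  then show ?thesis using assms(2) inj_on_eq_iff[OF inj] by (auto simp: infinite_order_def inj_def)
qed

text \<open>Left translation by \<open>g\<close> commutes with right translations, so the changes
  along the coset of \<open>g\<close> inject into the changes of \<open>A\<close>.\<close>

lemma almost_invariant_pullback:
  assumes f: "inj_group_hom C G f" and A: "almost_invariant G A" and g: "g \<in> carrier G"
  shows "almost_invariant C (\<lambda>h. A (g \<otimes>\<^bsub>G\<^esub> f h))"
  unfolding almost_invariant_def
proof
  interpret inj_group_hom C G f by (rule f)
  fix k assume k: "k \<in> carrier C"
  show "finite {x \<in> carrier C. A (g \<otimes>\<^bsub>G\<^esub> f (x \<otimes>\<^bsub>C\<^esub> k)) \<noteq> A (g \<otimes>\<^bsub>G\<^esub> f x)}"
  proof (rule finite_imageD)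
    have "finite {x \<in> carrier G. A (x \<otimes>\<^bsub>G\<^esub> f k) \<noteq> A x}" using A k by (simp add: almost_invariant_def)
    then show "finite ((\<lambda>x. g \<otimes>\<^bsub>G\<^esub> f x) ` {x \<in> carrier C. A (g \<otimes>\<^bsub>G\<^esub> f (x \<otimes>\<^bsub>C\<^esub> k)) \<noteq> A (g \<otimes>\<^bsub>G\<^esub> f x)})"
      by (rule rev_finite_subset) (use g k in \<open>auto simp: H.m_assoc\<close>)
    show "inj_on (\<lambda>x. g \<otimes>\<^bsub>G\<^esub> f x) {x \<in> carrier C. A (g \<otimes>\<^bsub>G\<^esub> f (x \<otimes>\<^bsub>C\<^esub> k)) \<noteq> A (g \<otimes>\<^bsub>G\<^esub> f x)}"
      using g inj by (auto simp: inj_on_def)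
  qed
qed

lemma crosses_pullback:
  assumes f: "inj_group_hom C G f" and g: "g \<in> carrier G" "h \<in> carrier C" "z \<in> carrier C"
  shows "crosses C (\<lambda>h. A (g \<otimes>\<^bsub>G\<^esub> f h)) h z \<longleftrightarrow> crosses G A (g \<otimes>\<^bsub>G\<^esub> f h) (f z)"
proof -
  interpret inj_group_hom C G f by (rule f)
  have "g \<otimes>\<^bsub>G\<^esub> f (h \<otimes>\<^bsub>C\<^esub> z [^]\<^bsub>C\<^esub> k) = g \<otimes>\<^bsub>G\<^esub> f h \<otimes>\<^bsub>G\<^esub> f z [^]\<^bsub>G\<^esub> k" for k :: int
    using g by (simp add: hom_int_pow H.m_assoc)
  then show ?thesis by (simp add: crosses_def)
qed

section \<open>Vertex groups, stable letters and heights in the fundamental group\<close>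

context gog_tree
begin

lemma \<iota>_closed: "v \<in> verts \<Gamma> \<Longrightarrow> x \<in> carrier (vgroup \<Gamma> v) \<Longrightarrow> \<iota> v x \<in> carrier G"
  by (auto simp: pi1_presented presented_group_def words_def pi1_gens_def)

lemma stable_closed: "e \<in> edges \<Gamma> \<Longrightarrow> stable e s \<in> carrier G"
  by (auto simp: pi1_presented presented_group_def words_def pi1_gens_def)

lemma cls_append: "u \<in> words X \<Longrightarrow> w \<in> words X \<Longrightarrow> cls (u @ w) = cls u \<cdot> cls w"
  by (simp add: pi1_presented presented_group_mult)

lemma cls_gen_inv: "x \<in> X \<Longrightarrow> cls [gen_inv x] = inv\<^bsub>G\<^esub> cls [gen x]"
  using word_class_inverse[of x X R True] by (simp add: pi1_presented)

lemma cls_relator: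
  assumes "q \<in> R" "q \<in> words X" shows "cls q = \<one>\<^bsub>G\<^esub>"
proof -
  have "word_eq X R ([] @ q @ []) ([] @ [])" by (rule word_eq.relator) (use assms in auto)
  then have "cls q = cls []" using word_class_eq_iff[OF assms(2)] by simp
  then show ?thesis by (simp add: pi1_presented presented_group_def)
qed

lemma \<iota>_hom:
  assumes v: "v \<in> verts \<Gamma>"
  shows "\<iota> v \<in> hom (vgroup \<Gamma> v) G"
proof (rule homI)
  interpret group "vgroup \<Gamma> v" by (rule vgroup[OF v])
  show "\<iota> v x \<in> carrier G" if "x \<in> carrier (vgroup \<Gamma> v)" for x using \<iota>_closed[OF v that] .
  fix x y assume xy: "x \<in> carrier (vgroup \<Gamma> v)" "y \<in> carrier (vgroup \<Gamma> v)"
  let ?q = "[gen (VGen v x), gen (VGen v y), gen_inv (VGen v (x \<otimes>\<^bsub>vgroup \<Gamma> v\<^esub> y))]"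
  have X: "VGen v x \<in> X" "VGen v y \<in> X" "VGen v (x \<otimes>\<^bsub>vgroup \<Gamma> v\<^esub> y) \<in> X"
    using v xy by (auto simp: pi1_gens_def)
  have w: "[(z, \<sigma>)] \<in> words X" if "z \<in> X" for z \<sigma> using that by (simp add: words_def)
  have "cls ?q = \<iota> v x \<cdot> (\<iota> v y \<cdot> inv\<^bsub>G\<^esub> \<iota> v (x \<otimes>\<^bsub>vgroup \<Gamma> v\<^esub> y))"
    using cls_append[of "[gen (VGen v x)]" "[gen (VGen v y)] @ [gen_inv (VGen v (x \<otimes>\<^bsub>vgroup \<Gamma> v\<^esub> y))]"]
      cls_append[of "[gen (VGen v y)]" "[gen_inv (VGen v (x \<otimes>\<^bsub>vgroup \<Gamma> v\<^esub> y))]"] w X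
    by (simp add: cls_gen_inv words_Cons_iff)
  moreover have "cls ?q = \<one>\<^bsub>G\<^esub>"
  proof (rule cls_relator)
    show "?q \<in> R" using v xy unfolding pi1_relators_def by blast
    show "?q \<in> words X" using X by (simp add: words_def)
  qed
  ultimately have e: "\<iota> v x \<cdot> \<iota> v y \<cdot> inv\<^bsub>G\<^esub> \<iota> v (x \<otimes>\<^bsub>vgroup \<Gamma> v\<^esub> y) = \<one>\<^bsub>G\<^esub>"
    using \<iota>_closed[OF v] xy by (simp add: G.m_assoc)
  then show "\<iota> v (x \<otimes>\<^bsub>vgroup \<Gamma> v\<^esub> y) = \<iota> v x \<cdot> \<iota> v y"
    using \<iota>_closed[OF v] xy G.inv_equality[OF e] by (metis G.inv_closed G.inv_inv G.m_closed m_closed)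
qed

lemma stable_inverse: "e \<in> edges \<Gamma> \<Longrightarrow> stable e (\<not> s) = inv\<^bsub>G\<^esub> stable e s"
  using word_class_inverse[of "EGen e" X R "\<not> s"] by (simp add: pi1_presented pi1_gens_def)

lemma stable_tree:
  assumes "e \<in> T" shows "stable e s = \<one>\<^bsub>G\<^esub>"
proof -
  have e: "e \<in> edges \<Gamma>" using assms T_edges by auto
  have "cls [gen (EGen e)] = \<one>\<^bsub>G\<^esub>"
    by (rule cls_relator) (use assms e in \<open>auto simp: pi1_relators_def words_def pi1_gens_def\<close>)
  then show ?thesis using stable_inverse[OF e, of False] by (cases s) auto
qed

lemma edge_relation:
  assumes e: "e \<in> edges \<Gamma>" and d: "d \<in> carrier (egroup \<Gamma> e)"
  shows "\<iota> (endpt \<Gamma> e s) (bdry \<Gamma> e s d) \<cdot> stable e s = stable e s \<cdot> \<iota> (endpt \<Gamma> e (\<not> s)) (bdry \<Gamma> e (\<not> s) d)"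
proof -
  interpret P: inj_group_hom "egroup \<Gamma> e" "vgroup \<Gamma> (endpt \<Gamma> e True)" "bdry \<Gamma> e True" by (rule bdry_inj[OF e])
  interpret M: inj_group_hom "egroup \<Gamma> e" "vgroup \<Gamma> (endpt \<Gamma> e False)" "bdry \<Gamma> e False" by (rule bdry_inj[OF e])
  let ?P = "VGen (endpt \<Gamma> e True) (bdry \<Gamma> e True d)" and ?M = "VGen (endpt \<Gamma> e False) (bdry \<Gamma> e False d)"
  let ?p = "cls [gen ?P]" and ?m = "cls [gen ?M]" and ?t = "cls [gen (EGen e)]"
  let ?q = "[gen (EGen e), gen ?P, gen_inv (EGen e), gen_inv ?M]"
  have X: "EGen e \<in> X" "?P \<in> X" "?M \<in> X" using e d endpt_verts[OF e] by (auto simp: pi1_gens_def)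
  have w: "[(z, \<sigma>)] \<in> words X" if "z \<in> X" for z \<sigma> using that by (simp add: words_def)
  have c: "?p \<in> carrier G" "?m \<in> carrier G" "?t \<in> carrier G"
    using \<iota>_closed endpt_verts[OF e] d stable_closed[OF e, of False] by auto
  have "cls ?q = ?t \<cdot> (?p \<cdot> (inv\<^bsub>G\<^esub> ?t \<cdot> inv\<^bsub>G\<^esub> ?m))"
    using cls_append[of "[gen (EGen e)]" "[gen ?P] @ [gen_inv (EGen e)] @ [gen_inv ?M]"]
      cls_append[of "[gen ?P]" "[gen_inv (EGen e)] @ [gen_inv ?M]"]
      cls_append[of "[gen_inv (EGen e)]" "[gen_inv ?M]"] w X
    by (simp add: cls_gen_inv words_Cons_iff)
  moreover have "cls ?q = \<one>\<^bsub>G\<^esub>"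
  proof (rule cls_relator)
    show "?q \<in> R" using e d unfolding pi1_relators_def by blast
    show "?q \<in> words X" using X by (simp add: words_def)
  qed
  ultimately have rel: "?t \<cdot> ?p \<cdot> inv\<^bsub>G\<^esub> ?t \<cdot> inv\<^bsub>G\<^esub> ?m = \<one>\<^bsub>G\<^esub>"
    using c by (simp add: G.m_assoc)
  have "?t \<cdot> ?p \<cdot> inv\<^bsub>G\<^esub> ?t = ?m"
    using G.inv_equality[OF rel] c by (metis G.inv_closed G.inv_inv G.m_closed)
  then have f: "?t \<cdot> ?p = ?m \<cdot> ?t" using c by (metis G.inv_solve_right' G.m_closed)
  have t: "stable e False = ?t" "stable e True = inv\<^bsub>G\<^esub> ?t"
    using stable_inverse[OF e, of False] by simp_all
  have "?p \<cdot> inv\<^bsub>G\<^esub> ?t = inv\<^bsub>G\<^esub> ?t \<cdot> (?t \<cdot> ?p) \<cdot> inv\<^bsub>G\<^esub> ?t"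
    using c by (simp add: G.m_assoc[symmetric])
  also have "\<dots> = inv\<^bsub>G\<^esub> ?t \<cdot> ?m" unfolding f using c by (simp add: G.m_assoc)
  finally show ?thesis using f t by (cases s) auto
qed

definition state where
  "state = (SOME state. equivariant state)"

lemma state:
  "g \<in> carrier G \<Longrightarrow> v \<in> verts \<Gamma> \<Longrightarrow> state g v \<in> normal_forms v"
  "g \<in> carrier G \<Longrightarrow> v \<in> verts \<Gamma> \<Longrightarrow> x \<in> carrier (vgroup \<Gamma> v) \<Longrightarrow>
     state (g \<cdot> \<iota> v x) v = translate v x (state g v)"
  "g \<in> carrier G \<Longrightarrow> e \<in> edges \<Gamma> \<Longrightarrow>
     state (g \<cdot> stable e s) (endpt \<Gamma> e (\<not> s)) = pass e s (state g (endpt \<Gamma> e s))"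
  using someI_ex[OF state_exists, folded state_def] unfolding equivariant_def by blast+

text \<open>Right multiplication by \<open>\<iota> v x\<close> translates the normal form at
  \<open>v\<close> by \<open>x\<close>, so \<open>x\<close> can be recovered from its image.\<close>

lemma \<iota>_inj_hom:
  assumes v: "v \<in> verts \<Gamma>"
  shows "inj_group_hom (vgroup \<Gamma> v) G (\<iota> v)"
proof -
  interpret V: group "vgroup \<Gamma> v" by (rule vgroup[OF v])
  have "inj_on (\<iota> v) (carrier (vgroup \<Gamma> v))"
  proof (rule inj_onI)
    fix x y assume xy: "x \<in> carrier (vgroup \<Gamma> v)" "y \<in> carrier (vgroup \<Gamma> v)" "\<iota> v x = \<iota> v y"
    then have "translate v x (state \<one>\<^bsub>G\<^esub> v) = translate v y (state \<one>\<^bsub>G\<^esub> v)"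
      using state(2)[of "\<one>\<^bsub>G\<^esub>" v, OF _ v] by (metis G.one_closed)
    moreover have "snd (state \<one>\<^bsub>G\<^esub> v) \<in> carrier (vgroup \<Gamma> v)"
      using state(1)[of "\<one>\<^bsub>G\<^esub>" v, OF _ v] by (auto simp: normal_forms_def)
    ultimately show "x = y" using xy by (simp add: translate_def)
  qed
  then show ?thesis using \<iota>_hom[OF v]
    by (simp add: inj_group_hom_def inj_group_hom_axioms_def group_hom_def group_hom_axioms_def V.is_group G.is_group)
qed

text \<open>The distance of the tree vertex \<open>g G\<^sub>v\<close> from the base vertex of the Bass-Serre tree.\<close>

definition height where "height v g = length (fst (state g v))"

lemma height_translate:
  "g \<in> carrier G \<Longrightarrow> v \<in> verts \<Gamma> \<Longrightarrow> x \<in> carrier (vgroup \<Gamma> v) \<Longrightarrow> height v (g \<cdot> \<iota> v x) = height v g"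
  by (simp add: height_def state translate_def)

lemma height_neq:
  assumes "g \<in> carrier G" "e \<in> edges \<Gamma>"
  shows "height (endpt \<Gamma> e (\<not> s)) (g \<cdot> stable e s) \<noteq> height (endpt \<Gamma> e s) g"
  using length_pass[OF assms(2) state(1)[OF assms(1) endpt_verts[OF assms(2)]], of s]
  by (auto simp: height_def state(3)[OF assms])

text \<open>Passing an edge lowers the height only by removing the head of the stack, and this head
  fixes the edge and its direction. Both \<open>y\<close> and \<open>y x\<close> then lie in the
  image of the edge group, hence so does \<open>x\<close>: the two descents use the same edge of the
  tree.\<close>

lemma unique_descent:
  assumes g: "g \<in> carrier G" and e: "e \<in> edges \<Gamma>" "e' \<in> edges \<Gamma>"
    and v: "endpt \<Gamma> e s = v" "endpt \<Gamma> e' s' = v" and x: "x \<in> carrier (vgroup \<Gamma> v)"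
    and d: "height (endpt \<Gamma> e (\<not> s)) (g \<cdot> stable e s) < height v g"
    and d': "height (endpt \<Gamma> e' (\<not> s')) (g \<cdot> \<iota> v x \<cdot> stable e' s') < height v g"
  shows "e' = e" "s' = s" "x \<in> bdry \<Gamma> e s ` carrier (egroup \<Gamma> e)"
proof -
  have vV: "v \<in> verts \<Gamma>" using endpt_verts[OF e(1)] v(1) by blast
  interpret A: inj_group_hom "egroup \<Gamma> e" "vgroup \<Gamma> (endpt \<Gamma> e s)" "bdry \<Gamma> e s" by (rule bdry_inj[OF e(1)])
  have gx: "g \<cdot> \<iota> v x \<in> carrier G" using g \<iota>_closed[OF vV x] by simp
  obtain L y where st: "state g v = (L, y)" "y \<in> carrier (vgroup \<Gamma> v)"
    using state(1)[OF g vV] by (auto simp: normal_forms_def)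
  have st': "state (g \<cdot> \<iota> v x) v = (L, y \<otimes>\<^bsub>vgroup \<Gamma> v\<^esub> x)"
    using state(2)[OF g vV x] st by (simp add: translate_def)
  have 1: "fst (hd L) = e \<and> fst (snd (hd L)) = (\<not> s) \<and> y \<in> bdry \<Gamma> e s ` carrier (egroup \<Gamma> e)"
    using length_pass[OF e(1) state(1)[OF g endpt_verts[OF e(1)]], of s] d st
    by (auto simp: height_def state(3)[OF g e(1)] v)
  have 2: "fst (hd L) = e' \<and> fst (snd (hd L)) = (\<not> s') \<and> y \<otimes>\<^bsub>vgroup \<Gamma> v\<^esub> x \<in> bdry \<Gamma> e' s' ` carrier (egroup \<Gamma> e')"
    using length_pass[OF e(2) state(1)[OF gx endpt_verts[OF e(2)]], of s'] d' st st'
    by (auto simp: height_def state(3)[OF gx e(2)] v)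
  show "e' = e" "s' = s" using 1 2 by auto
  with 1 2 obtain c c' where c: "c \<in> carrier (egroup \<Gamma> e)" "c' \<in> carrier (egroup \<Gamma> e)"
    "y = bdry \<Gamma> e s c" "y \<otimes>\<^bsub>vgroup \<Gamma> v\<^esub> x = bdry \<Gamma> e s c'" by auto
  have "bdry \<Gamma> e s (inv\<^bsub>egroup \<Gamma> e\<^esub> c \<otimes>\<^bsub>egroup \<Gamma> e\<^esub> c') = inv\<^bsub>vgroup \<Gamma> v\<^esub> y \<otimes>\<^bsub>vgroup \<Gamma> v\<^esub> (y \<otimes>\<^bsub>vgroup \<Gamma> v\<^esub> x)"
    using c v by simp
  also have "\<dots> = x" using st(2) x v A.H.m_assoc[symmetric] by (metis A.H.inv_closed A.H.l_inv A.H.l_one)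
  finally show "x \<in> bdry \<Gamma> e s ` carrier (egroup \<Gamma> e)" using c by (metis A.G.inv_closed A.G.m_closed imageI)
qed

end

section \<open>Reduced QBS graphs\<close>

lemma (in group) almost_constant_line:
  assumes A: "almost_invariant G A" and z: "infinite_order G z" and g: "g \<in> carrier G"
    and nc: "\<not> crosses G A g z"
  shows "\<exists>b. finite {k::int. A (g \<otimes> z [^] k) \<noteq> b}"
proof -
  obtain K :: int where K: "K > 0" "\<And>k. k \<ge> K \<Longrightarrow> A (g \<otimes> z [^] k) = A (g \<otimes> z [^] K)"
    "\<And>k. k \<ge> K \<Longrightarrow> A (g \<otimes> z [^] (- k)) = A (g \<otimes> z [^] (- K))"
    using line_limits[OF A z g] by metis
  have "crosses G A g z \<longleftrightarrow> A (g \<otimes> z [^] K) \<noteq> A (g \<otimes> z [^] (- K))"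
    by (rule crosses_iff[of K]) (use K(2,3) in blast)
  then have e: "A (g \<otimes> z [^] K) = A (g \<otimes> z [^] (- K))" using nc by simp
  have "{k::int. A (g \<otimes> z [^] k) \<noteq> A (g \<otimes> z [^] K)} \<subseteq> {-K..K}"
  proof
    fix k assume k: "k \<in> {k::int. A (g \<otimes> z [^] k) \<noteq> A (g \<otimes> z [^] K)}"
    show "k \<in> {-K..K}"
    proof (rule ccontr)
      assume "k \<notin> {-K..K}"
      then consider "k \<ge> K" | "- k \<ge> K" by force
      then show False using k K(2)[of k] K(3)[of "- k"] e by cases auto
    qed
  qed
  then show ?thesis using finite_subset by blast
qed

lemma QH_vertexE:
  assumes "QH_vertex \<Gamma> v"
  obtains ot g m \<phi> \<epsilon> where "\<phi> \<in> iso (surface_group ot g m) (vgroup \<Gamma> v)"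
    "bij_betw \<epsilon> {..<m} (edges_from \<Gamma> v)"
    "\<And>k. k < m \<Longrightarrow> bdry \<Gamma> (fst (\<epsilon> k)) (snd (\<epsilon> k)) ` carrier (egroup \<Gamma> (fst (\<epsilon> k)))
      \<subseteq> generate (vgroup \<Gamma> v) {\<phi> (boundary_class ot g m k)}"
proof -
  from assms obtain ot g m \<phi> \<epsilon> where 1: "\<phi> \<in> iso (surface_group ot g m) (vgroup \<Gamma> v)"
    and 2: "bij_betw \<epsilon> {..<m} (edges_from \<Gamma> v)"
    and 3: "\<forall>k<m. \<forall>e s. \<epsilon> k = (e, s) \<longrightarrow> bdry \<Gamma> e s ` carrier (egroup \<Gamma> e)
            \<subseteq> generate (vgroup \<Gamma> v) {\<phi> (boundary_class ot g m k)}"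
    unfolding QH_vertex_def by blast
  from 3 have "bdry \<Gamma> (fst (\<epsilon> k)) (snd (\<epsilon> k)) ` carrier (egroup \<Gamma> (fst (\<epsilon> k)))
      \<subseteq> generate (vgroup \<Gamma> v) {\<phi> (boundary_class ot g m k)}" if "k < m" for k
    using that by (metis prod.collapse)
  with 1 2 show ?thesis by (rule that)
qed

lemma boundary_class_closed:
  assumes "k < m"
  shows "boundary_class ot g m k \<in> carrier (surface_group ot g m)"
proof -
  have "[gen (GenP k)] \<in> words (surface_gens ot g m)" using assms by (simp add: words_def surface_gens_def)
  then show ?thesis by (simp add: boundary_class_def surface_group_def presented_group_def)
qed

locale reduced_QBS = gog_tree \<Gamma> T for \<Gamma> :: "('v, 'e, 'a, 'c) gog" and T +
  assumes qbs: "QBS_graph \<Gamma>" and reduced: "reduced_gog \<Gamma>" and finite_verts: "finite (verts \<Gamma>)"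
begin

definition edge_gen :: "'e \<Rightarrow> 'c" where
  "edge_gen e = (SOME c. infinite_order (egroup \<Gamma> e) c \<and> carrier (egroup \<Gamma> e) = range (\<lambda>k::int. c [^]\<^bsub>egroup \<Gamma> e\<^esub> k))"

lemma edge_gen:
  assumes "e \<in> edges \<Gamma>"
  shows "infinite_order (egroup \<Gamma> e) (edge_gen e)" "edge_gen e \<in> carrier (egroup \<Gamma> e)"
    "carrier (egroup \<Gamma> e) = range (\<lambda>k::int. edge_gen e [^]\<^bsub>egroup \<Gamma> e\<^esub> k)"
proof -
  have "group (egroup \<Gamma> e)" "infinite_cyclic (egroup \<Gamma> e)"
    using gog qbs assms by (auto simp: graph_of_groups_def QBS_graph_def)
  then have "\<exists>c. infinite_order (egroup \<Gamma> e) c \<and> carrier (egroup \<Gamma> e) = range (\<lambda>k::int. c [^]\<^bsub>egroup \<Gamma> e\<^esub> k)"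
    by (rule infinite_cyclic_generator) blast
  then have *: "infinite_order (egroup \<Gamma> e) (edge_gen e) \<and>
    carrier (egroup \<Gamma> e) = range (\<lambda>k::int. edge_gen e [^]\<^bsub>egroup \<Gamma> e\<^esub> k)"
    unfolding edge_gen_def by (rule someI_ex)
  then show "infinite_order (egroup \<Gamma> e) (edge_gen e)"
    "carrier (egroup \<Gamma> e) = range (\<lambda>k::int. edge_gen e [^]\<^bsub>egroup \<Gamma> e\<^esub> k)" by auto
  then show "edge_gen e \<in> carrier (egroup \<Gamma> e)" by (simp add: infinite_order_def)
qed

abbreviation end_gen :: "'e \<Rightarrow> bool \<Rightarrow> 'a" where
  "end_gen e s \<equiv> bdry \<Gamma> e s (edge_gen e)"

text \<open>The coset of \<open>g\<close> modulo the powers of \<open>axis e s\<close> is an edge of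
  the Bass-Serre tree at the vertex of \<open>g\<close>. Its other end is reached by right
  multiplication with \<open>stable e s\<close>.\<close>

abbreviation axis where
  "axis e s \<equiv> \<iota> (endpt \<Gamma> e s) (end_gen e s)"

lemma end_gen_closed: "e \<in> edges \<Gamma> \<Longrightarrow> end_gen e s \<in> carrier (vgroup \<Gamma> (endpt \<Gamma> e s))"
proof -
  assume e: "e \<in> edges \<Gamma>"
  interpret A: inj_group_hom "egroup \<Gamma> e" "vgroup \<Gamma> (endpt \<Gamma> e s)" "bdry \<Gamma> e s" by (rule bdry_inj[OF e])
  show ?thesis using edge_gen(2)[OF e] by simp
qed

lemma axis_infinite_order:
  assumes e: "e \<in> edges \<Gamma>"
  shows "infinite_order (vgroup \<Gamma> (endpt \<Gamma> e s)) (end_gen e s)" "infinite_order G (axis e s)"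
proof -
  show 1: "infinite_order (vgroup \<Gamma> (endpt \<Gamma> e s)) (end_gen e s)"
    using inj_group_hom_infinite_order[OF bdry_inj[OF e] edge_gen(2)[OF e]] edge_gen(1)[OF e] by simp
  show "infinite_order G (axis e s)"
    using inj_group_hom_infinite_order[OF \<iota>_inj_hom[OF endpt_verts[OF e]] end_gen_closed[OF e]] 1 by simp
qed

lemma axis_pow:
  assumes e: "e \<in> edges \<Gamma>"
  shows "axis e s [^]\<^bsub>G\<^esub> (k::int) = \<iota> (endpt \<Gamma> e s) (end_gen e s [^]\<^bsub>vgroup \<Gamma> (endpt \<Gamma> e s)\<^esub> k)"
    "end_gen e s [^]\<^bsub>vgroup \<Gamma> (endpt \<Gamma> e s)\<^esub> k \<in> carrier (vgroup \<Gamma> (endpt \<Gamma> e s))"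
proof -
  interpret inj_group_hom "vgroup \<Gamma> (endpt \<Gamma> e s)" G "\<iota> (endpt \<Gamma> e s)"
    by (rule \<iota>_inj_hom[OF endpt_verts[OF e]])
  show "axis e s [^]\<^bsub>G\<^esub> (k::int) = \<iota> (endpt \<Gamma> e s) (end_gen e s [^]\<^bsub>vgroup \<Gamma> (endpt \<Gamma> e s)\<^esub> k)"
    "end_gen e s [^]\<^bsub>vgroup \<Gamma> (endpt \<Gamma> e s)\<^esub> k \<in> carrier (vgroup \<Gamma> (endpt \<Gamma> e s))"
    using end_gen_closed[OF e] by (simp_all add: hom_int_pow)
qed

lemma axis_edge:
  assumes A: "almost_invariant G A" and g: "g \<in> carrier G" and e: "e \<in> edges \<Gamma>"
  shows "crosses G A (g \<cdot> stable e s) (axis e (\<not> s)) \<longleftrightarrow> crosses G A g (axis e s)"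
  by (rule G.crosses_translate(2)[OF A axis_infinite_order(2)[OF e] g stable_closed[OF e]
        \<iota>_closed[OF endpt_verts[OF e] end_gen_closed[OF e]] edge_relation[OF e edge_gen(2)[OF e]]])

text \<open>That boundary classes have infinite order is not part of the definition of a QH vertex.
  It follows since a power of the class is the injective image of an edge generator. That power is
  nonzero, so the lines of the class and of the axis cross together.\<close>

lemma QH_axes:
  assumes v: "v \<in> verts \<Gamma>" and QH: "QH_vertex \<Gamma> v"
  obtains ot g m \<phi> \<epsilon> where "\<phi> \<in> iso (surface_group ot g m) (vgroup \<Gamma> v)"
    "inj_group_hom (surface_group ot g m) G (\<lambda>h. \<iota> v (\<phi> h))"
    "bij_betw \<epsilon> {..<m} (edges_from \<Gamma> v)"
    "\<And>k. k < m \<Longrightarrow> infinite_order (surface_group ot g m) (boundary_class ot g m k)"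
    "\<And>k. k < m \<Longrightarrow> bdry \<Gamma> (fst (\<epsilon> k)) (snd (\<epsilon> k)) ` carrier (egroup \<Gamma> (fst (\<epsilon> k)))
      \<subseteq> \<phi> ` range (\<lambda>j::int. boundary_class ot g m k [^]\<^bsub>surface_group ot g m\<^esub> j)"
    "\<And>A x k. almost_invariant G A \<Longrightarrow> x \<in> carrier G \<Longrightarrow> k < m \<Longrightarrow>
       crosses G A x (axis (fst (\<epsilon> k)) (snd (\<epsilon> k))) \<longleftrightarrow> crosses G A x (\<iota> v (\<phi> (boundary_class ot g m k)))"
proof -
  obtain ot g m \<phi> \<epsilon> where \<phi>: "\<phi> \<in> iso (surface_group ot g m) (vgroup \<Gamma> v)"
    and \<epsilon>: "bij_betw \<epsilon> {..<m} (edges_from \<Gamma> v)"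
    and im: "\<And>k. k < m \<Longrightarrow> bdry \<Gamma> (fst (\<epsilon> k)) (snd (\<epsilon> k)) ` carrier (egroup \<Gamma> (fst (\<epsilon> k)))
      \<subseteq> generate (vgroup \<Gamma> v) {\<phi> (boundary_class ot g m k)}"
    using QH by (rule QH_vertexE) blast
  define H where "H = surface_group ot g m"
  define p where "p k = boundary_class ot g m k" for k
  interpret V: inj_group_hom "vgroup \<Gamma> v" G "\<iota> v" by (rule \<iota>_inj_hom[OF v])
  have gH: "group H" unfolding H_def surface_group_def by (rule group_presented_group)
  interpret F: inj_group_hom H "vgroup \<Gamma> v" \<phi>
    using \<phi> gH by (simp add: H_def inj_group_hom_def inj_group_hom_axioms_def group_hom_def group_hom_axioms_def
        V.G.is_group iso_def bij_betw_def)
  have VF: "inj_group_hom H G (\<lambda>h. \<iota> v (\<phi> h))"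
  proof -
    have "(\<lambda>h. \<iota> v (\<phi> h)) \<in> hom H G" by (rule homI) simp_all
    moreover have "inj_on (\<lambda>h. \<iota> v (\<phi> h)) (carrier H)"
    proof (rule inj_onI)
      fix a b assume ab: "a \<in> carrier H" "b \<in> carrier H" "\<iota> v (\<phi> a) = \<iota> v (\<phi> b)"
      then have "\<phi> a = \<phi> b" using inj_onD[OF V.inj] F.hom_closed by blast
      then show "a = b" using inj_onD[OF F.inj] ab by blast
    qed
    ultimately show ?thesis
      by (simp add: inj_group_hom_def inj_group_hom_axioms_def group_hom_def group_hom_axioms_def gH G.is_group)
  qed
  have p: "p k \<in> carrier H" if "k < m" for k using boundary_class_closed[OF that] by (simp add: H_def p_def)
  have im': "bdry \<Gamma> (fst (\<epsilon> k)) (snd (\<epsilon> k)) ` carrier (egroup \<Gamma> (fst (\<epsilon> k))) \<subseteq> \<phi> ` range (\<lambda>j::int. p k [^]\<^bsub>H\<^esub> j)"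
    if k: "k < m" for k
  proof -
    have "generate (vgroup \<Gamma> v) {\<phi> (p k)} \<subseteq> \<phi> ` range (\<lambda>j::int. p k [^]\<^bsub>H\<^esub> j)"
      unfolding V.G.generate_pow[OF F.hom_closed[OF p[OF k]]]
      using p[OF k] by (auto simp flip: F.hom_int_pow)
    then show ?thesis using im[OF k] by (auto simp: p_def)
  qed
  have ends: "fst (\<epsilon> k) \<in> edges \<Gamma>" "endpt \<Gamma> (fst (\<epsilon> k)) (snd (\<epsilon> k)) = v" if "k < m" for k
    using bij_betwE[OF \<epsilon>] that by (auto simp: edges_from_def split_beta)
  have pow: "\<exists>j::int. axis (fst (\<epsilon> k)) (snd (\<epsilon> k)) = (\<iota> v (\<phi> (p k))) [^]\<^bsub>G\<^esub> j" if k: "k < m" for k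
  proof -
    have "end_gen (fst (\<epsilon> k)) (snd (\<epsilon> k)) \<in> \<phi> ` range (\<lambda>j::int. p k [^]\<^bsub>H\<^esub> j)"
      using im'[OF k] edge_gen(2)[OF ends(1)[OF k]] by blast
    then obtain j :: int where "end_gen (fst (\<epsilon> k)) (snd (\<epsilon> k)) = \<phi> (p k [^]\<^bsub>H\<^esub> j)" by auto
    then show ?thesis using p[OF k] ends(2)[OF k] by (auto simp: F.hom_int_pow V.hom_int_pow)
  qed
  have inf: "infinite_order G (\<iota> v (\<phi> (p k)))" if k: "k < m" for k
  proof -
    from pow[OF k] obtain j :: int where "axis (fst (\<epsilon> k)) (snd (\<epsilon> k)) = (\<iota> v (\<phi> (p k))) [^]\<^bsub>G\<^esub> j" ..
    then show ?thesis
      using G.infinite_order_of_pow(1)[of "\<iota> v (\<phi> (p k))" j] axis_infinite_order(2)[OF ends(1)[OF k], of "snd (\<epsilon> k)"] p[OF k] by simp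
  qed
  show ?thesis
  proof (rule that[OF \<phi> VF[unfolded H_def] \<epsilon>])
    show "infinite_order (surface_group ot g m) (boundary_class ot g m k)" if "k < m" for k
      using inj_group_hom_infinite_order[OF VF p[OF that]] inf[OF that] by (simp add: H_def p_def)
    show "bdry \<Gamma> (fst (\<epsilon> k)) (snd (\<epsilon> k)) ` carrier (egroup \<Gamma> (fst (\<epsilon> k)))
      \<subseteq> \<phi> ` range (\<lambda>j::int. boundary_class ot g m k [^]\<^bsub>surface_group ot g m\<^esub> j)" if "k < m" for k
      using im'[OF that] by (simp add: H_def p_def)
    show "crosses G A x (axis (fst (\<epsilon> k)) (snd (\<epsilon> k))) \<longleftrightarrow> crosses G A x (\<iota> v (\<phi> (boundary_class ot g m k)))"
      if A: "almost_invariant G A" "x \<in> carrier G" and k: "k < m" for A x k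
    proof -
      from pow[OF k] obtain j :: int where j: "axis (fst (\<epsilon> k)) (snd (\<epsilon> k)) = (\<iota> v (\<phi> (p k))) [^]\<^bsub>G\<^esub> j" ..
      have "j \<noteq> 0"
        using G.infinite_order_of_pow(2)[of "\<iota> v (\<phi> (p k))" j] axis_infinite_order(2)[OF ends(1)[OF k], of "snd (\<epsilon> k)"] p[OF k] j by simp
      then show ?thesis unfolding j using G.crosses_pow[OF A(1) inf[OF k] A(2)] by (simp add: p_def)
    qed
  qed
qed

text \<open>The last conclusion says that a second edge of the tree has been found:
  \<open>e'\<close>, \<open>s'\<close> and \<open>x\<close> describe the original edge exactly when
  \<open>e' = e\<close>, \<open>s' = s\<close> and \<open>x\<close> lies in the image of the edge
  group. A loop counts with both of its ends.\<close>

lemma another_crossing_end: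
  assumes A: "almost_invariant G A" and g: "g \<in> carrier G" and e: "e \<in> edges \<Gamma>"
    and cr: "crosses G A g (axis e s)"
  obtains e' s' x where "e' \<in> edges \<Gamma>" "endpt \<Gamma> e' s' = endpt \<Gamma> e s" "x \<in> carrier (vgroup \<Gamma> (endpt \<Gamma> e s))"
    "crosses G A (g \<cdot> \<iota> (endpt \<Gamma> e s) x) (axis e' s')"
    "\<not> (e' = e \<and> s' = s \<and> x \<in> bdry \<Gamma> e s ` carrier (egroup \<Gamma> e))"
proof -
  define v where "v = endpt \<Gamma> e s"
  have v: "v \<in> verts \<Gamma>" using endpt_verts[OF e] by (simp add: v_def)
  interpret V: inj_group_hom "vgroup \<Gamma> v" G "\<iota> v" by (rule \<iota>_inj_hom[OF v])
  have "infinite_cyclic (vgroup \<Gamma> v) \<or> QH_vertex \<Gamma> v" using qbs v by (simp add: QBS_graph_def)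
  then show ?thesis
  proof
    assume "infinite_cyclic (vgroup \<Gamma> v)"
    then obtain y where y: "infinite_order (vgroup \<Gamma> v) y" "carrier (vgroup \<Gamma> v) = range (\<lambda>k::int. y [^]\<^bsub>vgroup \<Gamma> v\<^esub> k)"
      by (rule infinite_cyclic_generator[OF V.G.is_group])
    have yc: "y \<in> carrier (vgroup \<Gamma> v)" using y by (simp add: infinite_order_def)
    have yi: "infinite_order G (\<iota> v y)" using inj_group_hom_infinite_order[OF \<iota>_inj_hom[OF v] yc] y by simp
    have pow: "\<exists>n::int. n \<noteq> 0 \<and> axis e' s' = \<iota> v y [^]\<^bsub>G\<^esub> n"
      if e': "e' \<in> edges \<Gamma>" "endpt \<Gamma> e' s' = v" for e' s'
    proof -
      have "end_gen e' s' \<in> carrier (vgroup \<Gamma> v)" using end_gen_closed[OF e'(1), of s'] e' by simp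
      then obtain n :: int where "end_gen e' s' = y [^]\<^bsub>vgroup \<Gamma> v\<^esub> n" using y(2) by auto
      then have n: "axis e' s' = \<iota> v y [^]\<^bsub>G\<^esub> n" using e' yc by (simp add: V.hom_int_pow)
      have "n \<noteq> 0"
        using G.infinite_order_of_pow(2)[of "\<iota> v y" n] axis_infinite_order(2)[OF e'(1), of s'] n yc by simp
      then show ?thesis using n by blast
    qed
    have cr_y: "crosses G A h (axis e' s') \<longleftrightarrow> crosses G A h (\<iota> v y)"
      if e': "e' \<in> edges \<Gamma>" "endpt \<Gamma> e' s' = v" and h: "h \<in> carrier G" for e' s' h
      using pow[OF e'] G.crosses_pow[OF A yi h] by force
    have gy: "crosses G A g (\<iota> v y)" using cr_y[OF e _ g, of s] cr by (simp add: v_def)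
    \<comment> \<open>If \<open>e\<close> is a loop, its other end is the second edge. Otherwise
      reducedness makes the edge group a proper subgroup, and an \<open>x\<close> outside it shifts
      the line along the generator \<open>y\<close> to another coset.\<close>
    show ?thesis
    proof (cases "endpt \<Gamma> e (\<not> s) = v")
      case True
      have "crosses G A g (axis e (\<not> s))" using cr_y[OF e True g] gy by simp
      then show ?thesis
        using that[of e "\<not> s" "\<one>\<^bsub>vgroup \<Gamma> v\<^esub>"] e True g by (simp add: v_def[symmetric])
    next
      case False
      interpret B: inj_group_hom "egroup \<Gamma> e" "vgroup \<Gamma> v" "bdry \<Gamma> e s"
        using bdry_inj[OF e, of s] by (simp add: v_def)
      have "\<not> bdry \<Gamma> e s \<in> iso (egroup \<Gamma> e) (vgroup \<Gamma> v)"
      proof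
        assume "bdry \<Gamma> e s \<in> iso (egroup \<Gamma> e) (vgroup \<Gamma> v)"
        moreover have "endpt \<Gamma> e True \<noteq> endpt \<Gamma> e False" using False v_def by (cases s) auto
        ultimately have "collapsible_edge \<Gamma> e" using e unfolding collapsible_edge_def v_def by blast
        then show False using reduced by (auto simp: reduced_gog_def)
      qed
      then have "bdry \<Gamma> e s ` carrier (egroup \<Gamma> e) \<noteq> carrier (vgroup \<Gamma> v)"
        using B.inj B.homh by (auto simp: iso_def bij_betw_def)
      moreover have "bdry \<Gamma> e s ` carrier (egroup \<Gamma> e) \<subseteq> carrier (vgroup \<Gamma> v)" by auto
      ultimately obtain x where x: "x \<in> carrier (vgroup \<Gamma> v)" "x \<notin> bdry \<Gamma> e s ` carrier (egroup \<Gamma> e)" by blast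
      then obtain j :: int where j: "x = y [^]\<^bsub>vgroup \<Gamma> v\<^esub> j" using y(2) by auto
      have gx: "g \<cdot> \<iota> v x \<in> carrier G" using g \<iota>_closed[OF v x(1)] by simp
      have "crosses G A (g \<cdot> \<iota> v x) (\<iota> v y)"
        using G.crosses_shift[OF A yi g, of j] gy j yc by (simp add: V.hom_int_pow)
      then have "crosses G A (g \<cdot> \<iota> v x) (axis e s)"
        using cr_y[OF e v_def[symmetric] gx] by simp
      then show ?thesis using that[of e s x] e x by (simp add: v_def)
    qed
  next
    assume "QH_vertex \<Gamma> v"
    then obtain ot gn m \<phi> \<epsilon> where \<phi>: "\<phi> \<in> iso (surface_group ot gn m) (vgroup \<Gamma> v)"
      and VF: "inj_group_hom (surface_group ot gn m) G (\<lambda>h. \<iota> v (\<phi> h))"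
      and \<epsilon>: "bij_betw \<epsilon> {..<m} (edges_from \<Gamma> v)"
      and inf: "\<And>k. k < m \<Longrightarrow> infinite_order (surface_group ot gn m) (boundary_class ot gn m k)"
      and im: "\<And>k. k < m \<Longrightarrow> bdry \<Gamma> (fst (\<epsilon> k)) (snd (\<epsilon> k)) ` carrier (egroup \<Gamma> (fst (\<epsilon> k)))
        \<subseteq> \<phi> ` range (\<lambda>j::int. boundary_class ot gn m k [^]\<^bsub>surface_group ot gn m\<^esub> j)"
      and ax: "\<And>A x k. almost_invariant G A \<Longrightarrow> x \<in> carrier G \<Longrightarrow> k < m \<Longrightarrow>
       crosses G A x (axis (fst (\<epsilon> k)) (snd (\<epsilon> k))) \<longleftrightarrow> crosses G A x (\<iota> v (\<phi> (boundary_class ot gn m k)))"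
      by (rule QH_axes[OF v]) blast
    define H where "H = surface_group ot gn m"
    define p where "p k = boundary_class ot gn m k" for k
    interpret F: inj_group_hom H G "\<lambda>h. \<iota> v (\<phi> h)" using VF by (simp add: H_def)
    have pc: "p k \<in> carrier H" if "k < m" for k using boundary_class_closed[OF that] by (simp add: H_def p_def)
    have \<phi>c: "\<phi> h \<in> carrier (vgroup \<Gamma> v)" if "h \<in> carrier H" for h
      using \<phi> that by (auto simp: H_def iso_def hom_def)
    have "(e, s) \<in> edges_from \<Gamma> v" using e by (simp add: edges_from_def v_def)
    then have "(e, s) \<in> \<epsilon> ` {..<m}" using \<epsilon> by (simp add: bij_betw_def)
    then obtain k0 where k0: "k0 < m" "\<epsilon> k0 = (e, s)" by force
    let ?A = "\<lambda>h. A (g \<cdot> \<iota> v (\<phi> h))"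
    have A': "almost_invariant H ?A" by (rule almost_invariant_pullback[OF F.inj_group_hom_axioms A g])
    have cr': "crosses H ?A h (p k) \<longleftrightarrow> crosses G A (g \<cdot> \<iota> v (\<phi> h)) (axis (fst (\<epsilon> k)) (snd (\<epsilon> k)))"
      if "h \<in> carrier H" "k < m" for h k
      using crosses_pullback[OF F.inj_group_hom_axioms g that(1) pc[OF that(2)]] ax[OF A, of "g \<cdot> \<iota> v (\<phi> h)" k]
        that g by (simp add: p_def)
    have "crosses H ?A \<one>\<^bsub>H\<^esub> (p k0)"
      using cr'[of "\<one>\<^bsub>H\<^esub>" k0] k0 cr g by simp
    from surface_another_crossing_line[OF A'[unfolded H_def] inf k0(1) _ this[unfolded H_def p_def]]
    obtain k h where k: "k < m" "h \<in> carrier H" "crosses H ?A h (p k)"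
      "k = k0 \<Longrightarrow> h \<notin> range (\<lambda>j::int. \<one>\<^bsub>H\<^esub> \<otimes>\<^bsub>H\<^esub> p k0 [^]\<^bsub>H\<^esub> j)"
      using F.G.one_closed unfolding H_def p_def by blast
    obtain e' s' where es: "\<epsilon> k = (e', s')" by (cases "\<epsilon> k")
    have "(e', s') \<in> edges_from \<Gamma> v" using bij_betwE[OF \<epsilon>] k(1) es by (metis lessThan_iff)
    then have e': "e' \<in> edges \<Gamma>" "endpt \<Gamma> e' s' = v" by (auto simp: edges_from_def)
    \<comment> \<open>The edge group consists of images of powers of \<open>p k0\<close>, so
      \<open>h\<close> would lie on the excluded line through the identity.\<close>
    have "\<phi> h \<notin> bdry \<Gamma> e s ` carrier (egroup \<Gamma> e)" if "e' = e" "s' = s"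
    proof
      assume a: "\<phi> h \<in> bdry \<Gamma> e s ` carrier (egroup \<Gamma> e)"
      have kk: "k = k0" using \<epsilon> k(1) k0 es that by (auto simp: bij_betw_def inj_on_def)
      from a im[OF k0(1)] k0(2) obtain j :: int where j: "\<phi> h = \<phi> (p k0 [^]\<^bsub>H\<^esub> j)"
        by (auto simp: H_def p_def)
      have "inj_on \<phi> (carrier H)" using \<phi> by (auto simp: H_def iso_def bij_betw_def)
      then have "h = p k0 [^]\<^bsub>H\<^esub> j" using j k(2) pc[OF k0(1)] by (auto dest: inj_onD)
      then show False using k(4)[OF kk] pc[OF k0(1)] by auto
    qed
    moreover have "crosses G A (g \<cdot> \<iota> v (\<phi> h)) (axis e' s')"
      using cr'[OF k(2,1)] k(3) es by simp
    ultimately show ?thesis using that[of e' s' "\<phi> h"] e' \<phi>c[OF k(2)] by (auto simp: v_def)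
  qed
qed

text \<open>\<open>A\<close> must change somewhere on a crossing line, and all points of the line
  have the same height because the axis lies in the vertex group. So the finitely many changes
  already show all heights, although a crossing line has infinitely many points.\<close>

lemma finite_crossing_heights:
  assumes A: "almost_invariant G A" and e: "e \<in> edges \<Gamma>"
  shows "finite (height (endpt \<Gamma> e s) ` {g \<in> carrier G. crosses G A g (axis e s)})"
proof (rule finite_subset)
  let ?z = "axis e s"
  let ?D = "{g \<in> carrier G. A (g \<cdot> ?z) \<noteq> A g}"
  have zi: "infinite_order G ?z" by (rule axis_infinite_order(2)[OF e])
  then have zc: "?z \<in> carrier G" by (simp add: infinite_order_def)
  show "finite (height (endpt \<Gamma> e s) ` ?D)" using A zc by (simp add: almost_invariant_def)
  show "height (endpt \<Gamma> e s) ` {g \<in> carrier G. crosses G A g ?z} \<subseteq> height (endpt \<Gamma> e s) ` ?D"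
  proof (rule image_subsetI, elim CollectE conjE)
    fix g assume g: "g \<in> carrier G" "crosses G A g ?z"
    have "\<exists>k::int. A (g \<cdot> ?z [^]\<^bsub>G\<^esub> (k + 1)) \<noteq> A (g \<cdot> ?z [^]\<^bsub>G\<^esub> k)"
    proof (rule ccontr)
      assume "\<not> ?thesis"
      then have st: "A (g \<cdot> ?z [^]\<^bsub>G\<^esub> (k + 1)) = A (g \<cdot> ?z [^]\<^bsub>G\<^esub> k)" for k :: int by blast
      have "A (g \<cdot> ?z [^]\<^bsub>G\<^esub> k) = A (g \<cdot> ?z [^]\<^bsub>G\<^esub> (0::int))" for k :: int
      proof (induction k rule: int_induct[of _ 0])
        case (step1 i) then show ?case using st[of i] by simp
      next
        case (step2 i) then show ?case using st[of "i - 1"] by simp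
      qed simp
      then have "\<not> crosses G A g ?z" unfolding crosses_def by (metis order_refl)
      then show False using g by simp
    qed
    then obtain k :: int where "A (g \<cdot> ?z [^]\<^bsub>G\<^esub> k \<cdot> ?z) \<noteq> A (g \<cdot> ?z [^]\<^bsub>G\<^esub> k)"
      using G.line_step[OF zc g(1)] by auto
    then have D: "g \<cdot> ?z [^]\<^bsub>G\<^esub> k \<in> ?D" using g zc by simp
    have "height (endpt \<Gamma> e s) (g \<cdot> ?z [^]\<^bsub>G\<^esub> k) = height (endpt \<Gamma> e s) g"
      unfolding axis_pow(1)[OF e] by (rule height_translate[OF g(1) endpt_verts[OF e] axis_pow(2)[OF e]])
    with imageI[OF D, of "height (endpt \<Gamma> e s)"]
    show "height (endpt \<Gamma> e s) g \<in> height (endpt \<Gamma> e s) ` ?D" by (simp only:)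
  qed
qed

text \<open>
  The crossing edges of the Bass-Serre tree form a finite forest. At the far end of one that is furthest
  from the base vertex there would have to be another one, leading further away.
\<close>

theorem no_crossing:
  assumes A: "almost_invariant G A" and g: "g \<in> carrier G" and e: "e \<in> edges \<Gamma>"
  shows "\<not> crosses G A g (axis e s)"
proof
  assume cr: "crosses G A g (axis e s)"
  define M where "M = (\<Union>e\<in>edges \<Gamma>. \<Union>s. height (endpt \<Gamma> e s) ` {g \<in> carrier G. crosses G A g (axis e s)})"
  have M: "finite M" unfolding M_def using finite_edges finite_crossing_heights[OF A] by (intro finite_UN_I) auto
  have inM: "height (endpt \<Gamma> e s) g \<in> M" if "e \<in> edges \<Gamma>" "g \<in> carrier G" "crosses G A g (axis e s)" for e s g
    using that unfolding M_def by blast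
  have "Max M \<in> M" using M inM[OF e g cr] by (intro Max_in) auto
  then obtain e s g where 1: "e \<in> edges \<Gamma>" "g \<in> carrier G" "crosses G A g (axis e s)"
    "height (endpt \<Gamma> e s) g = Max M" unfolding M_def by auto
  \<comment> \<open>The other end of the same edge crosses too, so its height is at most the
    maximum; and the heights of the two ends of an edge differ.\<close>
  have desc: "height (endpt \<Gamma> e (\<not> s)) (g \<cdot> stable e s) < Max M"
    if "e \<in> edges \<Gamma>" "g \<in> carrier G" "crosses G A g (axis e s)" "height (endpt \<Gamma> e s) g = Max M" for e s g
  proof -
    have "g \<cdot> stable e s \<in> carrier G" using that stable_closed by simp
    moreover have "crosses G A (g \<cdot> stable e s) (axis e (\<not> s))" using axis_edge[OF A that(2,1)] that(3) by simp
    ultimately have "height (endpt \<Gamma> e (\<not> s)) (g \<cdot> stable e s) \<le> Max M"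
      using inM[OF that(1), of "g \<cdot> stable e s" "\<not> s"] M by simp
    then show ?thesis using height_neq[OF that(2,1), of s] that(4) by simp
  qed
  obtain e' s' x where 2: "e' \<in> edges \<Gamma>" "endpt \<Gamma> e' s' = endpt \<Gamma> e s" "x \<in> carrier (vgroup \<Gamma> (endpt \<Gamma> e s))"
    "crosses G A (g \<cdot> \<iota> (endpt \<Gamma> e s) x) (axis e' s')"
    "\<not> (e' = e \<and> s' = s \<and> x \<in> bdry \<Gamma> e s ` carrier (egroup \<Gamma> e))"
    using another_crossing_end[OF A 1(2,1,3)] by metis
  have v: "endpt \<Gamma> e s \<in> verts \<Gamma>" using endpt_verts 1 by blast
  let ?h = "g \<cdot> \<iota> (endpt \<Gamma> e s) x"
  have h: "?h \<in> carrier G" "height (endpt \<Gamma> e' s') ?h = Max M"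
    using 1 2 \<iota>_closed[OF v 2(3)] height_translate[OF 1(2) v 2(3)] by auto
  have "height (endpt \<Gamma> e' (\<not> s')) (?h \<cdot> stable e' s') < Max M"
    by (rule desc[OF 2(1) h(1) 2(4) h(2)])
  with unique_descent[OF 1(2,1) 2(1) HOL.refl 2(2,3)] desc[OF 1] 1(4) 2(5) show False by simp
qed

end

section \<open>Finite generation and limits on cosets of vertex groups\<close>

context reduced_QBS
begin

lemma vgroup_finitely_generated:
  assumes v: "v \<in> verts \<Gamma>"
  shows "\<exists>S. finite S \<and> S \<subseteq> carrier (vgroup \<Gamma> v) \<and> generate (vgroup \<Gamma> v) S = carrier (vgroup \<Gamma> v)"
proof -
  interpret V: group "vgroup \<Gamma> v" by (rule vgroup[OF v])
  have "infinite_cyclic (vgroup \<Gamma> v) \<or> QH_vertex \<Gamma> v" using qbs v by (simp add: QBS_graph_def)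
  then show ?thesis
  proof
    assume "infinite_cyclic (vgroup \<Gamma> v)"
    then obtain y where y: "infinite_order (vgroup \<Gamma> v) y" "carrier (vgroup \<Gamma> v) = range (\<lambda>k::int. y [^]\<^bsub>vgroup \<Gamma> v\<^esub> k)"
      by (rule infinite_cyclic_generator[OF V.is_group])
    then show ?thesis
      by (intro exI[of _ "{y}"]) (auto simp: V.generate_pow infinite_order_def)
  next
    assume "QH_vertex \<Gamma> v"
    then obtain ot g m \<phi> where \<phi>: "\<phi> \<in> iso (surface_group ot g m) (vgroup \<Gamma> v)"
      unfolding QH_vertex_def by blast
    have gH: "group (surface_group ot g m)" unfolding surface_group_def by (rule group_presented_group)
    interpret F: group_hom "surface_group ot g m" "vgroup \<Gamma> v" \<phi>
      using \<phi> gH by (simp add: group_hom_def group_hom_axioms_def V.is_group iso_def)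
    define S where "S = (\<lambda>x. word_class (surface_gens ot g m) {surface_relator ot g m} [gen x]) ` surface_gens ot g m"
    have gen: "generate (surface_group ot g m) S = carrier (surface_group ot g m)"
      unfolding surface_group_def S_def by (rule generate_presented_group)
    have sub: "S \<subseteq> carrier (surface_group ot g m)"
      using generate.incl[of _ S "surface_group ot g m"] gen by blast
    have "generate (vgroup \<Gamma> v) (\<phi> ` S) = carrier (vgroup \<Gamma> v)"
      unfolding F.generate_img[OF sub] gen using \<phi> by (simp add: iso_def bij_betw_def)
    moreover have "finite (\<phi> ` S)" by (simp add: S_def surface_gens_def)
    moreover have "\<phi> ` S \<subseteq> carrier (vgroup \<Gamma> v)" using sub by (auto intro!: F.hom_closed)
    ultimately show ?thesis by blast
  qed
qed

definition vgens where
  "vgens v = (SOME S. finite S \<and> S \<subseteq> carrier (vgroup \<Gamma> v) \<and> generate (vgroup \<Gamma> v) S = carrier (vgroup \<Gamma> v))"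

lemma vgens:
  assumes "v \<in> verts \<Gamma>"
  shows "finite (vgens v)" "vgens v \<subseteq> carrier (vgroup \<Gamma> v)" "generate (vgroup \<Gamma> v) (vgens v) = carrier (vgroup \<Gamma> v)"
  using someI_ex[OF vgroup_finitely_generated[OF assms], folded vgens_def] by simp_all

definition gens where
  "gens = (\<Union>v\<in>verts \<Gamma>. \<iota> v ` vgens v) \<union> (\<lambda>e. stable e False) ` edges \<Gamma>"

lemma gens: "finite gens" "gens \<subseteq> carrier G" "generate G gens = carrier G"
proof -
  show "finite gens" using finite_verts finite_edges vgens by (simp add: gens_def)
  show sub: "gens \<subseteq> carrier G"
    unfolding gens_def using \<iota>_closed[OF _ subsetD[OF vgens(2)]] stable_closed by blast
  have "(\<lambda>x. cls [gen x]) ` X \<subseteq> generate G gens"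
  proof
    fix y assume "y \<in> (\<lambda>x. cls [gen x]) ` X"
    then consider (v) v x where "v \<in> verts \<Gamma>" "x \<in> carrier (vgroup \<Gamma> v)" "y = \<iota> v x"
      | (e) e where "e \<in> edges \<Gamma>" "y = stable e False"
      by (auto simp: pi1_gens_def)
    then show "y \<in> generate G gens"
    proof cases
      case v
      interpret V: inj_group_hom "vgroup \<Gamma> v" G "\<iota> v" by (rule \<iota>_inj_hom[OF v(1)])
      have "y \<in> generate G (\<iota> v ` vgens v)"
        using V.generate_img[OF vgens(2)[OF v(1)]] vgens(3)[OF v(1)] v by simp
      moreover have "\<iota> v ` vgens v \<subseteq> gens" using v by (auto simp: gens_def)
      ultimately show ?thesis using G.mono_generate by blast
    next
      case e
      then show ?thesis by (auto simp: gens_def intro: generate.incl)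
    qed
  qed
  moreover have "generate G ((\<lambda>x. cls [gen x]) ` X) = carrier G"
    unfolding pi1_presented by (rule generate_presented_group)
  ultimately show "generate G gens = carrier G" by (rule G.generate_eq_carrierI[OF sub])
qed

text \<open>In the infinite cyclic case the absence of crossing axes says something about the coset
  only if some edge is incident, for then the axis is a nonzero power of the generator. In the QH
  case the surface may be closed.\<close>

lemma almost_constant_on_coset:
  assumes A: "almost_invariant G A" and g: "g \<in> carrier G" and v: "v \<in> verts \<Gamma>"
    and edge: "infinite_cyclic (vgroup \<Gamma> v) \<Longrightarrow> edges_from \<Gamma> v \<noteq> {}"
  shows "\<exists>b. finite {x \<in> carrier (vgroup \<Gamma> v). A (g \<cdot> \<iota> v x) \<noteq> b}"
proof (cases "infinite_cyclic (vgroup \<Gamma> v)")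
  case True
  interpret V: inj_group_hom "vgroup \<Gamma> v" G "\<iota> v" by (rule \<iota>_inj_hom[OF v])
  from True obtain y where y: "infinite_order (vgroup \<Gamma> v) y" "carrier (vgroup \<Gamma> v) = range (\<lambda>k::int. y [^]\<^bsub>vgroup \<Gamma> v\<^esub> k)"
    by (rule infinite_cyclic_generator[OF V.G.is_group])
  have yc: "y \<in> carrier (vgroup \<Gamma> v)" using y by (simp add: infinite_order_def)
  have yi: "infinite_order G (\<iota> v y)" using inj_group_hom_infinite_order[OF \<iota>_inj_hom[OF v] yc] y by simp
  obtain e s where e: "e \<in> edges \<Gamma>" "endpt \<Gamma> e s = v" using edge[OF True] by (auto simp: edges_from_def)
  have "end_gen e s \<in> carrier (vgroup \<Gamma> v)" using end_gen_closed[OF e(1), of s] e by simp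
  then obtain n :: int where "end_gen e s = y [^]\<^bsub>vgroup \<Gamma> v\<^esub> n" using y(2) by auto
  then have n: "axis e s = \<iota> v y [^]\<^bsub>G\<^esub> n" using e yc by (simp add: V.hom_int_pow)
  have "n \<noteq> 0"
    using G.infinite_order_of_pow(2)[of "\<iota> v y" n] axis_infinite_order(2)[OF e(1), of s] n yc by simp
  then have "\<not> crosses G A g (\<iota> v y)"
    using no_crossing[OF A g e(1), of s] G.crosses_pow[OF A yi g] n by simp
  from G.almost_constant_line[OF A yi g this]
  obtain b where b: "finite {k::int. A (g \<cdot> \<iota> v y [^]\<^bsub>G\<^esub> k) \<noteq> b}" by blast
  have "{x \<in> carrier (vgroup \<Gamma> v). A (g \<cdot> \<iota> v x) \<noteq> b} \<subseteq>
      (\<lambda>k. y [^]\<^bsub>vgroup \<Gamma> v\<^esub> k) ` {k::int. A (g \<cdot> \<iota> v y [^]\<^bsub>G\<^esub> k) \<noteq> b}"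
    using yc y(2) by (auto simp: V.hom_int_pow)
  then show ?thesis using finite_surj[OF b] by blast
next
  case False
  then have "QH_vertex \<Gamma> v" using qbs v by (auto simp: QBS_graph_def)
  then obtain ot gn m \<phi> \<epsilon> where \<phi>: "\<phi> \<in> iso (surface_group ot gn m) (vgroup \<Gamma> v)"
    and VF: "inj_group_hom (surface_group ot gn m) G (\<lambda>h. \<iota> v (\<phi> h))"
    and \<epsilon>: "bij_betw \<epsilon> {..<m} (edges_from \<Gamma> v)"
    and inf: "\<And>k. k < m \<Longrightarrow> infinite_order (surface_group ot gn m) (boundary_class ot gn m k)"
    and ax: "\<And>A x k. almost_invariant G A \<Longrightarrow> x \<in> carrier G \<Longrightarrow> k < m \<Longrightarrow>
     crosses G A x (axis (fst (\<epsilon> k)) (snd (\<epsilon> k))) \<longleftrightarrow> crosses G A x (\<iota> v (\<phi> (boundary_class ot gn m k)))"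
    by (rule QH_axes[OF v]) blast
  define H where "H = surface_group ot gn m"
  interpret F: inj_group_hom H G "\<lambda>h. \<iota> v (\<phi> h)" using VF by (simp add: H_def)
  let ?A = "\<lambda>h. A (g \<cdot> \<iota> v (\<phi> h))"
  have "\<exists>b. finite {h \<in> carrier (surface_group ot gn m). ?A h \<noteq> b}"
  proof (rule surface_almost_constant[OF _ inf])
    show "almost_invariant (surface_group ot gn m) ?A"
      using almost_invariant_pullback[OF F.inj_group_hom_axioms A g] by (simp add: H_def)
    fix k h assume k: "k < m" and h: "h \<in> carrier (surface_group ot gn m)"
    have e: "fst (\<epsilon> k) \<in> edges \<Gamma>" using bij_betwE[OF \<epsilon>] k by (auto simp: edges_from_def split_beta)
    have gh: "g \<cdot> \<iota> v (\<phi> h) \<in> carrier G" using F.hom_closed[of h] g h by (simp add: H_def)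
    have "\<not> crosses G A (g \<cdot> \<iota> v (\<phi> h)) (\<iota> v (\<phi> (boundary_class ot gn m k)))"
      using no_crossing[OF A gh e] ax[OF A gh k] by simp
    then show "\<not> crosses (surface_group ot gn m) ?A h (boundary_class ot gn m k)"
      using crosses_pullback[OF VF g h boundary_class_closed[OF k]] by simp
  qed
  then obtain b where b: "finite {h \<in> carrier H. ?A h \<noteq> b}" unfolding H_def by blast
  have "\<phi> ` carrier H = carrier (vgroup \<Gamma> v)" using \<phi> by (simp add: H_def iso_def bij_betw_def)
  then have "{x \<in> carrier (vgroup \<Gamma> v). A (g \<cdot> \<iota> v x) \<noteq> b} \<subseteq> \<phi> ` {h \<in> carrier H. ?A h \<noteq> b}" by auto
  then show ?thesis using finite_surj[OF b] by blast
qed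

lemma isolated_vertex:
  assumes v: "v \<in> verts \<Gamma>" and none: "edges_from \<Gamma> v = {}"
  shows "edges \<Gamma> = {}" "verts \<Gamma> = {v}" "\<iota> v ` carrier (vgroup \<Gamma> v) = carrier G"
proof -
  have no: "endpt \<Gamma> e s \<noteq> v" if "e \<in> edges \<Gamma>" for e s using none that by (auto simp: edges_from_def)
  have vw: "w = v" if "w \<in> verts \<Gamma>" for w
  proof -
    have "(w, v) \<in> {(endpt \<Gamma> e s, endpt \<Gamma> e (\<not> s)) |e s. e \<in> edges \<Gamma>}\<^sup>*"
      using gog v that by (simp add: graph_of_groups_def joins_verts_def)
    then show ?thesis by (cases rule: rtranclE) (use no in auto)
  qed
  show V: "verts \<Gamma> = {v}" using vw v by blast
  show E: "edges \<Gamma> = {}" using no endpt_verts vw by blast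
  interpret V: inj_group_hom "vgroup \<Gamma> v" G "\<iota> v" by (rule \<iota>_inj_hom[OF v])
  have "gens = \<iota> v ` vgens v" by (simp add: gens_def V E)
  then show "\<iota> v ` carrier (vgroup \<Gamma> v) = carrier G"
    using V.generate_img[OF vgens(2)[OF v]] vgens(3)[OF v] gens(3) by simp
qed

text \<open>The whole group is one vertex group. Excluding the integers, which have two ends, leaves
  a surface group.\<close>

lemma almost_constant_isolated:
  assumes A: "almost_invariant G A" and v: "v \<in> verts \<Gamma>" and none: "edges_from \<Gamma> v = {}"
    and not_cyclic: "\<not> G \<cong> integer_group"
  shows "\<exists>b. finite {x \<in> carrier G. A x \<noteq> b}"
proof -
  interpret V: inj_group_hom "vgroup \<Gamma> v" G "\<iota> v" by (rule \<iota>_inj_hom[OF v])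
  note onto = isolated_vertex(3)[OF v none]
  have "\<iota> v \<in> iso (vgroup \<Gamma> v) G" using V.inj V.homh onto by (simp add: iso_def bij_betw_def)
  then have "vgroup \<Gamma> v \<cong> G" by (rule is_isoI)
  then have "G \<cong> vgroup \<Gamma> v" by (rule V.G.iso_sym)
  then have "\<not> infinite_cyclic (vgroup \<Gamma> v)"
    using not_cyclic iso_trans unfolding infinite_cyclic_def by blast
  then obtain b where b: "finite {x \<in> carrier (vgroup \<Gamma> v). A (\<one>\<^bsub>G\<^esub> \<cdot> \<iota> v x) \<noteq> b}"
    using almost_constant_on_coset[OF A G.one_closed v] by blast
  have "{x \<in> carrier G. A x \<noteq> b} \<subseteq> \<iota> v ` {x \<in> carrier (vgroup \<Gamma> v). A (\<one>\<^bsub>G\<^esub> \<cdot> \<iota> v x) \<noteq> b}"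
    unfolding onto[symmetric] by auto
  then show ?thesis using finite_surj[OF b] by blast
qed

lemma vgroup_infinite:
  assumes "e \<in> edges \<Gamma>" shows "infinite (carrier (vgroup \<Gamma> (endpt \<Gamma> e s)))"
proof
  assume "finite (carrier (vgroup \<Gamma> (endpt \<Gamma> e s)))"
  moreover have "range (\<lambda>k::int. end_gen e s [^]\<^bsub>vgroup \<Gamma> (endpt \<Gamma> e s)\<^esub> k) \<subseteq> carrier (vgroup \<Gamma> (endpt \<Gamma> e s))"
    by (rule image_subsetI) (rule axis_pow(2)[OF assms])
  moreover have "infinite (range (\<lambda>k::int. end_gen e s [^]\<^bsub>vgroup \<Gamma> (endpt \<Gamma> e s)\<^esub> k))"
    using axis_infinite_order(1)[OF assms, of s] finite_imageD[of _ "UNIV :: int set"] infinite_UNIV_int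
    unfolding infinite_order_def by blast
  ultimately show False using finite_subset by blast
qed

theorem almost_constant:
  assumes A: "almost_invariant G A" and not_cyclic: "\<not> G \<cong> integer_group"
  shows "\<exists>b. finite {x \<in> carrier G. A x \<noteq> b}"
proof (cases "\<exists>v\<in>verts \<Gamma>. edges_from \<Gamma> v = {}")
  case True
  then show ?thesis using almost_constant_isolated[OF A _ _ not_cyclic] by blast
next
  case False
  define lim where "lim v g b \<longleftrightarrow> finite {x \<in> carrier (vgroup \<Gamma> v). A (g \<cdot> \<iota> v x) \<noteq> b}" for v g b
  have ex: "\<exists>b. lim v g b" if "v \<in> verts \<Gamma>" "g \<in> carrier G" for v g
    unfolding lim_def by (rule almost_constant_on_coset[OF A that(2,1)]) (use False that in blast)
  have inf: "infinite (carrier (vgroup \<Gamma> v))" if v: "v \<in> verts \<Gamma>" for v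
  proof -
    obtain e s where "e \<in> edges \<Gamma>" "endpt \<Gamma> e s = v" using False v by (fastforce simp: edges_from_def)
    then show ?thesis using vgroup_infinite by blast
  qed
  have translate: "lim v (g \<cdot> \<iota> v y) b" if l: "lim v g b" and v: "v \<in> verts \<Gamma>" and g: "g \<in> carrier G"
    and y: "y \<in> carrier (vgroup \<Gamma> v)" for v g y b
  proof -
    interpret V: inj_group_hom "vgroup \<Gamma> v" G "\<iota> v" by (rule \<iota>_inj_hom[OF v])
    let ?F = "{x \<in> carrier (vgroup \<Gamma> v). A (g \<cdot> \<iota> v x) \<noteq> b}"
    have "{x \<in> carrier (vgroup \<Gamma> v). A (g \<cdot> \<iota> v y \<cdot> \<iota> v x) \<noteq> b} \<subseteq>
        (\<lambda>x. inv\<^bsub>vgroup \<Gamma> v\<^esub> y \<otimes>\<^bsub>vgroup \<Gamma> v\<^esub> x) ` ?F"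
    proof
      fix x assume x: "x \<in> {x \<in> carrier (vgroup \<Gamma> v). A (g \<cdot> \<iota> v y \<cdot> \<iota> v x) \<noteq> b}"
      then have x: "x \<in> carrier (vgroup \<Gamma> v)" "A (g \<cdot> \<iota> v y \<cdot> \<iota> v x) \<noteq> b" by auto
      then have "y \<otimes>\<^bsub>vgroup \<Gamma> v\<^esub> x \<in> ?F" using y g by (simp add: G.m_assoc)
      moreover have "x = inv\<^bsub>vgroup \<Gamma> v\<^esub> y \<otimes>\<^bsub>vgroup \<Gamma> v\<^esub> (y \<otimes>\<^bsub>vgroup \<Gamma> v\<^esub> x)"
        using x(1) y by (simp flip: V.G.m_assoc)
      ultimately show "x \<in> (\<lambda>x. inv\<^bsub>vgroup \<Gamma> v\<^esub> y \<otimes>\<^bsub>vgroup \<Gamma> v\<^esub> x) ` ?F" by blast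
    qed
    then show ?thesis using finite_surj l unfolding lim_def by blast
  qed
  have line: "finite {k::int. A (g \<cdot> axis e s [^]\<^bsub>G\<^esub> k) \<noteq> b}"
    if l: "lim (endpt \<Gamma> e s) g b" and e: "e \<in> edges \<Gamma>" for e s g b
  proof -
    let ?f = "\<lambda>k::int. end_gen e s [^]\<^bsub>vgroup \<Gamma> (endpt \<Gamma> e s)\<^esub> k"
    have "inj ?f" using axis_infinite_order(1)[OF e] by (simp add: infinite_order_def)
    from finite_vimageI[OF l[unfolded lim_def] this] show ?thesis
      using axis_pow[OF e, of s] by (simp add: vimage_def)
  qed
  have unique_line: "b = b'" if "finite {k::int. f k \<noteq> b}" "finite {k. f k \<noteq> b'}" for f :: "int \<Rightarrow> bit" and b b'
  proof (rule ccontr)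
    assume "b \<noteq> b'"
    then have "UNIV \<subseteq> {k::int. f k \<noteq> b} \<union> {k. f k \<noteq> b'}" by auto
    then have "finite (UNIV :: int set)" using that by (meson finite_UnI finite_subset)
    then show False by simp
  qed
  have unique: "b = b'" if "lim v g b" "lim v g b'" and v: "v \<in> verts \<Gamma>" for v g b b'
  proof (rule ccontr)
    assume "b \<noteq> b'"
    then have "carrier (vgroup \<Gamma> v) \<subseteq> {x \<in> carrier (vgroup \<Gamma> v). A (g \<cdot> \<iota> v x) \<noteq> b} \<union>
      {x \<in> carrier (vgroup \<Gamma> v). A (g \<cdot> \<iota> v x) \<noteq> b'}" by auto
    then show False using that inf[OF v] unfolding lim_def by (meson finite_UnI finite_subset)
  qed
  \<comment> \<open>The stable letter carries the axis line at one end of the edge to the axis line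
    at the other, and along it changes the value of \<open>A\<close> only finitely often. Since
    lines are infinite, both limits can be read off there.\<close>
  have cross: "b = b'" if l: "lim (endpt \<Gamma> e s) g b" "lim (endpt \<Gamma> e (\<not> s)) (g \<cdot> stable e s) b'"
    and e: "e \<in> edges \<Gamma>" and g: "g \<in> carrier G" for e s g b b'
  proof -
    let ?t = "stable e s" and ?z = "axis e s" and ?z' = "axis e (\<not> s)"
    have zc: "?z \<in> carrier G" "?z' \<in> carrier G" "?t \<in> carrier G"
      using axis_infinite_order(2)[OF e] stable_closed[OF e] by (auto simp: infinite_order_def)
    have pow: "?z [^]\<^bsub>G\<^esub> k \<cdot> ?t = ?t \<cdot> ?z' [^]\<^bsub>G\<^esub> k" for k :: int
      by (rule G.int_pow_intertwine[OF zc(1,3,2) edge_relation[OF e edge_gen(2)[OF e]]])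
    have "finite {x \<in> carrier G. A (x \<cdot> ?t) \<noteq> A x}" using A zc by (simp add: almost_invariant_def)
    from G.finite_line_preimage[OF axis_infinite_order(2)[OF e, of s] g this]
    have "finite {k::int. A (g \<cdot> ?z [^]\<^bsub>G\<^esub> k \<cdot> ?t) \<noteq> A (g \<cdot> ?z [^]\<^bsub>G\<^esub> k)}"
      using g zc by simp
    from finite_UnI[OF this line[OF l(1) e]]
    have "finite {k::int. A (g \<cdot> ?z [^]\<^bsub>G\<^esub> k \<cdot> ?t) \<noteq> b}" by (rule rev_finite_subset) auto
    moreover have "g \<cdot> ?z [^]\<^bsub>G\<^esub> k \<cdot> ?t = g \<cdot> ?t \<cdot> ?z' [^]\<^bsub>G\<^esub> k" for k :: int
      using g zc by (simp add: G.m_assoc pow)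
    ultimately have "finite {k::int. A (g \<cdot> ?t \<cdot> ?z' [^]\<^bsub>G\<^esub> k) \<noteq> b}" by simp
    then show ?thesis using line[OF l(2) e] by (rule unique_line)
  qed
  \<comment> \<open>Stable letters of tree edges are trivial, so \<open>cross\<close> moves between
    vertices while \<open>g\<close> stays fixed. Thus the limit does not depend on the
    vertex.\<close>
  have connected: "lim w g b" if l: "lim v g b" and v: "v \<in> verts \<Gamma>" "w \<in> verts \<Gamma>" and g: "g \<in> carrier G" for v w g b
  proof -
    have "(v, w) \<in> {(endpt \<Gamma> e s, endpt \<Gamma> e (\<not> s)) |e s. e \<in> T}\<^sup>*"
      using tree v by (simp add: spanning_tree_def joins_verts_def)
    then show ?thesis
    proof (induction rule: rtrancl_induct)
      case base show ?case by (rule l)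
    next
      case (step y z)
      then obtain e s where e: "e \<in> T" "y = endpt \<Gamma> e s" "z = endpt \<Gamma> e (\<not> s)" by blast
      then have eE: "e \<in> edges \<Gamma>" using T_edges by auto
      obtain b' where b': "lim z g b'" using ex[of z g] endpt_verts[OF eE] e g by blast
      have "b = b'" by (rule cross[of e s g]) (use step e b' g eE stable_tree[OF e(1)] in auto)
      then show ?case using b' by simp
    qed
  qed
  have step: "lim base (g \<cdot> s) b" if g: "g \<in> carrier G" and l: "lim base g b" and s: "s \<in> gens" for g s b
  proof -
    have gs: "g \<cdot> s \<in> carrier G" using g s gens(2) by auto
    consider (v) v x where "v \<in> verts \<Gamma>" "x \<in> vgens v" "s = \<iota> v x"
      | (e) e where "e \<in> edges \<Gamma>" "s = stable e False"
      using s by (auto simp: gens_def)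
    then show ?thesis
    proof cases
      case v
      then have "lim v (g \<cdot> s) b"
        using translate[OF connected[OF l base v(1) g] v(1) g, of x] vgens(2)[OF v(1)] by auto
      then show ?thesis by (rule connected[OF _ v(1) base gs])
    next
      case e
      have V: "endpt \<Gamma> e False \<in> verts \<Gamma>" "endpt \<Gamma> e True \<in> verts \<Gamma>" using endpt_verts[OF e(1)] by auto
      obtain b' where b': "lim (endpt \<Gamma> e True) (g \<cdot> s) b'" using ex[OF V(2) gs] by blast
      have "b = b'" by (rule cross[of e False g]) (use connected[OF l base V(1) g] b' e g in auto)
      then show ?thesis using connected[OF b' V(2) base gs] by simp
    qed
  qed
  define val where "val g = (THE b. lim base g b)" for g
  have val: "val g = b" if "lim base g b" for g b
    unfolding val_def by (rule the_equality[where P = "lim base g", OF that]) (rule unique[OF _ that base])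
  have limval: "lim base g (val g)" if "g \<in> carrier G" for g
    using ex[OF base that] val by metis
  define b where "b = val \<one>\<^bsub>G\<^esub>"
  have "val g = b" if g: "g \<in> carrier G" for g
    using G.invariant_generate[OF gens(2), of val g "\<one>\<^bsub>G\<^esub>"] val[OF step[OF _ limval]] g gens(3) by (simp add: b_def)
  then have b: "lim base g b" if "g \<in> carrier G" for g using limval[OF that] that by simp
  interpret V: inj_group_hom "vgroup \<Gamma> base" G "\<iota> base" by (rule \<iota>_inj_hom[OF base])
  \<comment> \<open>A common limit on all cosets does not yet bound the exceptions, as there may be
    infinitely many cosets. But on a coset that misses \<open>D\<close> the function is constant,
    and its value must be the limit \<open>b\<close> because the vertex group is infinite. So all
    exceptions lie on the cosets through the finite set \<open>D\<close>, finitely many on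
    each.\<close>
  define D where "D = (\<Union>s\<in>vgens base. {h \<in> carrier G. A (h \<cdot> \<iota> base s) \<noteq> A h})"
  have D: "finite D"
    unfolding D_def using vgens(1,2)[OF base] A \<iota>_closed[OF base]
    by (intro finite_UN_I) (auto simp: almost_invariant_def)
  have "{g \<in> carrier G. A g \<noteq> b} \<subseteq>
      (\<Union>h\<in>D. (\<lambda>x. h \<cdot> \<iota> base x) ` {x \<in> carrier (vgroup \<Gamma> base). A (h \<cdot> \<iota> base x) \<noteq> b})"
  proof (rule subsetI, elim CollectE conjE)
    fix g assume g: "g \<in> carrier G" "A g \<noteq> b"
    have "\<exists>x\<in>carrier (vgroup \<Gamma> base). g \<cdot> \<iota> base x \<in> D"
    proof (rule ccontr)
      assume no: "\<not> ?thesis"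
      have "A (g \<cdot> \<iota> base (x \<otimes>\<^bsub>vgroup \<Gamma> base\<^esub> s)) = A (g \<cdot> \<iota> base x)"
        if x: "x \<in> carrier (vgroup \<Gamma> base)" and s: "s \<in> vgens base" for x s
      proof -
        have sc: "s \<in> carrier (vgroup \<Gamma> base)" using s vgens(2)[OF base] by auto
        have "g \<cdot> \<iota> base x \<notin> D" using no x by blast
        then have "A (g \<cdot> \<iota> base x \<cdot> \<iota> base s) = A (g \<cdot> \<iota> base x)"
          using g x s unfolding D_def by auto
        then show ?thesis using g x sc by (simp add: G.m_assoc)
      qed
      from V.G.invariant_generate[OF vgens(2)[OF base] this _ V.G.one_closed]
      have "A (g \<cdot> \<iota> base x) = A g" if "x \<in> carrier (vgroup \<Gamma> base)" for x
        using that vgens(3)[OF base] g by simp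
      then have "{x \<in> carrier (vgroup \<Gamma> base). A (g \<cdot> \<iota> base x) \<noteq> b} = carrier (vgroup \<Gamma> base)"
        using g by auto
      then show False using b[OF g(1)] inf[OF base] by (simp add: lim_def)
    qed
    then obtain x where x: "x \<in> carrier (vgroup \<Gamma> base)" "g \<cdot> \<iota> base x \<in> D" by blast
    have "g = g \<cdot> \<iota> base x \<cdot> \<iota> base (inv\<^bsub>vgroup \<Gamma> base\<^esub> x)"
      using g x by (simp add: G.m_assoc)
    with g x show "g \<in> (\<Union>h\<in>D. (\<lambda>x. h \<cdot> \<iota> base x) `
        {x \<in> carrier (vgroup \<Gamma> base). A (h \<cdot> \<iota> base x) \<noteq> b})"
      by (intro UN_I[OF x(2)] image_eqI[of _ _ "inv\<^bsub>vgroup \<Gamma> base\<^esub> x"]) auto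
  qed
  moreover have "finite (\<Union>h\<in>D. (\<lambda>x. h \<cdot> \<iota> base x) ` {x \<in> carrier (vgroup \<Gamma> base). A (h \<cdot> \<iota> base x) \<noteq> b})"
    using D b by (intro finite_UN_I finite_imageI) (auto simp: D_def lim_def)
  ultimately show ?thesis using finite_subset by blast
qed

end

theorem proposition6p1:
  fixes \<Gamma> :: "('v, 'e, 'a, 'c) gog" and T :: "'e set"
  assumes "QBS_graph \<Gamma>"
    and "finite (verts \<Gamma>)" and "finite (edges \<Gamma>)"
    and "reduced_gog \<Gamma>"
    and "spanning_tree \<Gamma> T"
    and "\<not> pi1 \<Gamma> T \<cong> integer_group"
  shows "one_ended_group (pi1 \<Gamma> T)"
proof -
  interpret reduced_QBS \<Gamma> T
    by unfold_locales (use assms in \<open>auto simp: QBS_graph_def\<close>)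
  show ?thesis
    by (rule G.one_ended_groupI[OF gens]) (rule almost_constant[OF _ assms(6)])
qed

end
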